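(* Let $\sigma$ be a finite nonnegative measure with infinite support on $[-1,1]$, let $s_{-1}\in\mathbb R$, and let $$\mathfrak F(\lambda)=\frac1\lambda\int_{-1}^1\frac{d\sigma(t)}{t-\lambda}-\frac{s_{-1}}{\lambda}\in\mathbf D^+_{-\infty},\qquad F(\lambda)=\int_{-1}^1\frac{d\sigma(t)}{t-\lambda}.$$ Let $\{\mathfrak n_j\}_{j\ge1}$ be the normal indices of the coefficient sequence $\mathfrak s_0=s_{-1}$, $\mathfrak s_{j}=\int t^{j-1}d\sigma(t)$ ($j\ge1$) of $\mathfrak F$, and $\mathfrak n_0=0$. Then the following statements are equivalent: (i) the operator $\mathfrak L$ in the block $LU$-factorization $\mathfrak J=\mathfrak L\mathfrak U$ of the monic generalized Jacobi matrix $\mathfrak J$ associated with $\mathfrak F$ is bounded in $\ell^2_{[0,\infty)}$; (ii) the operator $\mathfrak L=\mathfrak L(s_{-1})$ in the block $UL$-factorization $J=\mathfrak U\mathfrak L$, with the parameter $s_{-1}=\mathfrak s_0$, of the monic Jacobi matrix $J$ associated with $F$ is bounded in $\ell^2_{[0,\infty)}$; (iii) the sequence $\{\mathfrak F^{[\mathfrak n_j/\mathfrak n_j]}\}_{j=0}^\infty$ of diagonal Padé approximants converges to $\mathfrak F$ locally uniformly in $\widehat{\mathbb C}\setminus[-1-\varepsilon,1+\varepsilon]$ for some $\varepsilon\ge0$.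
   Context: $\widehat{\mathbb C}=\mathbb C\cup\{\infty\}$ with the spherical metric. $\lambda\widehat\to\infty$ means that $\lambda\to\infty$ inside a sector $\varepsilon<\arg\lambda<\pi-\varepsilon$, $\varepsilon>0$; $\mathfrak F(\lambda)\sim-\sum_j\mathfrak s_j\lambda^{-j-1}$ denotes the asymptotic expansion to all orders as $\lambda\widehat\to\infty$. $\mathbf N_{-\infty}$ is the class of functions $\int_{\mathbb R}\frac{d\mu(t)}{t-\lambda}$ with $\mu$ a finite measure with all moments finite. $\mathbf D^+_{-\infty}$: functions $\mathfrak F$ meromorphic in $\mathbb C_+$ with $\mathfrak F\sim-\sum_{j\ge0}\mathfrak s_j\lambda^{-j-1}$, $\mathfrak s_j\in\mathbb R$, and $\lambda\mathfrak F(\lambda)+\mathfrak s_0\in\mathbf N_{-\infty}$. Padé approximants: for a formal power series $\mathfrak F=-\sum_{j\ge0}\mathfrak s_j\lambda^{-j-1}$, the $[L/M]$ approximant is a ratio $A(1/\lambda)/B(1/\lambda)$ of polynomials of formal degrees $L$ and $M$ with $B(0)\neq0$ and $\sum_{j=0}^{L+M-1}\mathfrak s_j\lambda^{-j-1}+\mathfrak F^{[L/M]}(\lambda)=O(\lambda^{-L-M-1})$, $\lambda\to\infty$. Jacobi matrix: $s_j=\int t^jd\sigma$, $j\ge0$; the monic orthogonal polynomials $P_j$ of $\sigma/s_0$ satisfy $\lambda P_j=P_{j+1}+b_jP_j+c_{j-1}P_{j-1}$, $P_{-1}=0$, $P_0=1$; $Q_j(\lambda)=\int\frac{P_j(\lambda)-P_j(t)}{\lambda-t}d\sigma(t)$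 are the polynomials of the second kind; the monic Jacobi matrix associated with $F$ has $J_{j,j}=b_j$, $J_{j,j+1}=1$, $J_{j+1,j}=c_j$. Normal indices of $\{\mathfrak s_j\}_{j\ge0}$: integers $n\ge1$ with $\det(\mathfrak s_{i+k})_{i,k=0}^{n-1}\ne0$, listed increasingly $\mathfrak n_1<\mathfrak n_2<\dots$; $\mathfrak n_0=0$, $\mathfrak k_j=\mathfrak n_{j+1}-\mathfrak n_j\in\{1,2\}$. Generalized Jacobi matrix: $\mathfrak F$ (nonrational) is normalized if its first nonzero coefficient $\mathfrak s_{\mathfrak n_1-1}$ has modulus $1$. For normalized $\mathfrak F$ put $\mathfrak F_0=\mathfrak F$ and recursively $-1/\mathfrak F_j(\lambda)=\epsilon_j\mathfrak p_j(\lambda)+\mathfrak b_j^2\mathfrak F_{j+1}(\lambda)$, where $\epsilon_j=\pm1$ is the first nonzero asymptotic coefficient of $\mathfrak F_j$, $\mathfrak p_j$ is the monic polynomial (of degree $\mathfrak k_j$) with $-1/\mathfrak F_j-\epsilon_j\mathfrak p_j=o(1)$ as $\lambda\widehat\to\infty$, and $\mathfrak b_j>0$ makes $\mathfrak F_{j+1}$ normalized. Put $\mathfrak c_j=\epsilon_j\epsilon_{j+1}\mathfrak b_j^2$; $\mathfrak p_j(\lambda)=\lambda+\mathfrak p_0^{(j)}$ if $\mathfrak k_j=1$, $\mathfrak p_j(\lambda)=\lambda^2+\mathfrak p_1^{(j)}\lambda+\mathfrak p_0^{(j)}$ if $\mathfrak k_j=2$. The monic generalized Jacobi matrix associated with $\mathfrak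 F$ is the block tridiagonal matrix with diagonal blocks $-\mathfrak p_0^{(j)}$ ($\mathfrak k_j=1$) or $\begin{pmatrix}0&1\\-\mathfrak p_0^{(j)}&-\mathfrak p_1^{(j)}\end{pmatrix}$ ($\mathfrak k_j=2$), superdiagonal $\mathfrak k_j\times\mathfrak k_{j+1}$ blocks with lower-left entry $1$ and other entries $0$, and subdiagonal $\mathfrak k_{j+1}\times\mathfrak k_j$ blocks with lower-left entry $\mathfrak c_j$ and other entries $0$. For $\mathfrak F$ not normalized one uses $\mathfrak F/|\mathfrak s_{\mathfrak n_1-1}|$. Form of $\mathfrak L$ and $\mathfrak U$: $\mathfrak L$ is block lower bidiagonal with diagonal blocks $\mathfrak E_j$ and subdiagonal blocks $\mathfrak L_j$ ($\mathfrak k_j\times\mathfrak k_{j-1}$, in block row $j\ge1$, lower-right entry $\mathfrak l_j$, other entries $0$); $\mathfrak U$ is block upper bidiagonal with diagonal blocks $\mathfrak U_j$ and superdiagonal blocks $\mathfrak D_j$ ($\mathfrak k_j\times\mathfrak k_{j+1}$, lower-left entry $1$, other entries $0$); here $\mathfrak U_j=\mathfrak u_j$, $\mathfrak E_j=1$ if $\mathfrak k_j=1$, and $\mathfrak U_j=\begin{pmatrix}0&1\\ \mathfrak u_j&0\end{pmatrix}$, $\mathfrak E_j=\begin{pmatrix}1&0\\ \mathfrak e_j&1\end{pmatrix}$ if $\mathfrak k_j=2$. In (i), $\mathfrak J=\mathfrak L\mathfrak U$ is the factorization of this form with $\mathfrak u_j=-\mathfrak P_{j+1}(0)/\mathfrak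 P_j(0)$, $\mathfrak l_{j+1}=\mathfrak c_j/\mathfrak u_j$, $\mathfrak e_j=-\mathfrak p_1^{(j)}$, where $\mathfrak P_{-1}=0$, $\mathfrak P_0=1$, $\mathfrak P_{j+1}=\mathfrak p_j\mathfrak P_j-\mathfrak c_{j-1}\mathfrak P_{j-1}$ (one has $\mathfrak P_j(0)\ne0$). In (ii), $J=\mathfrak U\mathfrak L$ is the factorization of this form with $\mathfrak l_j=-\widehat P_{\mathfrak n_{j+1}-1}(0)/\widehat P_{\mathfrak n_j-1}(0)$, $j\in\mathbb N$, where $\widehat P_j=Q_j+s_{-1}P_j$ (one has $\widehat P_{\mathfrak n_j-1}(0)\neq0$). A matrix is bounded in $\ell^2_{[0,\infty)}$ if it defines a bounded operator there. *)

theory Defs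
  imports
    "HOL-Complex_Analysis.Complex_Analysis"
    "HOL-Library.Landau_Symbols"
    "HOL-Library.Infinite_Set"
    "Jordan_Normal_Form.Determinant"
begin

section \<open>The Riemann sphere with the spherical metric\<close>

datatype csphere = Fin complex | Infty

text \<open>Inverse stereographic projection onto the unit sphere of \<open>\<complex> \<times> \<real>\<close>;
  the spherical metric is the (chordal) distance of the images.\<close>

fun to_sphere :: "csphere \<Rightarrow> complex \<times> real" where
  "to_sphere (Fin z) =
     (2 * z / of_real (1 + (cmod z)\<^sup>2), ((cmod z)\<^sup>2 - 1) / ((cmod z)\<^sup>2 + 1))"
| "to_sphere Infty = (0, 1)"

lemma to_sphere_Fin_inj:
  assumes "to_sphere (Fin z) = to_sphere (Fin w)"
  shows "z = w"
proof -
  have pos: "1 + (cmod x)\<^sup>2 > 0" for x by (simp add: add_pos_nonneg)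
  have "((cmod z)\<^sup>2 - 1) / ((cmod z)\<^sup>2 + 1) = ((cmod w)\<^sup>2 - 1) / ((cmod w)\<^sup>2 + 1)"
    using assms by simp
  then have eq: "(cmod z)\<^sup>2 = (cmod w)\<^sup>2"
    using pos[of z] pos[of w] by (simp add: field_simps)
  have "2 * z / of_real (1 + (cmod z)\<^sup>2) = 2 * w / of_real (1 + (cmod w)\<^sup>2)"
    using assms by simp
  moreover have "complex_of_real (1 + (cmod z)\<^sup>2) \<noteq> 0"
    using pos[of z] by (metis less_irrefl of_real_eq_0_iff)
  ultimately show ?thesis unfolding eq by (simp add: eq)
qed

lemma to_sphere_Fin_Infty: "to_sphere (Fin z) \<noteq> to_sphere Infty"
proof -
  have "(cmod z)\<^sup>2 + 1 > 0" by (simp add: add_nonneg_pos)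
  then show ?thesis by (simp add: field_simps)
qed

lemma inj_to_sphere: "inj to_sphere"
proof (rule injI)
  fix x y assume "to_sphere x = to_sphere y"
  then show "x = y"
    by (cases x; cases y)
      (metis to_sphere_Fin_inj to_sphere_Fin_Infty)+
qed

instantiation csphere :: metric_space
begin

definition dist_csphere :: "csphere \<Rightarrow> csphere \<Rightarrow> real" where
  "dist_csphere x y = dist (to_sphere x) (to_sphere y)"

definition uniformity_csphere :: "(csphere \<times> csphere) filter" where
  "uniformity_csphere = (INF e\<in>{0<..}. principal {(x, y). dist x y < e})"

definition open_csphere :: "csphere set \<Rightarrow> bool" where
  "open_csphere U \<longleftrightarrow> (\<forall>x\<in>U. eventually (\<lambda>(x', y). x' = x \<longrightarrow> y \<in> U) uniformity)"

instance
proof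
  fix x y z :: csphere
  show "dist x y = 0 \<longleftrightarrow> x = y"
    using inj_to_sphere by (auto simp: dist_csphere_def dest: injD)
  show "dist x y \<le> dist x z + dist y z"
    unfolding dist_csphere_def by (rule dist_triangle2)
qed (simp_all add: uniformity_csphere_def open_csphere_def)

end

definition locally_uniform_limit ::
    "'a::topological_space set \<Rightarrow> (nat \<Rightarrow> 'a \<Rightarrow> 'b::metric_space) \<Rightarrow> ('a \<Rightarrow> 'b) \<Rightarrow> bool" where
  "locally_uniform_limit D f g \<longleftrightarrow>
     (\<forall>x\<in>D. \<exists>U. open U \<and> x \<in> U \<and> uniform_limit (U \<inter> D) f g sequentially)"

text \<open>Extension to \<open>Infty\<close> of a function that vanishes at infinity.\<close>

definition extend_zero :: "(complex \<Rightarrow> complex) \<Rightarrow> csphere \<Rightarrow> csphere" where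
  "extend_zero f x = (case x of Fin z \<Rightarrow> Fin (f z) | Infty \<Rightarrow> Fin 0)"


section \<open>Asymptotic expansions and function classes\<close>

definition sector_at_infinity :: "real \<Rightarrow> complex filter" where
  "sector_at_infinity \<epsilon> = inf at_infinity (principal {z. \<epsilon> < Arg z \<and> Arg z < pi - \<epsilon>})"

text \<open>\<open>f \<sim> - (\<Sum>j. s j / \<lambda>^(j+1))\<close> to all orders.\<close>

definition asymp_expansion :: "(complex \<Rightarrow> complex) \<Rightarrow> (nat \<Rightarrow> real) \<Rightarrow> bool" where
  "asymp_expansion f s \<longleftrightarrow>
     (\<forall>\<epsilon>>0. \<forall>n. (\<lambda>z. f z + (\<Sum>j<n. complex_of_real (s j) / z ^ (j + 1)))
        \<in> o[sector_at_infinity \<epsilon>](\<lambda>z. 1 / z ^ n))"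

definition asymp_coeffs :: "(complex \<Rightarrow> complex) \<Rightarrow> nat \<Rightarrow> real" where
  "asymp_coeffs f = (THE s. asymp_expansion f s)"

definition cauchy_transform :: "real measure \<Rightarrow> complex \<Rightarrow> complex" where
  "cauchy_transform \<mu> z = (\<integral>t. 1 / (complex_of_real t - z) \<partial>\<mu>)"

definition N_minf :: "(complex \<Rightarrow> complex) set" where
  "N_minf = {f. \<exists>\<mu>. finite_measure \<mu> \<and> sets \<mu> = sets borel \<and> (\<forall>n. integrable \<mu> (\<lambda>t. t ^ n)) \<and>
     (\<forall>z. Im z > 0 \<longrightarrow> f z = cauchy_transform \<mu> z)}"

definition D_plus_minf :: "(complex \<Rightarrow> complex) set" where
  "D_plus_minf = {f. f meromorphic_on {z. Im z > 0} \<and>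
     (\<exists>s. asymp_expansion f s \<and> (\<lambda>z. z * f z + complex_of_real (s 0)) \<in> N_minf)}"

definition measure_support :: "real measure \<Rightarrow> real set" where
  "measure_support \<mu> = {x. \<forall>U. open U \<and> x \<in> U \<longrightarrow> emeasure \<mu> U > 0}"


section \<open>Normal indices and Pade approximants\<close>

definition hankel :: "(nat \<Rightarrow> real) \<Rightarrow> nat \<Rightarrow> real mat" where
  "hankel s n = Matrix.mat n n (\<lambda>(i, k). s (i + k))"

primrec normal_index :: "(nat \<Rightarrow> real) \<Rightarrow> nat \<Rightarrow> nat" where
  "normal_index s 0 = 0"
| "normal_index s (Suc j) = enumerate {n. n \<ge> 1 \<and> Determinant.det (hankel s n) \<noteq> 0} j"

text \<open>\<open>R\<close> is the rational function \<open>A(1/\<lambda>) / B(1/\<lambda>)\<close>, viewed as a continuous map of the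
  Riemann sphere to itself. Continuity fixes its values at poles, at common zeros of
  numerator and denominator, and at \<open>0\<close> and \<open>\<infinity>\<close>.\<close>

definition is_pade_approximant ::
    "(nat \<Rightarrow> real) \<Rightarrow> nat \<Rightarrow> nat \<Rightarrow> (csphere \<Rightarrow> csphere) \<Rightarrow> bool" where
  "is_pade_approximant s L M R \<longleftrightarrow> continuous_on UNIV R \<and>
     (\<exists>A B :: complex poly. degree A \<le> L \<and> degree B \<le> M \<and> poly B 0 \<noteq> 0 \<and>
        (\<forall>z. z \<noteq> 0 \<and> poly B (1 / z) \<noteq> 0 \<longrightarrow> R (Fin z) = Fin (poly A (1 / z) / poly B (1 / z))) \<and>
        (\<lambda>z. (\<Sum>j<L + M. complex_of_real (s j) / z ^ (j + 1)) + poly A (1 / z) / poly B (1 / z))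
          \<in> O[at_infinity](\<lambda>z. 1 / z ^ (L + M + 1)))"

definition pade :: "(nat \<Rightarrow> real) \<Rightarrow> nat \<Rightarrow> nat \<Rightarrow> csphere \<Rightarrow> csphere" where
  "pade s L M = (THE R. is_pade_approximant s L M R)"


section \<open>Infinite matrices\<close>

type_synonym inf_mat = "nat \<Rightarrow> nat \<Rightarrow> real"

text \<open>Only used for matrices with finitely many nonzero entries in each row.\<close>

definition inf_mat_mult :: "inf_mat \<Rightarrow> inf_mat \<Rightarrow> inf_mat" where
  "inf_mat_mult A B = (\<lambda>i k. \<Sum>m. A i m * B m k)"

definition in_l2 :: "(nat \<Rightarrow> complex) \<Rightarrow> bool" where
  "in_l2 x \<longleftrightarrow> summable (\<lambda>n. (cmod (x n))\<^sup>2)"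

definition l2_norm :: "(nat \<Rightarrow> complex) \<Rightarrow> real" where
  "l2_norm x = sqrt (\<Sum>n. (cmod (x n))\<^sup>2)"

definition inf_mat_vec :: "inf_mat \<Rightarrow> (nat \<Rightarrow> complex) \<Rightarrow> nat \<Rightarrow> complex" where
  "inf_mat_vec A x = (\<lambda>i. \<Sum>m. complex_of_real (A i m) * x m)"

definition bounded_in_l2 :: "inf_mat \<Rightarrow> bool" where
  "bounded_in_l2 A \<longleftrightarrow> (\<exists>C. \<forall>x. in_l2 x \<longrightarrow>
     (\<forall>i. summable (\<lambda>m. complex_of_real (A i m) * x m)) \<and>
     in_l2 (inf_mat_vec A x) \<and> l2_norm (inf_mat_vec A x) \<le> C * l2_norm x)"

text \<open>Given a strictly increasing \<open>n\<close> with \<open>n 0 = 0\<close>, rows and columns are partitioned into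
  the blocks \<open>{n j..<n (Suc j)}\<close>; \<open>B i j r c\<close> is the entry \<open>(r, c)\<close> (counted from \<open>0\<close>) of the
  block in block row \<open>i\<close> and block column \<open>j\<close>.\<close>

definition block_of :: "(nat \<Rightarrow> nat) \<Rightarrow> nat \<Rightarrow> nat" where
  "block_of n i = (LEAST j. i < n (Suc j))"

definition block_matrix ::
    "(nat \<Rightarrow> nat) \<Rightarrow> (nat \<Rightarrow> nat \<Rightarrow> nat \<Rightarrow> nat \<Rightarrow> real) \<Rightarrow> inf_mat" where
  "block_matrix n B = (\<lambda>i k.
     B (block_of n i) (block_of n k) (i - n (block_of n i)) (k - n (block_of n k)))"

abbreviation block_size :: "(nat \<Rightarrow> nat) \<Rightarrow> nat \<Rightarrow> nat" where
  "block_size n j \<equiv> n (Suc j) - n j"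

definition block_L :: "(nat \<Rightarrow> nat) \<Rightarrow> (nat \<Rightarrow> real) \<Rightarrow> (nat \<Rightarrow> real) \<Rightarrow> inf_mat" where
  "block_L n l e = block_matrix n (\<lambda>i j r c.
     if i = j then
       (if block_size n j = 1 then 1 else [[1, 0], [e j, 1]] ! r ! c)
     else if i = Suc j then
       (if r = block_size n i - 1 \<and> c = block_size n j - 1 then l i else 0)
     else 0)"

definition block_U :: "(nat \<Rightarrow> nat) \<Rightarrow> (nat \<Rightarrow> real) \<Rightarrow> inf_mat" where
  "block_U n u = block_matrix n (\<lambda>i j r c.
     if i = j then
       (if block_size n j = 1 then u j else [[0, 1], [u j, 0]] ! r ! c)
     else if j = Suc i then
       (if r = block_size n i - 1 \<and> c = 0 then 1 else 0)
     else 0)"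


section \<open>The monic Jacobi matrix of a measure\<close>

text \<open>\<open>\<sigma> / s\<^sub>0\<close>\<close>

definition normalized_measure :: "real measure \<Rightarrow> real measure" where
  "normalized_measure \<sigma> = scale_measure (ennreal (1 / (\<integral>t. 1 \<partial>\<sigma>))) \<sigma>"

definition monic_op :: "real measure \<Rightarrow> nat \<Rightarrow> real poly" where
  "monic_op \<sigma> j = (THE p. degree p = j \<and> lead_coeff p = 1 \<and>
     (\<forall>i<j. (\<integral>t. poly p t * t ^ i \<partial>(normalized_measure \<sigma>)) = 0))"

definition recurrence_coeffs :: "real measure \<Rightarrow> (nat \<Rightarrow> real) \<times> (nat \<Rightarrow> real)" where
  "recurrence_coeffs \<sigma> = (THE (b, c). \<forall>j.
     [:0, 1:] * monic_op \<sigma> j = monic_op \<sigma> (Suc j) + Polynomial.smult (b j) (monic_op \<sigma> j) +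
       (if j = 0 then 0 else Polynomial.smult (c (j - 1)) (monic_op \<sigma> (j - 1))))"

definition jacobi_matrix :: "real measure \<Rightarrow> inf_mat" where
  "jacobi_matrix \<sigma> = (let (b, c) = recurrence_coeffs \<sigma> in
     (\<lambda>i k. if k = i then b i else if k = Suc i then 1 else if i = Suc k then c k else 0))"

text \<open>The difference quotient of a polynomial is itself a polynomial, so its value on the
  diagonal is the derivative; this matters when \<open>\<sigma>\<close> has an atom at \<open>x\<close>.\<close>

definition diff_quotient :: "real poly \<Rightarrow> real \<Rightarrow> real \<Rightarrow> real" where
  "diff_quotient p x t =
     (if t = x then poly (pderiv p) x else (poly p x - poly p t) / (x - t))"

definition second_kind :: "real measure \<Rightarrow> nat \<Rightarrow> real \<Rightarrow> real" where
  "second_kind \<sigma> j x = (\<integral>t. diff_quotient (monic_op \<sigma> j) x t \<partial>\<sigma>)"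

definition P_hat :: "real measure \<Rightarrow> real \<Rightarrow> nat \<Rightarrow> real \<Rightarrow> real" where
  "P_hat \<sigma> s_m1 j x = second_kind \<sigma> j x + s_m1 * poly (monic_op \<sigma> j) x"


section \<open>The monic generalized Jacobi matrix of a function\<close>

definition first_coeff :: "(complex \<Rightarrow> complex) \<Rightarrow> real" where
  "first_coeff f = asymp_coeffs f (LEAST n. asymp_coeffs f n \<noteq> 0)"

definition normalized :: "(complex \<Rightarrow> complex) \<Rightarrow> bool" where
  "normalized f \<longleftrightarrow> \<bar>first_coeff f\<bar> = 1"

text \<open>One step \<open>- 1 / f = \<epsilon> p + b\<^sup>2 g\<close> of the expansion of a normalized \<open>f\<close>, where
  \<open>\<epsilon> = first_coeff f\<close>.\<close>

definition step_poly :: "(complex \<Rightarrow> complex) \<Rightarrow> real poly" where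
  "step_poly f = (THE p. lead_coeff p = 1 \<and> (\<forall>\<delta>>0.
     (\<lambda>z. - 1 / f z - complex_of_real (first_coeff f) * poly (map_poly complex_of_real p) z)
       \<in> o[sector_at_infinity \<delta>](\<lambda>_. 1)))"

definition step_remainder :: "(complex \<Rightarrow> complex) \<Rightarrow> complex \<Rightarrow> complex" where
  "step_remainder f z =
     - 1 / f z - complex_of_real (first_coeff f) * poly (map_poly complex_of_real (step_poly f)) z"

definition step_b :: "(complex \<Rightarrow> complex) \<Rightarrow> real" where
  "step_b f = (THE b. b > 0 \<and> normalized (\<lambda>z. step_remainder f z / complex_of_real (b\<^sup>2)))"

primrec gj_fun :: "(complex \<Rightarrow> complex) \<Rightarrow> nat \<Rightarrow> complex \<Rightarrow> complex" where
  "gj_fun f 0 = (\<lambda>z. f z / complex_of_real \<bar>first_coeff f\<bar>)"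
| "gj_fun f (Suc j) =
     (\<lambda>z. step_remainder (gj_fun f j) z / complex_of_real ((step_b (gj_fun f j))\<^sup>2))"

definition gj_p :: "(complex \<Rightarrow> complex) \<Rightarrow> nat \<Rightarrow> real poly" where
  "gj_p f j = step_poly (gj_fun f j)"

definition gj_c :: "(complex \<Rightarrow> complex) \<Rightarrow> nat \<Rightarrow> real" where
  "gj_c f j = first_coeff (gj_fun f j) * first_coeff (gj_fun f (Suc j)) * (step_b (gj_fun f j))\<^sup>2"

definition gen_jacobi_matrix :: "(complex \<Rightarrow> complex) \<Rightarrow> inf_mat" where
  "gen_jacobi_matrix f = (let n = normal_index (asymp_coeffs f) in
     block_matrix n (\<lambda>i j r c.
       if i = j then
         (if block_size n j = 1 then - coeff (gj_p f j) 0
          else [[0, 1], [- coeff (gj_p f j) 0, - coeff (gj_p f j) 1]] ! r ! c)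
       else if j = Suc i then
         (if r = block_size n i - 1 \<and> c = 0 then 1 else 0)
       else if i = Suc j then
         (if r = block_size n i - 1 \<and> c = 0 then gj_c f j else 0)
       else 0))"

fun gj_P :: "(complex \<Rightarrow> complex) \<Rightarrow> nat \<Rightarrow> real poly" where
  "gj_P f 0 = 1"
| "gj_P f (Suc 0) = gj_p f 0"
| "gj_P f (Suc (Suc j)) = gj_p f (Suc j) * gj_P f (Suc j) - Polynomial.smult (gj_c f j) (gj_P f j)"


section \<open>Block factorizations\<close>

definition block_LU_factors :: "(complex \<Rightarrow> complex) \<Rightarrow> inf_mat \<Rightarrow> inf_mat \<Rightarrow> bool" where
  "block_LU_factors f L U \<longleftrightarrow> (let n = normal_index (asymp_coeffs f) in
     \<exists>u l e. L = block_L n l e \<and> U = block_U n u \<and>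
       (\<forall>j. u j = - poly (gj_P f (Suc j)) 0 / poly (gj_P f j) 0) \<and>
       (\<forall>j. l (Suc j) = gj_c f j / u j) \<and>
       (\<forall>j. block_size n j = 2 \<longrightarrow> e j = - coeff (gj_p f j) 1) \<and>
       gen_jacobi_matrix f = inf_mat_mult L U)"

text \<open>Here \<open>n\<close> is the sequence of normal indices of \<open>s_m1, s\<^sub>0, s\<^sub>1, \<dots>\<close>. The entries \<open>u\<close> and \<open>e\<close>
  are determined by the factorization.\<close>

definition block_UL_factors ::
    "real measure \<Rightarrow> real \<Rightarrow> (nat \<Rightarrow> nat) \<Rightarrow> inf_mat \<Rightarrow> inf_mat \<Rightarrow> bool" where
  "block_UL_factors \<sigma> s_m1 n U L \<longleftrightarrow>
     (\<exists>u l e. U = block_U n u \<and> L = block_L n l e \<and>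
       (\<forall>j\<ge>1. l j = - P_hat \<sigma> s_m1 (n (Suc j) - 1) 0 / P_hat \<sigma> s_m1 (n j - 1) 0) \<and>
       jacobi_matrix \<sigma> = inf_mat_mult U L)"

end

theory Submission
  imports Defs
begin

text \<open>
  Write \<open>lint p\<close> for the integral of a polynomial \<open>p\<close>, \<open>P n\<close> for the monic orthogonal polynomials, with
  recurrence coefficients \<open>\<beta> n\<close>, \<open>\<gamma> n\<close> and squared norms \<open>h n\<close>, and let
  \<open>sf p = s\<^sub>-\<^sub>1 p(0) + lint ((p - p(0)) / t)\<close> be the functional whose moments are the coefficients of the
  given function. Put \<open>\<xi> n = sf (P n)\<close>, which is the value at \<open>0\<close> of the polynomial \<open>Q\<^sub>n + s\<^sub>-\<^sub>1 P\<^sub>n\<close>. An index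
  \<open>n + 1\<close> is normal iff \<open>\<xi> n \<noteq> 0\<close>, and two consecutive \<open>\<xi>\<close> never vanish together, so that blocks have
  size \<open>1\<close> or \<open>2\<close>. Let \<open>\<nu> j\<close> be the normal indices and \<open>\<delta> j = \<xi> (\<nu> j) / \<xi> (\<nu> j - 1)\<close>. Each of the three
  statements is shown to be equivalent to the boundedness of the sequence \<open>\<delta>\<close>.

  The lower triangular factor. The entries \<open>l\<close> of the factor in \<open>J = U L\<close> are
  \<open>- \<xi> (\<nu> (j + 1) - 1) / \<xi> (\<nu> j - 1)\<close>; this is \<open>- \<delta> j\<close> for a block of size \<open>1\<close>, and \<open>\<gamma> (\<nu> j - 1) \<le> 1\<close> with
  \<open>\<delta> j = 0\<close> for a block of size \<open>2\<close>. The recurrence for \<open>\<xi>\<close> gives the factorization, with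
  \<open>e j = \<beta> (\<nu> j)\<close>. A banded matrix is bounded iff its entries are, and \<open>\<bar>\<beta>\<bar> \<le> 1\<close>
  (\<open>block_UL_bounded_iff\<close>).

  The generalized Jacobi matrix. The polynomials \<open>G j = P (\<nu> j) - \<delta> j P (\<nu> j - 1)\<close> are orthogonal with
  respect to \<open>sf\<close> and satisfy \<open>G (j+2) = pp (j+1) G (j+1) - cc j G j\<close>. Their functions of the second
  kind \<open>rt (G j)\<close>, its Cauchy transforms, obey the same recurrence, and their quotients of
  consecutive index are, up to constants, the functions in the continued fraction expansion. All
  these functions have convergent expansions at infinity with real coefficients, so \<open>pp\<close> and \<open>cc\<close> are
  the data of the generalized Jacobi matrix (\<open>gj_identification\<close>). The factor in its LU factorization
  is then literally the same matrix as in \<open>J = U L\<close>, because \<open>G j (0) \<xi> (\<nu> j - 1) = - h (\<nu> j - 1)\<close>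
  for \<open>j > 0\<close> (\<open>G_at_0\<close>, \<open>block_LU_bounded_iff\<close>).

  Pade approximants. The approximant with index \<open>\<nu> j\<close> has denominator \<open>G j\<close>, its error is
  \<open>rt (G j) / G j\<close>, and \<open>rt (G j) z = (1 / z) \<integral> G j (t) / (t - z) d\<sigma>\<close> for \<open>j > 0\<close>. Off the real axis
  no bound on \<open>\<delta>\<close> is needed: by orthogonality \<open>G j (z) \<integral> G j (t) / (t - z) d\<sigma>\<close> has the imaginary part
  of \<open>\<integral> G j (t)\<^sup>2 / (t - z) d\<sigma>\<close>, whose modulus is at least a constant times the squared norm of \<open>G j\<close>, while the
  integral \<open>\<integral> G j (t) / (t - z) d\<sigma>\<close> itself is geometrically small relative to the norm, because
  \<open>1 / (t - z)\<close> can be expanded about a far centre whose disc contains the interval but not \<open>z\<close>. Far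
  from the interval \<open>\<bar>P (n+1)\<bar> \<ge> (\<bar>z\<bar> - 2) \<bar>P n\<bar>\<close>, so a bound on \<open>\<delta>\<close> keeps \<open>G j\<close> away from zero there
  (\<open>pade_converges\<close>). Conversely, convergence near infinity excludes poles outside some disc, whereas a
  large \<open>\<bar>\<delta> j\<bar>\<close> would force a sign change of \<open>G j\<close> on the real axis far out
  (\<open>\<delta>_bounded_if_pade_converges\<close>).
\<close>

section \<open>Orthogonal polynomials of a measure on the interval\<close>

text \<open>A finite measure on \<open>[-1, 1]\<close> with infinite support.\<close>

locale interval_measure =
  fixes \<sigma> :: "real measure"
  assumes finite_sigma: "finite_measure \<sigma>" and sets_sigma: "sets \<sigma> = sets borel"
    and null_outside: "emeasure \<sigma> (- {-1..1}) = 0"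
    and infinite_support: "infinite (measure_support \<sigma>)"
begin

sublocale finite_measure \<sigma> by (rule finite_sigma)

lemma AE_interval: "AE t in \<sigma>. t \<in> {-1..1}"
proof (rule AE_I[where N = "- {-1..1}"])
  show "- {-1..1} \<in> sets \<sigma>" by (simp add: sets_sigma)
qed (use null_outside in auto)

lemma space_sigma: "space \<sigma> = UNIV"
  using sets_eq_imp_space_eq[OF sets_sigma] by simp

lemma borel_sigma: "f \<in> borel_measurable borel \<Longrightarrow> f \<in> borel_measurable \<sigma>"
  using measurable_cong_sets[OF sets_sigma refl] by blast

lemma integrable_bounded:
  fixes f :: "real \<Rightarrow> 'b::{banach, second_countable_topology}"
  assumes "f \<in> borel_measurable borel" and "\<And>t. t \<in> {-1..1} \<Longrightarrow> norm (f t) \<le> B"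
  shows "integrable \<sigma> f"
proof (rule integrable_const_bound)
  show "AE t in \<sigma>. norm (f t) \<le> B" using AE_interval by eventually_elim (use assms in auto)
qed (use assms borel_sigma in auto)

lemma poly_bounded_interval:
  fixes p :: "real poly"
  obtains B where "\<And>t. t \<in> {-1..1} \<Longrightarrow> \<bar>poly p t\<bar> \<le> B"
proof -
  have "compact (poly p ` {-1..1})"
    by (intro compact_continuous_image continuous_intros compact_Icc)
  then have "bounded (poly p ` {-1..1})" by (rule compact_imp_bounded)
  then obtain B where "\<forall>y \<in> poly p ` {-1..1}. norm y \<le> B" unfolding bounded_iff by blast
  then show ?thesis by (intro that[of B]) auto
qed

lemma integrable_poly [simp, intro]: "integrable \<sigma> (poly p)"
proof -
  obtain B where "\<And>t. t \<in> {-1..1} \<Longrightarrow> \<bar>poly p t\<bar> \<le> B" using poly_bounded_interval[of p] by blast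
  then show ?thesis by (intro integrable_bounded) (auto intro!: borel_measurable_continuous_onI continuous_intros)
qed

text \<open>The integral of a polynomial.\<close>

definition lint :: "real poly \<Rightarrow> real" where
  "lint p = (\<integral>t. poly p t \<partial>\<sigma>)"

lemma lint_0 [simp]: "lint 0 = 0" by (simp add: lint_def)

lemma lint_add: "lint (p + q) = lint p + lint q"
  by (simp add: lint_def Bochner_Integration.integral_add integrable_poly[unfolded fun_eq_iff])

lemma lint_minus: "lint (- p) = - lint p"
  by (simp add: lint_def)

lemma lint_diff: "lint (p - q) = lint p - lint q"
  using lint_add[of p "-q"] lint_minus by simp

lemma lint_smult: "lint (Polynomial.smult a p) = a * lint p"
  by (simp add: lint_def)

lemma lint_sum: "lint (\<Sum>i\<in>A. p i) = (\<Sum>i\<in>A. lint (p i))"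
  by (induction A rule: infinite_finite_induct) (auto simp: lint_add)

text \<open>The form is positive definite: a polynomial that vanishes almost everywhere vanishes on the
  support, which is infinite.\<close>

lemma lint_square_pos:
  assumes "p \<noteq> 0" shows "lint (p * p) > 0"
proof (rule ccontr)
  assume "\<not> lint (p * p) > 0"
  moreover have "lint (p * p) \<ge> 0" unfolding lint_def by (intro integral_nonneg_AE) auto
  ultimately have "lint (p * p) = 0" by simp
  then have "AE t in \<sigma>. poly (p * p) t = 0"
    unfolding lint_def by (subst (asm) integral_nonneg_eq_0_iff_AE) auto
  then have ae: "AE t in \<sigma>. poly p t = 0" by simp
  let ?U = "{t. poly p t \<noteq> 0}"
  have op: "open ?U"
    by (intro open_Collect_neq continuous_intros)
  have "emeasure \<sigma> ?U = 0"
    using ae op by (subst (asm) AE_iff_measurable[where N = ?U])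
      (auto simp: space_sigma sets_sigma)
  then have "measure_support \<sigma> \<subseteq> {t. poly p t = 0}"
    using op unfolding measure_support_def by force
  then show False using poly_roots_finite[OF assms] infinite_support finite_subset by blast
qed

lemma lint_eq_0_if_orthogonal:
  assumes "\<And>i. i \<le> degree q \<Longrightarrow> lint (p * monom 1 i) = 0"
  shows "lint (p * q) = 0"
proof -
  have "p * q = (\<Sum>i\<le>degree q. Polynomial.smult (coeff q i) (p * monom 1 i))"
  proof -
    have "(\<Sum>i\<le>degree q. Polynomial.smult (coeff q i) (p * monom 1 i)) = p * (\<Sum>i\<le>degree q. monom (coeff q i) i)"
      by (simp add: sum_distrib_left mult_smult_right[symmetric] smult_monom del: mult_smult_right)
    then show ?thesis by (simp add: poly_as_sum_of_monoms)
  qed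
  then show ?thesis using assms by (simp add: lint_sum lint_smult)
qed

text \<open>\<open>p\<close> is the monic orthogonal polynomial of degree \<open>n\<close>.\<close>

definition is_op :: "nat \<Rightarrow> real poly \<Rightarrow> bool" where
  "is_op n p \<longleftrightarrow> degree p = n \<and> lead_coeff p = 1 \<and> (\<forall>i<n. lint (p * monom 1 i) = 0)"

lemma is_opD:
  assumes "is_op n p"
  shows "degree p = n" "lead_coeff p = 1" "coeff p n = 1" "p \<noteq> 0"
    "\<And>q. degree q < n \<Longrightarrow> lint (p * q) = 0"
  using assms lint_eq_0_if_orthogonal[of _ p] unfolding is_op_def
  by (auto intro: le_less_trans)

lemma degree_diff_monic_less:
  fixes p q :: "real poly"
  assumes "degree p = n" "degree q = n" "coeff p n = coeff q n" "p \<noteq> q"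
  shows "degree (p - q) < n"
proof -
  have "degree (p - q) \<le> n" using assms by (metis degree_diff_le order_refl)
  moreover have "degree (p - q) \<noteq> n"
  proof
    assume "degree (p - q) = n"
    then have "lead_coeff (p - q) = 0" using assms(3) by simp
    then show False using assms(4) by (simp only: leading_coeff_0_iff eq_iff_diff_eq_0[symmetric])
  qed
  ultimately show ?thesis by simp
qed

lemma degree_less_if_coeff_eq_0:
  assumes "degree p \<le> n" "coeff p n = 0" "p \<noteq> 0" shows "degree p < n"
  using assms by (metis leading_coeff_neq_0 le_neq_implies_less)

lemma is_op_unique:
  assumes "is_op n p" "is_op n q" shows "p = q"
proof (rule ccontr)
  assume ne: "p \<noteq> q"
  note p = is_opD[OF assms(1)] and q = is_opD[OF assms(2)]
  have d: "degree (p - q) < n" using p q ne by (intro degree_diff_monic_less) auto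
  have "lint ((p - q) * (p - q)) = lint (p * (p - q)) - lint (q * (p - q))"
    by (simp add: left_diff_distrib lint_diff)
  also have "\<dots> = 0" using p(5)[OF d] q(5)[OF d] by simp
  finally show False using lint_square_pos[of "p - q"] ne by simp
qed

lemma is_op_0: "is_op 0 1" by (simp add: is_op_def)

text \<open>One step of the three-term recurrence. The polynomial \<open>q\<close> is the previous one, and \<open>0\<close> for \<open>n = 0\<close>;
  its coefficient is then a division by zero, that is, \<open>0\<close>.\<close>

lemma is_op_step:
  assumes p: "is_op n p" and q: "n > 0 \<Longrightarrow> is_op (n - 1) q" and q0: "n = 0 \<Longrightarrow> q = 0"
  shows "is_op (Suc n) ([:- (lint ([:0, 1:] * (p * p)) / lint (p * p)), 1:] * p
           - Polynomial.smult (lint (p * p) / lint (q * q)) q)"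
    (is "is_op _ ([:- ?b, 1:] * p - Polynomial.smult ?c q)")
proof -
  let ?r = "[:- ?b, 1:] * p - Polynomial.smult ?c q"
  note P = is_opD[OF p]
  have hp: "lint (p * p) > 0" using lint_square_pos P(4) by blast
  have dq: "degree q \<le> n" using is_opD(1)[OF q] q0 by (cases "n = 0") auto
  have dt: "degree ([:- ?b, 1:] * p) = Suc n" using P by (subst degree_mult_eq) auto
  have dr: "degree ?r = Suc n"
  proof -
    have "degree (- Polynomial.smult ?c q) < degree ([:- ?b, 1:] * p)"
      using dq dt degree_smult_le[of ?c q] by simp
    from degree_add_eq_left[OF this] show ?thesis using dt by simp
  qed
  have "coeff q (Suc n) = 0" using dq by (simp add: coeff_eq_0)
  then have lr: "coeff ?r (Suc n) = 1" using P by (simp add: coeff_eq_0)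
  have qp: "lint (q * p) = 0" if "n > 0"
    using P(5)[of q] is_opD(1)[OF q[OF that]] that by (simp add: mult.commute)
  have main: "lint (?r * s) = 0" if s: "degree s \<le> n" for s
  proof -
    \<comment> \<open>split off the component along \<open>p\<close>; the rest has degree less than \<open>n\<close>\<close>
    let ?s' = "s - Polynomial.smult (coeff s n) p"
    have "?r * s = ?r * ?s' + Polynomial.smult (coeff s n) (?r * p)"
      by (simp only: right_diff_distrib mult_smult_right)
    then have split: "lint (?r * s) = lint (?r * ?s') + coeff s n * lint (?r * p)"
      by (simp only: lint_add lint_smult)
    have "lint (?r * p) = lint ([:0, 1:] * (p * p)) - ?b * lint (p * p) - ?c * lint (q * p)"
      by (simp add: algebra_simps lint_diff lint_add lint_smult lint_minus)
    moreover have "?c * lint (q * p) = 0" using qp q0 by (cases "n > 0") auto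
    ultimately have rp: "lint (?r * p) = 0" using hp by simp
    have "lint (?r * ?s') = 0"
    proof (cases "s = Polynomial.smult (coeff s n) p")
      case True
      then have "?s' = 0" by simp
      then show ?thesis by simp
    next
      case False
      have c0: "coeff ?s' n = 0" using P by simp
      have "degree ?s' \<le> n" using s P by (intro degree_diff_le) auto
      then have ds': "degree ?s' < n"
        using c0 False by (metis eq_iff_diff_eq_0 leading_coeff_neq_0 le_neq_implies_less)
      then have n0: "n > 0" by simp
      note Q = is_opD[OF q[OF n0]]
      have hq: "lint (q * q) > 0" using lint_square_pos Q(4) by blast
      \<comment> \<open>the integrals of \<open>q * s'\<close> and \<open>p * (t * s')\<close> are \<open>a\<close> times the squared norms of \<open>q\<close> and \<open>p\<close>\<close>
      define a where "a = coeff ?s' (n - 1)"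
      define v where "v = ?s' - Polynomial.smult a q"
      have vq: "lint (q * v) = 0"
      proof (cases "v = 0")
        case False
        have "coeff v (n - 1) = 0" unfolding v_def a_def using Q by simp
        moreover have "degree v \<le> n - 1" unfolding v_def
          using ds' Q(1) degree_smult_le[of a q] by (intro degree_diff_le[of ?s']) linarith+
        ultimately have "degree v < n - 1" using False
          by (intro degree_less_if_coeff_eq_0) auto
        then show ?thesis using Q(5) by blast
      qed simp
      have s'q: "lint (q * ?s') = a * lint (q * q)"
        using vq unfolding v_def by (simp add: right_diff_distrib lint_diff lint_smult)
      have tw: "lint (p * ([:0, 1:] * ?s')) = a * lint (p * p)"
      proof (cases "[:0, 1:] * ?s' = Polynomial.smult a p")
        case True
        then show ?thesis by (metis lint_smult mult_smult_right)
      next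
        case False
        let ?w = "[:0, 1:] * ?s' - Polynomial.smult a p"
        have "coeff ?w n = 0" using P n0 unfolding a_def
          by (cases n) (simp_all add: coeff_pCons)
        moreover have "degree ?w \<le> n"
          using ds' P degree_mult_le[of "[:0, 1::real:]" ?s'] by (intro degree_diff_le) auto
        ultimately have "degree ?w < n" using False
          by (intro degree_less_if_coeff_eq_0) auto
        then have "lint (p * ?w) = 0" by (rule P(5))
        then show ?thesis by (simp add: right_diff_distrib lint_diff lint_smult del: mult_pCons_left)
      qed
      have "?r * ?s' = p * ([:0, 1:] * ?s') - Polynomial.smult ?b (p * ?s') - Polynomial.smult ?c (q * ?s')"
        by (simp add: algebra_simps)
      then have "lint (?r * ?s') = lint (p * ([:0, 1:] * ?s')) - ?b * lint (p * ?s') - ?c * lint (q * ?s')"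
        by (simp only: lint_diff lint_smult)
      also have "\<dots> = 0" using P(5)[OF ds'] tw s'q hq by simp
      finally show ?thesis .
    qed
    then show ?thesis using split rp by simp
  qed
  have "\<forall>i<Suc n. lint (?r * monom 1 i) = 0" using main by (auto simp: degree_monom_eq)
  then show ?thesis unfolding is_op_def using dr lr by simp
qed

lemma is_op_exists: "\<exists>p. is_op n p"
proof -
  have "(\<exists>p. is_op n p) \<and> (\<exists>p. is_op (Suc n) p)"
  proof (induction n)
    case 0
    show ?case using is_op_0 is_op_step[OF is_op_0, of 0] by blast
  next
    case (Suc n)
    then obtain p q where "is_op n q" "is_op (Suc n) p" by blast
    then have "\<exists>r. is_op (Suc (Suc n)) r" using is_op_step[of "Suc n" p q] by auto
    then show ?case using Suc by blast
  qed
  then show ?thesis by blast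
qed

lemma lint_1_pos: "lint 1 > 0"
  using lint_square_pos[of 1] by simp

lemma integral_normalized: "(\<integral>t. poly p t \<partial>(normalized_measure \<sigma>)) = lint p / lint 1"
proof -
  have "scale_measure (ennreal (1 / lint 1)) \<sigma> = density \<sigma> (\<lambda>_. ennreal (1 / lint 1))"
    by (rule measure_eqI) (auto simp: emeasure_density_const)
  moreover have "(\<integral>t. poly p t \<partial>(density \<sigma> (\<lambda>_. ennreal (1 / lint 1))))
      = (\<integral>t. (1 / lint 1) *\<^sub>R poly p t \<partial>\<sigma>)"
    using lint_1_pos by (intro integral_density) (auto intro: borel_measurable_integrable)
  moreover have "(\<integral>t. 1 \<partial>\<sigma>) = lint 1" by (simp add: lint_def)
  ultimately show ?thesis unfolding normalized_measure_def by (simp only:) (simp add: lint_def)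
qed

lemma is_op_monic_op: "is_op n (monic_op \<sigma> n)"
proof -
  have eq: "(degree p = n \<and> lead_coeff p = 1 \<and>
     (\<forall>i<n. (\<integral>t. poly p t * t ^ i \<partial>(normalized_measure \<sigma>)) = 0)) \<longleftrightarrow> is_op n p" for p
  proof -
    have "(\<integral>t. poly p t * t ^ i \<partial>(normalized_measure \<sigma>)) = lint (p * monom 1 i) / lint 1" for i
      using integral_normalized[of "p * monom 1 i"] by (simp add: poly_monom)
    then show ?thesis using lint_1_pos by (simp add: is_op_def)
  qed
  have "\<exists>!p. is_op n p" using is_op_exists is_op_unique by blast
  then show ?thesis unfolding monic_op_def eq by (rule theI')
qed

abbreviation P :: "nat \<Rightarrow> real poly" where "P \<equiv> monic_op \<sigma>"

text \<open>Squared norms and recurrence coefficients of the orthogonal polynomials.\<close>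

definition h :: "nat \<Rightarrow> real" where "h n = lint (P n * P n)"
definition \<beta> :: "nat \<Rightarrow> real" where "\<beta> n = lint ([:0, 1:] * (P n * P n)) / h n"
definition \<gamma> :: "nat \<Rightarrow> real" where "\<gamma> n = h (Suc n) / h n"

lemmas P_degree = is_opD(1)[OF is_op_monic_op]
lemmas P_lead = is_opD(3)[OF is_op_monic_op]
lemmas P_nz = is_opD(4)[OF is_op_monic_op]
lemmas P_orth = is_opD(5)[OF is_op_monic_op]

lemma h_pos: "h n > 0" unfolding h_def by (rule lint_square_pos[OF P_nz])
lemma \<gamma>_pos: "\<gamma> n > 0" unfolding \<gamma>_def using h_pos by simp

lemma P_0: "P 0 = 1" by (rule is_op_unique[OF is_op_monic_op is_op_0])

lemma h_0: "h 0 = lint 1" by (simp add: h_def P_0)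

lemma P_Suc_0: "P (Suc 0) = [:- \<beta> 0, 1:]"
proof -
  have "is_op (Suc 0) [:- \<beta> 0, 1:]"
    using is_op_step[OF is_op_monic_op[of 0], of 0] unfolding \<beta>_def h_def P_0 by simp
  then show ?thesis using is_op_unique is_op_monic_op by blast
qed

lemma P_Suc_Suc: "P (Suc (Suc n)) = [:- \<beta> (Suc n), 1:] * P (Suc n) - Polynomial.smult (\<gamma> n) (P n)"
proof -
  have "is_op (Suc (Suc n)) ([:- \<beta> (Suc n), 1:] * P (Suc n) - Polynomial.smult (\<gamma> n) (P n))"
    using is_op_step[OF is_op_monic_op[of "Suc n"], of "P n"] is_op_monic_op[of n]
    unfolding \<beta>_def h_def \<gamma>_def by (simp del: mult_pCons_left)
  then show ?thesis using is_op_unique is_op_monic_op by blast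
qed

lemma lint_P_mult:
  assumes "degree q \<le> n" shows "lint (P n * q) = coeff q n * h n"
proof (cases "q = Polynomial.smult (coeff q n) (P n)")
  case True
  then show ?thesis unfolding h_def by (metis lint_smult mult_smult_right)
next
  case False
  let ?w = "q - Polynomial.smult (coeff q n) (P n)"
  have "coeff ?w n = 0" using P_lead by simp
  moreover have "degree ?w \<le> n" using assms P_degree by (intro degree_diff_le) auto
  ultimately have "degree ?w < n" using False
          by (intro degree_less_if_coeff_eq_0) auto
  then have "lint (P n * ?w) = 0" by (rule P_orth)
  then show ?thesis by (simp add: right_diff_distrib lint_diff lint_smult h_def)
qed

text \<open>The orthogonality relations determine a polynomial of degree at most \<open>n\<close> up to a factor.\<close>

lemma eq_smult_P:
  assumes "degree q \<le> n" and "\<And>i. i < n \<Longrightarrow> lint (q * monom 1 i) = 0"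
  shows "q = Polynomial.smult (coeff q n) (P n)"
proof (rule ccontr)
  let ?w = "q - Polynomial.smult (coeff q n) (P n)"
  assume ne: "q \<noteq> Polynomial.smult (coeff q n) (P n)"
  have "coeff ?w n = 0" using P_lead by simp
  moreover have "degree ?w \<le> n" using assms P_degree by (intro degree_diff_le) auto
  ultimately have d: "degree ?w < n" using ne
          by (intro degree_less_if_coeff_eq_0) auto
  have "lint (q * ?w) = 0" 
  proof (rule lint_eq_0_if_orthogonal)
    show "lint (q * monom 1 i) = 0" if "i \<le> degree ?w" for i using assms(2)[of i] that d by simp
  qed
  moreover have "lint (P n * ?w) = 0" using d by (rule P_orth)
  ultimately have "lint (?w * ?w) = 0"
    by (simp add: left_diff_distrib[of _ _ ?w] lint_diff lint_smult)
  then show False using lint_square_pos[of ?w] ne by simp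
qed

lemma \<beta>_le: "\<bar>\<beta> n\<bar> \<le> 1"
proof -
  have "\<bar>lint ([:0, 1:] * (P n * P n))\<bar> \<le> (\<integral>t. \<bar>poly ([:0, 1:] * (P n * P n)) t\<bar> \<partial>\<sigma>)"
    unfolding lint_def by (rule integral_abs_bound)
  also have "\<dots> \<le> (\<integral>t. poly (P n * P n) t \<partial>\<sigma>)"
  proof (rule integral_mono_AE)
    show "AE t in \<sigma>. \<bar>poly ([:0, 1:] * (P n * P n)) t\<bar> \<le> poly (P n * P n) t"
      using AE_interval
    proof eventually_elim
      case (elim t)
      then have "\<bar>t\<bar> * (poly (P n) t)\<^sup>2 \<le> 1 * (poly (P n) t)\<^sup>2"
        by (intro mult_right_mono) auto
      then show ?case by (simp add: abs_mult power2_eq_square)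
    qed
  qed (intro integrable_abs integrable_poly)+
  finally have "\<bar>lint ([:0, 1:] * (P n * P n))\<bar> \<le> h n" unfolding h_def lint_def .
  then show ?thesis using h_pos[of n] unfolding \<beta>_def by simp
qed

lemma \<gamma>_le: "\<gamma> n \<le> 1"
proof -
  have eq: "[:0, 1:] * P n = P (Suc n) + (Polynomial.smult (\<beta> n) (P n) +
      (if n = 0 then 0 else Polynomial.smult (\<gamma> (n - 1)) (P (n - 1))))" (is "_ = _ + ?r")
    by (cases n) (simp_all add: P_Suc_0 P_0 P_Suc_Suc)
  have "degree ?r \<le> n" by (intro degree_add_le) (auto simp: P_degree)
  then have o: "lint (P (Suc n) * ?r) = 0" by (intro P_orth) auto
  have expand: "lint ((p + r) * (p + r)) = lint (p * p) + 2 * lint (p * r) + lint (r * r)" for p r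
  proof -
    have "(p + r) * (p + r) = p * p + (p * r + p * r) + r * r" by (simp add: algebra_simps)
    then show ?thesis by (simp only: lint_add)
  qed
  have "lint (([:0, 1:] * P n) * ([:0, 1:] * P n)) = lint (P (Suc n) * P (Suc n)) + 2 * lint (P (Suc n) * ?r) + lint (?r * ?r)"
    unfolding eq by (rule expand)
  moreover have "lint (?r * ?r) \<ge> 0" using lint_square_pos[of ?r] by (cases "?r = 0") auto
  ultimately have "h (Suc n) \<le> lint (([:0, 1:] * P n) * ([:0, 1:] * P n))" using o by (simp add: h_def)
  also have "\<dots> \<le> h n" unfolding h_def lint_def
  proof (rule integral_mono_AE)
    show "AE t in \<sigma>. poly (([:0, 1:] * P n) * ([:0, 1:] * P n)) t \<le> poly (P n * P n) t"
      using AE_interval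
    proof eventually_elim
      case (elim t)
      then have "t\<^sup>2 \<le> 1" by (simp add: abs_square_le_1 abs_le_iff)
      then have "t\<^sup>2 * (poly (P n) t)\<^sup>2 \<le> 1 * (poly (P n) t)\<^sup>2"
        by (intro mult_right_mono) auto
      then show ?case by (simp add: power2_eq_square mult_ac)
    qed
  qed (rule integrable_poly)+
  finally show ?thesis unfolding \<gamma>_def using h_pos[of n] by simp
qed

lemma h_mono: "h (Suc n) \<le> h n"
  using \<gamma>_le[of n] h_pos[of n] by (simp add: \<gamma>_def)

lemma h_le: "h n \<le> lint 1"
proof (induction n)
  case (Suc n)
  then show ?case using h_mono[of n] by simp
qed (simp add: h_0)

lemma jacobi_matrix_eq: "jacobi_matrix \<sigma> =
  (\<lambda>i k. if k = i then \<beta> i else if k = Suc i then 1 else if i = Suc k then \<gamma> k else 0)"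
proof -
  have rec: "[:0, 1:] * P j = P (Suc j) + Polynomial.smult (\<beta> j) (P j) +
      (if j = 0 then 0 else Polynomial.smult (\<gamma> (j - 1)) (P (j - 1)))" for j
    by (cases j) (simp_all add: P_Suc_0 P_0 P_Suc_Suc)
  have "recurrence_coeffs \<sigma> = (\<beta>, \<gamma>)"
    unfolding recurrence_coeffs_def
  proof (rule the_equality)
    show "case (\<beta>, \<gamma>) of (b, c) \<Rightarrow> \<forall>j. [:0, 1:] * P j = P (Suc j) + Polynomial.smult (b j) (P j) +
      (if j = 0 then 0 else Polynomial.smult (c (j - 1)) (P (j - 1)))" using rec by simp
  next
    fix bc :: "(nat \<Rightarrow> real) \<times> (nat \<Rightarrow> real)"
    assume A: "case bc of (b, c) \<Rightarrow> \<forall>j. [:0, 1:] * P j = P (Suc j) + Polynomial.smult (b j) (P j) +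
      (if j = 0 then 0 else Polynomial.smult (c (j - 1)) (P (j - 1)))"
    obtain b' c' where bc: "bc = (b', c')" by (cases bc)
    have eq: "Polynomial.smult (\<beta> j) (P j) + (if j = 0 then 0 else Polynomial.smult (\<gamma> (j - 1)) (P (j - 1))) =
        Polynomial.smult (b' j) (P j) + (if j = 0 then 0 else Polynomial.smult (c' (j - 1)) (P (j - 1)))" for j
      using rec[of j] A unfolding bc by (auto simp del: mult_pCons_left)
    have bb: "b' j = \<beta> j" for j
    proof -
      have "coeff (P (j - 1)) j = 0" if "j \<noteq> 0" using that by (intro coeff_eq_0) (simp add: P_degree)
      then show ?thesis using arg_cong[OF eq[of j], of "\<lambda>p. coeff p j"] P_lead[of j]
        by (cases "j = 0") auto
    qed
    have "c' j = \<gamma> j" for j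
    proof -
      have "Polynomial.smult (\<gamma> j - c' j) (P j) = 0" using eq[of "Suc j"] by (simp add: bb smult_diff_left)
      then show ?thesis using P_nz[of j] by simp
    qed
    then show "bc = (\<beta>, \<gamma>)" using bb bc by auto
  qed
  then show ?thesis by (simp add: jacobi_matrix_def)
qed

end

section \<open>The shifted moment functional and its normal indices\<close>

lemma degree_monic_div:
  fixes p q :: "real poly"
  assumes "lead_coeff p = 1" "lead_coeff q = 1" "degree q \<le> degree p"
  shows "degree (p div q) = degree p - degree q" "lead_coeff (p div q) = 1"
proof -
  have q0: "q \<noteq> 0" using assms by auto
  have r: "p mod q = 0 \<or> degree (p mod q) < degree q" by (rule degree_mod_less[OF q0])
  have eq: "p = p div q * q + p mod q" by simp
  have d0: "p div q \<noteq> 0"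
  proof
    assume "p div q = 0"
    then have "p = p mod q" using eq by simp
    then have "degree p < degree q \<or> p = 0" using r by auto
    then show False using assms by auto
  qed
  have dm: "degree (p div q * q) = degree (p div q) + degree q"
    using d0 q0 by (simp add: degree_mult_eq)
  have lt: "p mod q = 0 \<or> degree (p mod q) < degree (p div q * q)" using r dm by auto
  then have "degree p = degree (p div q * q)"
    using eq by (metis add.right_neutral degree_add_eq_left)
  then show "degree (p div q) = degree p - degree q" using dm by simp
  have "coeff (p mod q) (degree (p div q * q)) = 0" using lt by (auto simp: coeff_eq_0)
  then have "lead_coeff p = lead_coeff (p div q * q)"
    using \<open>degree p = _\<close> eq by (metis add.right_neutral coeff_add)
  then show "lead_coeff (p div q) = 1" using assms by (simp add: lead_coeff_mult)
qed

text \<open>The moment sequence is prolonged to the left by an arbitrary number \<open>s_m1\<close>.\<close>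

locale shifted_moments = interval_measure +
  fixes s_m1 :: real
begin

text \<open>The functional with moments \<open>s_m1, s\<^sub>0, s\<^sub>1, \<dots>\<close>; \<open>poly_shift 1 p\<close> is \<open>(p - p(0)) / t\<close>.\<close>

definition sf :: "real poly \<Rightarrow> real" where
  "sf p = s_m1 * coeff p 0 + lint (poly_shift 1 p)"

lemma sf_pCons: "sf (pCons a q) = s_m1 * a + lint q"
proof -
  have "poly_shift 1 (pCons a q) = q" by (rule poly_eqI) (simp add: coeff_poly_shift)
  then show ?thesis by (simp add: sf_def)
qed

lemma sf_add: "sf (p + q) = sf p + sf q"
  by (cases p; cases q) (simp add: sf_pCons lint_add algebra_simps)

lemma sf_smult: "sf (Polynomial.smult a p) = a * sf p"
  by (cases p) (simp add: sf_pCons lint_smult algebra_simps)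

lemma sf_0 [simp]: "sf 0 = 0"
  using sf_smult[of 0 0] by simp

lemma sf_diff: "sf (p - q) = sf p - sf q"
  using sf_add[of p "Polynomial.smult (-1) q"] sf_smult[of "-1" q] by simp

lemma sf_sum: "sf (\<Sum>i\<in>A. p i) = (\<Sum>i\<in>A. sf (p i))"
  by (induction A rule: infinite_finite_induct) (auto simp: sf_add)

lemma sf_monom_Suc: "sf (p * monom 1 (Suc i)) = lint (p * monom 1 i)"
  by (simp add: monom_Suc sf_pCons)

definition \<ss> :: "nat \<Rightarrow> real" where
  "\<ss> j = (if j = 0 then s_m1 else (\<integral>t. t ^ (j - 1) \<partial>\<sigma>))"

lemma \<ss>_eq: "\<ss> j = sf (monom 1 j)"
  by (cases j) (simp_all add: \<ss>_def sf_pCons monom_0 monom_Suc lint_def poly_monom)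

text \<open>The numbers \<open>\<xi> n\<close> obey the recurrence of the orthogonal
  polynomials at \<open>0\<close>, with initial values that make consecutive zeros impossible.\<close>

definition \<xi> :: "nat \<Rightarrow> real" where "\<xi> n = sf (P n)"

lemma lint_P_Suc: "lint (P (Suc n)) = 0"
  using P_orth[of 1 "Suc n"] by simp

lemma \<xi>_0: "\<xi> 0 = s_m1"
  using sf_pCons[of 1 0] by (simp add: \<xi>_def P_0 one_pCons)

lemma \<xi>_Suc_0: "\<xi> (Suc 0) = h 0 - \<beta> 0 * s_m1"
  using sf_pCons[of "- \<beta> 0" 1] by (simp add: \<xi>_def P_Suc_0 one_pCons h_0)

lemma \<xi>_Suc_Suc: "\<xi> (Suc (Suc n)) = - \<beta> (Suc n) * \<xi> (Suc n) - \<gamma> n * \<xi> n"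
proof -
  have "P (Suc (Suc n)) = Polynomial.smult (- \<beta> (Suc n)) (P (Suc n)) + pCons 0 (P (Suc n)) - Polynomial.smult (\<gamma> n) (P n)"
    by (simp add: P_Suc_Suc)
  then show ?thesis unfolding \<xi>_def by (simp add: sf_diff sf_add sf_smult sf_pCons lint_P_Suc)
qed

lemma \<xi>_no_consecutive_zeros: "\<xi> n = 0 \<Longrightarrow> \<xi> (Suc n) \<noteq> 0"
proof (induction n)
  case 0
  then have "\<xi> (Suc 0) = h 0" using \<xi>_0 \<xi>_Suc_0 by (metis diff_zero mult_zero_right)
  then show ?case using h_pos[of 0] by linarith
next
  case (Suc n)
  then have "\<xi> n \<noteq> 0" by auto
  then show ?case using Suc.prems \<gamma>_pos[of n] by (simp add: \<xi>_Suc_Suc)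
qed

lemma P_sf_eq_0:
  assumes "\<xi> n = 0" "i \<le> n" shows "sf (P n * monom 1 i) = 0"
proof (cases i)
  case 0
  then show ?thesis using assms by (simp add: \<xi>_def monom_0)
next
  case (Suc k)
  then have "lint (P n * monom 1 k) = 0" using assms by (intro P_orth) (simp add: degree_monom_eq)
  then show ?thesis using Suc by (simp add: sf_monom_Suc)
qed

text \<open>If \<open>\<xi> n \<noteq> 0\<close>, the bilinear form \<open>(p, q) \<mapsto> sf (p * q)\<close> is nondegenerate on polynomials of degree at
  most \<open>n\<close>: a vector \<open>p\<close> of its kernel is orthogonal, for the measure, to all polynomials of degree less
  than \<open>n\<close>, hence a multiple of \<open>P n\<close>.\<close>

lemma sf_nondegenerate:
  assumes "\<xi> n \<noteq> 0" "degree p \<le> n" "\<And>i. i \<le> n \<Longrightarrow> sf (p * monom 1 i) = 0"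
  shows "p = 0"
proof -
  have eq: "p = Polynomial.smult (coeff p n) (P n)"
  proof (rule eq_smult_P)
    show "lint (p * monom 1 i) = 0" if "i < n" for i
      using assms(3)[of "Suc i"] that by (simp add: sf_monom_Suc)
  qed (use assms in auto)
  have "sf p = 0" using assms(3)[of 0] by (simp add: monom_0)
  then have "coeff p n * \<xi> n = 0" using eq unfolding \<xi>_def by (metis sf_smult)
  then show ?thesis using eq assms(1) by auto
qed

text \<open>The kernel of the Hankel matrix consists of the coefficient vectors of the polynomials in the kernel
  of the form \<open>(p, q) \<mapsto> sf (p * q)\<close>.\<close>

lemma det_hankel_nonzero_iff: "Determinant.det (hankel \<ss> (Suc n)) \<noteq> 0 \<longleftrightarrow> \<xi> n \<noteq> 0"
proof -
  let ?A = "hankel \<ss> (Suc n)"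
  have A: "?A \<in> carrier_mat (Suc n) (Suc n)" by (simp add: hankel_def)
  have prod: "(?A *\<^sub>v v) $ i = sf ((\<Sum>k\<le>n. monom (v $ k) k) * monom 1 i)"
    if v: "v \<in> carrier_vec (Suc n)" and i: "i \<le> n" for v i
  proof -
    have "(?A *\<^sub>v v) $ i = (\<Sum>k\<le>n. \<ss> (i + k) * v $ k)"
      using v i by (simp add: hankel_def scalar_prod_def atLeast0LessThan lessThan_Suc_atMost[symmetric])
    also have "\<dots> = (\<Sum>k\<le>n. sf (monom (v $ k) k * monom 1 i))"
    proof (rule sum.cong[OF refl])
      fix k
      have "monom (v $ k) k * monom 1 i = Polynomial.smult (v $ k) (monom 1 (i + k))"
        by (simp add: mult_monom smult_monom add.commute)
      then show "\<ss> (i + k) * v $ k = sf (monom (v $ k) k * monom 1 i)"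
        by (simp add: sf_smult \<ss>_eq)
    qed
    finally show ?thesis by (simp add: sf_sum sum_distrib_right)
  qed
  have "(\<exists>v. v \<in> carrier_vec (Suc n) \<and> v \<noteq> 0\<^sub>v (Suc n) \<and> ?A *\<^sub>v v = 0\<^sub>v (Suc n)) \<longleftrightarrow> \<xi> n = 0"
  proof
    assume "\<exists>v. v \<in> carrier_vec (Suc n) \<and> v \<noteq> 0\<^sub>v (Suc n) \<and> ?A *\<^sub>v v = 0\<^sub>v (Suc n)"
    then obtain v where v: "v \<in> carrier_vec (Suc n)" "v \<noteq> 0\<^sub>v (Suc n)" "?A *\<^sub>v v = 0\<^sub>v (Suc n)" by blast
    let ?p = "\<Sum>k\<le>n. monom (v $ k) k"
    have cf: "coeff ?p k = v $ k" if "k \<le> n" for k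
      using that by (simp add: coeff_sum sum.delta)
    show "\<xi> n = 0"
    proof (rule ccontr)
      assume ne: "\<xi> n \<noteq> 0"
      have "?p = 0"
      proof (rule sf_nondegenerate[OF ne])
        show "degree ?p \<le> n" by (rule degree_sum_le) (auto intro: order_trans[OF degree_monom_le])
        show "sf (?p * monom 1 i) = 0" if "i \<le> n" for i
          using prod[OF v(1) that] v(3) that by simp
      qed
      then have "v = 0\<^sub>v (Suc n)" using cf v(1) by (intro eq_vecI) auto
      then show False using v by simp
    qed
  next
    assume z: "\<xi> n = 0"
    let ?v = "vec (Suc n) (\<lambda>k. coeff (P n) k)"
    have "(\<Sum>k\<le>n. monom (?v $ k) k) = (\<Sum>k\<le>n. monom (coeff (P n) k) k)"
      by (intro sum.cong) auto
    also have "\<dots> = P n" using poly_as_sum_of_monoms[of "P n"] by (simp add: P_degree)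
    finally have eq: "(\<Sum>k\<le>n. monom (?v $ k) k) = P n" .
    have "?v $ n = 1" by (simp add: P_lead)
    then have "?v \<noteq> 0\<^sub>v (Suc n)" by force
    moreover have "?A *\<^sub>v ?v = 0\<^sub>v (Suc n)"
    proof (rule eq_vecI)
      fix i assume "i < dim_vec (0\<^sub>v (Suc n))"
      then have i: "i \<le> n" by simp
      have "(?A *\<^sub>v ?v) $ i = sf (P n * monom 1 i)"
        using prod[of ?v i] i unfolding eq by simp
      then show "(?A *\<^sub>v ?v) $ i = 0\<^sub>v (Suc n) $ i" using P_sf_eq_0[OF z i] i by simp
    qed (simp add: hankel_def)
    ultimately show "\<exists>v. v \<in> carrier_vec (Suc n) \<and> v \<noteq> 0\<^sub>v (Suc n) \<and> ?A *\<^sub>v v = 0\<^sub>v (Suc n)"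
      by (intro exI[of _ ?v]) auto
  qed
  then show ?thesis using det_0_iff_vec_prod_zero[OF A] by blast
qed

text \<open>The normal indices, preceded by \<open>\<nu> 0 = 0\<close>.\<close>

definition \<nu> :: "nat \<Rightarrow> nat" where "\<nu> = normal_index \<ss>"

lemma \<nu>_0 [simp]: "\<nu> 0 = 0" by (simp add: \<nu>_def)

lemma \<nu>_Suc: "\<nu> (Suc j) = (if \<xi> (\<nu> j) \<noteq> 0 then Suc (\<nu> j) else Suc (Suc (\<nu> j)))"
proof -
  define S where "S = {n. n \<ge> 1 \<and> Determinant.det (hankel \<ss> n) \<noteq> 0}"
  have S: "Suc n \<in> S \<longleftrightarrow> \<xi> n \<noteq> 0" for n by (simp add: S_def det_hankel_nonzero_iff)
  have S0: "0 \<notin> S" by (simp add: S_def)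
  have inf: "infinite S"
    unfolding infinite_nat_iff_unbounded
  proof
    fix m
    show "\<exists>n>m. n \<in> S" using \<xi>_no_consecutive_zeros[of m] S[of m] S[of "Suc m"]
      by (cases "\<xi> m = 0") (auto intro: exI[of _ "Suc m"] exI[of _ "Suc (Suc m)"])
  qed
  have enum: "\<nu> (Suc k) = enumerate S k" for k
    by (simp only: \<nu>_def normal_index.simps S_def)
  have "\<nu> (Suc j) = (LEAST s. s \<in> S \<and> \<nu> j < s)"
  proof (cases j)
    case 0
    have "(\<lambda>s. s \<in> S \<and> 0 < s) = (\<lambda>s. s \<in> S)" using S0 by (auto intro: gr0I)
    then show ?thesis using 0 by (simp only: enum enumerate_0 \<nu>_0)
  next
    case (Suc k)
    then show ?thesis using enumerate_Suc''[OF inf] by (simp only: enum)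
  qed
  also have "\<dots> = (if \<xi> (\<nu> j) \<noteq> 0 then Suc (\<nu> j) else Suc (Suc (\<nu> j)))"
  proof (rule Least_equality)
    show "(if \<xi> (\<nu> j) \<noteq> 0 then Suc (\<nu> j) else Suc (Suc (\<nu> j))) \<in> S \<and> \<nu> j < (if \<xi> (\<nu> j) \<noteq> 0 then Suc (\<nu> j) else Suc (Suc (\<nu> j)))"
      using \<xi>_no_consecutive_zeros[of "\<nu> j"] S by auto
  next
    fix y assume y: "y \<in> S \<and> \<nu> j < y"
    show "(if \<xi> (\<nu> j) \<noteq> 0 then Suc (\<nu> j) else Suc (Suc (\<nu> j))) \<le> y"
    proof (cases "\<xi> (\<nu> j) = 0")
      case True
      then have "y \<noteq> Suc (\<nu> j)" using y S by auto
      then show ?thesis using y True by auto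
    qed (use y in auto)
  qed
  finally show ?thesis .
qed

lemma \<nu>_less: "\<nu> j < \<nu> (Suc j)" by (simp add: \<nu>_Suc)

lemma \<nu>_ge: "j \<le> \<nu> j"
  by (induction j) (auto intro: le_less_trans[OF _ \<nu>_less, THEN Suc_leI])

lemma \<nu>_pos: "j > 0 \<Longrightarrow> \<nu> j > 0" using \<nu>_ge[of j] by simp

lemma \<xi>_normal: "\<xi> (\<nu> (Suc j) - 1) \<noteq> 0"
  using \<xi>_no_consecutive_zeros[of "\<nu> j"] by (simp add: \<nu>_Suc)

text \<open>\<open>\<Xi> j\<close> is \<open>\<xi> (\<nu> j - 1)\<close>. The value \<open>-1\<close> for \<open>j = 0\<close> is the one that extends the recurrence for \<open>\<xi>\<close> to
  the index \<open>-1\<close>, with \<open>\<gamma>\<^sub>-\<^sub>1 = h 0\<close>; the formulas for \<open>ell\<close>, \<open>G_at_0\<close> and \<open>\<eta>\<close> then hold for all \<open>j\<close>.\<close>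

definition \<Xi> :: "nat \<Rightarrow> real" where
  "\<Xi> j = (if j = 0 then -1 else \<xi> (\<nu> j - 1))"

lemma \<Xi>_nz: "\<Xi> j \<noteq> 0" using \<xi>_normal by (cases j) (auto simp: \<Xi>_def)

text \<open>The sequence whose boundedness is equivalent to each of the three statements.\<close>

definition \<delta> :: "nat \<Rightarrow> real" where "\<delta> j = (if j = 0 then 0 else \<xi> (\<nu> j) / \<Xi> j)"

text \<open>The monic orthogonal polynomials of \<open>sf\<close>, of degree \<open>\<nu> j\<close>.\<close>

definition G :: "nat \<Rightarrow> real poly" where
  "G j = (if j = 0 then 1 else P (\<nu> j) - Polynomial.smult (\<delta> j) (P (\<nu> j - 1)))"

text \<open>The entries of the lower triangular factor.\<close>

definition ell :: "nat \<Rightarrow> real" where "ell j = - \<Xi> (Suc j) / \<Xi> j"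

text \<open>\<open>h (\<nu> j - 1)\<close>, with the value \<open>1\<close> for \<open>j = 0\<close>.\<close>

definition h_pred :: "nat \<Rightarrow> real" where "h_pred j = (if j = 0 then 1 else h (\<nu> j - 1))"

text \<open>The first nonzero number among \<open>sf (G j * t ^ m)\<close>, attained at \<open>m = \<nu> (j + 1) - 1\<close>.\<close>

definition \<eta> :: "nat \<Rightarrow> real" where "\<eta> j = ell j * h_pred j"

lemma h_pred_pos: "h_pred j > 0" using h_pos by (simp add: h_pred_def)

lemma ell_nz: "ell j \<noteq> 0" using \<Xi>_nz by (simp add: ell_def)

lemma \<eta>_nz: "\<eta> j \<noteq> 0" using ell_nz h_pred_pos[of j] by (simp add: \<eta>_def)

lemma ell_single: "j > 0 \<Longrightarrow> \<xi> (\<nu> j) \<noteq> 0 \<Longrightarrow> ell j = - \<delta> j"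
  by (simp add: ell_def \<delta>_def \<Xi>_def \<nu>_Suc)

lemma \<delta>_double: "\<xi> (\<nu> j) = 0 \<Longrightarrow> \<delta> j = 0" by (simp add: \<delta>_def)

lemma ell_double: assumes "j > 0" "\<xi> (\<nu> j) = 0" shows "ell j = \<gamma> (\<nu> j - 1)"
proof -
  obtain n where n: "\<nu> j = Suc n" using \<nu>_pos[OF assms(1)] by (cases "\<nu> j") auto
  have "\<xi> (Suc (Suc n)) = - \<gamma> n * \<xi> n" using assms(2) n by (simp add: \<xi>_Suc_Suc)
  moreover have "\<xi> n \<noteq> 0" using \<Xi>_nz[of j] assms n by (simp add: \<Xi>_def)
  ultimately show ?thesis using assms n by (simp add: ell_def \<Xi>_def \<nu>_Suc)
qed

lemma G_degree: "degree (G j) = \<nu> j" and G_lead: "coeff (G j) (\<nu> j) = 1"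
proof -
  have "degree (G j) = \<nu> j \<and> coeff (G j) (\<nu> j) = 1"
  proof (cases "j = 0")
    case True
    then show ?thesis by (simp add: G_def)
  next
    case False
    then have pos: "\<nu> j > 0" using \<nu>_pos by simp
    have lt: "degree (- Polynomial.smult (\<delta> j) (P (\<nu> j - 1))) < degree (P (\<nu> j))"
      using pos degree_smult_le[of "\<delta> j" "P (\<nu> j - 1)"] by (simp add: P_degree)
    have "coeff (P (\<nu> j - 1)) (\<nu> j) = 0" using pos by (intro coeff_eq_0) (simp add: P_degree)
    then show ?thesis using False degree_add_eq_left[OF lt] by (simp add: G_def P_degree P_lead)
  qed
  then show "degree (G j) = \<nu> j" "coeff (G j) (\<nu> j) = 1" by auto
qed

lemma G_nz: "G j \<noteq> 0" using G_lead[of j] by auto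

lemma lint_G:
  assumes "j > 0"
  shows "m < \<nu> (Suc j) - 2 \<Longrightarrow> lint (G j * monom 1 m) = 0"
    "lint (G j * monom 1 (\<nu> (Suc j) - 2)) = \<eta> j"
proof -
  have pos: "\<nu> j > 0" using \<nu>_pos[OF assms] .
  have G: "lint (G j * q) = lint (P (\<nu> j) * q) - \<delta> j * lint (P (\<nu> j - 1) * q)" for q
    using assms by (simp add: G_def left_diff_distrib lint_diff lint_smult)
  have o: "lint (P n * monom 1 i) = 0" if "i < n" for n i
    using that by (intro P_orth) (simp add: degree_monom_eq)
  have e: "lint (P n * monom 1 n) = h n" for n
    using lint_P_mult[of "monom 1 n" n] by (simp add: degree_monom_eq)
  show "lint (G j * monom 1 m) = 0" if "m < \<nu> (Suc j) - 2"
  proof (cases "\<xi> (\<nu> j) = 0")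
    case True
    then show ?thesis using that by (simp add: G o \<nu>_Suc \<delta>_double)
  next
    case False
    then show ?thesis using that by (simp add: G o \<nu>_Suc)
  qed
  show "lint (G j * monom 1 (\<nu> (Suc j) - 2)) = \<eta> j"
  proof (cases "\<xi> (\<nu> j) = 0")
    case True
    have "\<eta> j = \<gamma> (\<nu> j - 1) * h (\<nu> j - 1)"
      using assms True by (simp add: \<eta>_def h_pred_def ell_double)
    also have "\<dots> = h (\<nu> j)" using pos h_pos[of "\<nu> j - 1"] by (simp add: \<gamma>_def)
    finally show ?thesis using True by (simp add: G e \<nu>_Suc \<delta>_double)
  next
    case False
    then show ?thesis using assms pos e[of "\<nu> j - 1"] o[of "\<nu> j - 1" "\<nu> j"]
      by (simp add: G \<nu>_Suc ell_single \<eta>_def h_pred_def)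
  qed
qed

lemma sf_G_less: "m < \<nu> (Suc j) - 1 \<Longrightarrow> sf (G j * monom 1 m) = 0"
  and sf_G_eq: "sf (G j * monom 1 (\<nu> (Suc j) - 1)) = \<eta> j"
proof -
  have "(m < \<nu> (Suc j) - 1 \<longrightarrow> sf (G j * monom 1 m) = 0) \<and> sf (G j * monom 1 (\<nu> (Suc j) - 1)) = \<eta> j" for m
  proof (cases "j = 0")
    case True
    have "sf 1 = s_m1" using \<xi>_0 by (simp add: \<xi>_def P_0)
    moreover have "sf (monom 1 (Suc 0)) = h 0" by (simp add: monom_Suc sf_pCons h_0 monom_0 one_pCons)
    moreover have "\<nu> (Suc 0) = (if \<xi> 0 \<noteq> 0 then 1 else 2)" by (simp add: \<nu>_Suc)
    moreover have "\<xi> (Suc 0) = h 0" if "\<xi> 0 = 0" using that \<xi>_0 \<xi>_Suc_0 by (metis diff_zero mult_zero_right)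
    moreover have "sf 1 = \<xi> 0" using \<open>sf 1 = s_m1\<close> \<xi>_0 by simp
    moreover have "G 0 = 1" "\<eta> 0 = \<xi> (\<nu> (Suc 0) - 1)" by (simp_all add: G_def \<eta>_def ell_def \<Xi>_def h_pred_def)
    moreover have "monom 1 0 = (1 :: real poly)" by (simp add: monom_0 one_pCons)
    ultimately have "(m < \<nu> (Suc 0) - 1 \<longrightarrow> sf (G 0 * monom 1 m) = 0) \<and> sf (G 0 * monom 1 (\<nu> (Suc 0) - 1)) = \<eta> 0"
      by (cases "\<xi> 0 = 0") simp_all
    then show ?thesis using True by simp
  next
    case False
    have ge: "\<nu> (Suc j) \<ge> 2" using \<nu>_less[of j] \<nu>_pos[of j] False by simp
    have z: "sf (G j) = 0" using False \<Xi>_nz[of j]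
      by (simp add: G_def sf_diff sf_smult \<xi>_def[symmetric] \<delta>_def \<Xi>_def)
    have "sf (G j * monom 1 m) = 0" if "m < \<nu> (Suc j) - 1"
      using that lint_G(1)[of j "m - 1"] False z by (cases m) (auto simp: sf_monom_Suc monom_0)
    moreover have "sf (G j * monom 1 (\<nu> (Suc j) - 1)) = \<eta> j"
    proof -
      have "\<nu> (Suc j) - 1 = Suc (\<nu> (Suc j) - 2)" using ge by simp
      then show ?thesis using lint_G(2)[of j] False by (simp add: sf_monom_Suc)
    qed
    ultimately show ?thesis by blast
  qed
  then show "m < \<nu> (Suc j) - 1 \<Longrightarrow> sf (G j * monom 1 m) = 0"
    "sf (G j * monom 1 (\<nu> (Suc j) - 1)) = \<eta> j" by auto
qed

lemma sf_G_degree_less: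
  assumes "degree q < \<nu> (Suc j) - 1" shows "sf (G j * q) = 0"
proof -
  have "G j * q = (\<Sum>i\<le>degree q. Polynomial.smult (coeff q i) (G j * monom 1 i))"
    using arg_cong[OF poly_as_sum_of_monoms[of q], of "\<lambda>r. G j * r"]
    by (simp add: sum_distrib_left mult_smult_right[symmetric] smult_monom del: mult_smult_right)
  then show ?thesis using assms by (simp add: sf_sum sf_smult sf_G_less)
qed

lemma sf_G_monic:
  assumes "degree q = \<nu> (Suc j) - 1" "lead_coeff q = 1" shows "sf (G j * q) = \<eta> j"
proof -
  let ?m = "monom 1 (\<nu> (Suc j) - 1) :: real poly"
  have "sf (G j * (q - ?m)) = 0"
  proof (cases "q = ?m")
    case False
    then show ?thesis using assms
      by (intro sf_G_degree_less degree_diff_monic_less) (auto simp: degree_monom_eq)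
  qed simp
  then have "sf (G j * q) = sf (G j * ?m)" by (simp add: right_diff_distrib sf_diff)
  then show ?thesis using sf_G_eq by simp
qed

text \<open>Coefficients of the three-term recurrence for \<open>G\<close>; \<open>pp j\<close> is monic of degree
  \<open>\<nu> (j + 1) - \<nu> j\<close>.\<close>

definition pp :: "nat \<Rightarrow> real poly" where "pp j = G (Suc j) div G j"

definition cc :: "nat \<Rightarrow> real" where "cc j = \<eta> (Suc j) / \<eta> j"

lemma cc_nz: "cc j \<noteq> 0" using \<eta>_nz by (simp add: cc_def)

lemma pp_degree: "degree (pp j) = \<nu> (Suc j) - \<nu> j" and pp_lead: "lead_coeff (pp j) = 1"
  using degree_monic_div[of "G (Suc j)" "G j"] \<nu>_less[of j]
  by (simp_all add: pp_def G_degree G_lead)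

lemma G_0: "G 0 = 1" by (simp add: G_def)

lemma G_Suc_0: "G (Suc 0) = pp 0"
  by (simp add: pp_def G_0)

text \<open>The remainder in the division of \<open>G (j+2)\<close> by \<open>G (j+1)\<close> satisfies the orthogonality relations of \<open>G j\<close>,
  so that it is a multiple of \<open>G j\<close>.\<close>

lemma G_Suc_Suc: "G (Suc (Suc j)) = pp (Suc j) * G (Suc j) - Polynomial.smult (cc j) (G j)"
proof -
  let ?n = "\<nu> (Suc j)"
  define r where "r = G (Suc (Suc j)) mod G (Suc j)"
  have npos: "?n > 0" by (rule \<nu>_pos) simp
  have eq: "G (Suc (Suc j)) = pp (Suc j) * G (Suc j) + r" by (simp add: pp_def r_def)
  have dr: "degree r \<le> ?n - 1"
    using degree_mod_less'[of "G (Suc j)" "G (Suc (Suc j))"] G_nz npos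
    unfolding r_def by (cases "r = 0") (force simp: r_def G_degree)+
  have sr: "sf (r * monom 1 m) = sf (G (Suc (Suc j)) * monom 1 m) - sf (G (Suc j) * (pp (Suc j) * monom 1 m))" for m
  proof -
    have "r * monom 1 m = G (Suc (Suc j)) * monom 1 m - G (Suc j) * (pp (Suc j) * monom 1 m)"
      unfolding eq by (simp add: algebra_simps)
    then show ?thesis by (simp add: sf_diff)
  qed
  have dm: "degree (pp (Suc j) * monom 1 m) = \<nu> (Suc (Suc j)) - ?n + m"
    and lm: "lead_coeff (pp (Suc j) * monom 1 m) = 1" for m
  proof -
    have "pp (Suc j) \<noteq> 0" using pp_lead[of "Suc j"] by auto
    then show "degree (pp (Suc j) * monom 1 m) = \<nu> (Suc (Suc j)) - ?n + m"
      by (simp add: degree_mult_eq degree_monom_eq pp_degree)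
    show "lead_coeff (pp (Suc j) * monom 1 m) = 1"
      by (simp only: lead_coeff_mult pp_lead lead_coeff_monom mult_1)
  qed
  note lt = \<nu>_less[of "Suc j"] \<nu>_less[of "Suc (Suc j)"]
  have r0: "sf (r * monom 1 m) = 0" if "m < ?n - 1" for m
    using that lt dm[of m] by (simp add: sr sf_G_less sf_G_degree_less)
  have r1: "sf (r * monom 1 (?n - 1)) = - \<eta> (Suc j)"
    using lt npos dm[of "?n - 1"] lm[of "?n - 1"] by (simp add: sr sf_G_less sf_G_monic)
  let ?w = "r + Polynomial.smult (cc j) (G j)"
  have "?w = 0"
  proof (rule sf_nondegenerate)
    show "\<xi> (?n - 1) \<noteq> 0" by (rule \<xi>_normal)
    have "degree (G j) \<le> ?n - 1" using \<nu>_less[of j] by (simp add: G_degree)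
    then show "degree ?w \<le> ?n - 1" using dr by (intro degree_add_le) (auto intro: order_trans[OF degree_smult_le])
    fix i assume "i \<le> ?n - 1"
    then show "sf (?w * monom 1 i) = 0"
      using r0[of i] r1 sf_G_less[of i j] sf_G_eq[of j] \<eta>_nz[of j]
      by (cases "i = ?n - 1") (auto simp: distrib_right sf_add sf_smult cc_def)
  qed
  then have "r = - Polynomial.smult (cc j) (G j)" by (simp add: eq_neg_iff_add_eq_0)
  then show ?thesis using eq by simp
qed

text \<open>The Wronskian at \<open>0\<close> of the two solutions \<open>P\<close> and \<open>\<xi>\<close> of the recurrence.\<close>

lemma P_wronskian_0:
  "poly (P (Suc n)) 0 * \<xi> n - poly (P n) 0 * \<xi> (Suc n) = - h n"
proof (induction n)
  case 0
  show ?case by (simp add: P_Suc_0 P_0 \<xi>_0 \<xi>_Suc_0)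
next
  case (Suc n)
  have "poly (P (Suc (Suc n))) 0 * \<xi> (Suc n) - poly (P (Suc n)) 0 * \<xi> (Suc (Suc n)) =
     \<gamma> n * (poly (P (Suc n)) 0 * \<xi> n - poly (P n) 0 * \<xi> (Suc n))"
    by (simp add: P_Suc_Suc \<xi>_Suc_Suc algebra_simps)
  also have "\<dots> = - h (Suc n)" using Suc h_pos[of n] by (simp add: \<gamma>_def)
  finally show ?case .
qed

lemma G_at_0: "poly (G j) 0 = - h_pred j / \<Xi> j"
proof (cases "j = 0")
  case False
  then obtain n where n: "\<nu> j = Suc n" using \<nu>_pos[of j] by (cases "\<nu> j") auto
  then have nz: "\<xi> n \<noteq> 0" using \<Xi>_nz[of j] False by (simp add: \<Xi>_def)
  have "poly (G j) 0 = (poly (P (Suc n)) 0 * \<xi> n - poly (P n) 0 * \<xi> (Suc n)) / \<xi> n"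
    using nz n False by (simp add: G_def \<delta>_def \<Xi>_def diff_divide_distrib)
  also have "\<dots> = - h_pred j / \<Xi> j"
    using n False by (simp only: P_wronskian_0) (simp add: h_pred_def \<Xi>_def)
  finally show ?thesis .
qed (simp add: G_def h_pred_def \<Xi>_def)

lemma G_at_0_nz: "poly (G j) 0 \<noteq> 0"
  using h_pred_pos[of j] \<Xi>_nz[of j] by (simp add: G_at_0)

text \<open>The entries \<open>c\<^sub>j / u\<^sub>j\<close> of the factor in the LU factorization are those of the UL factorization.\<close>

lemma cc_quotient: "cc j / (- poly (G (Suc j)) 0 / poly (G j) 0) = ell (Suc j)"
  using h_pred_pos[of j] h_pred_pos[of "Suc j"] \<Xi>_nz[of j] \<Xi>_nz[of "Suc j"]
  by (simp add: cc_def \<eta>_def G_at_0 ell_def field_simps)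

lemma coeff_pp_double:
  assumes z: "\<xi> (\<nu> j) = 0" shows "coeff (pp j) 1 = - \<beta> (\<nu> j)"
proof -
  let ?n = "\<nu> j"
  have n': "\<nu> (Suc j) = Suc (Suc ?n)" using z by (simp add: \<nu>_Suc)
  have nz: "\<xi> (Suc ?n) \<noteq> 0" using \<xi>_no_consecutive_zeros z by blast
  have "\<delta> (Suc j) = - \<beta> (Suc ?n)"
    using z nz by (simp add: \<delta>_def \<Xi>_def n' \<xi>_Suc_Suc)
  then have G': "G (Suc j) = pCons 0 (P (Suc ?n)) - Polynomial.smult (\<gamma> ?n) (P ?n)"
    by (simp add: G_def n' P_Suc_Suc)
  have G: "G j = P ?n" using z by (cases "j = 0") (auto simp: G_def P_0 \<delta>_def)
  define k where "k = (if ?n = 0 then 0 else coeff (P ?n) (?n - 1))"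
  have "coeff (P ?n) (Suc ?n) = 0" by (rule coeff_eq_0) (simp add: P_degree)
  moreover have "coeff (P (Suc ?n)) ?n = k - \<beta> ?n"
  proof (cases ?n)
    case (Suc m)
    have "coeff (P m) (Suc m) = 0" by (rule coeff_eq_0) (simp add: P_degree)
    then show ?thesis using P_lead[of "Suc m"] by (simp add: k_def Suc P_Suc_Suc)
  qed (simp add: k_def P_Suc_0)
  ultimately have lhs: "coeff (G (Suc j)) (Suc ?n) = k - \<beta> ?n" by (simp add: G')
  have "degree (pp j) = 2" using pp_degree[of j] n' by simp
  then obtain a e where pp: "pp j = [:a, e, 1:]"
  proof -
    have "pp j = [:coeff (pp j) 0, coeff (pp j) 1, 1:]"
    proof (rule poly_eqI)
      fix i show "coeff (pp j) i = coeff [:coeff (pp j) 0, coeff (pp j) 1, 1:] i"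
        using \<open>degree (pp j) = 2\<close> pp_lead[of j]
        by (auto simp: coeff_pCons numeral_2_eq_2 coeff_eq_0 split: nat.splits)
    qed
    then show ?thesis by (rule that)
  qed
  have rhs: "coeff (pp j * G j) (Suc ?n) = e + k"
    unfolding pp G using P_lead[of ?n] \<open>coeff (P ?n) (Suc ?n) = 0\<close> by (cases ?n) (auto simp: k_def)
  have "degree (G (Suc j) mod G j) \<le> ?n"
    using degree_mod_less'[of "G j" "G (Suc j)"] G_nz[of j] G_degree[of j]
    by (cases "G (Suc j) mod G j = 0") auto
  then have "coeff (G (Suc j) mod G j) (Suc ?n) = 0" by (intro coeff_eq_0) simp
  moreover have "G (Suc j) = pp j * G j + G (Suc j) mod G j" by (simp add: pp_def)
  ultimately have "coeff (G (Suc j)) (Suc ?n) = coeff (pp j * G j) (Suc ?n)"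
    by (metis add.right_neutral coeff_add)
  then show ?thesis using lhs rhs pp by simp
qed

end

section \<open>Banded and block bidiagonal matrices\<close>

lemma shifted_sums:
  fixes f :: "nat \<Rightarrow> real"
  assumes "summable f"
  shows "(\<lambda>i. if d \<le> i then f (i - d) else 0) sums suminf f"
  using assms sums_iff_shift[of "\<lambda>i. if d \<le> i then f (i - d) else 0" d "suminf f"]
  by (simp add: summable_sums)

lemma bounded_in_l2_entries:
  assumes "bounded_in_l2 A"
  obtains C where "\<And>i m. \<bar>A i m\<bar> \<le> C"
proof -
  obtain C where C: "\<And>x. in_l2 x \<Longrightarrow> in_l2 (inf_mat_vec A x) \<and> l2_norm (inf_mat_vec A x) \<le> C * l2_norm x"
    using assms unfolding bounded_in_l2_def by blast
  have "\<bar>A i m\<bar> \<le> C" for i m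
  proof -
    define x :: "nat \<Rightarrow> complex" where "x = (\<lambda>k. if k = m then 1 else 0)"
    have sq: "(\<lambda>k. (cmod (x k))\<^sup>2) sums 1"
      using sums_single[of m "\<lambda>_. 1 :: real"] by (simp add: x_def if_distrib[of "\<lambda>z. (cmod z)\<^sup>2"] cong: if_cong)
    have x: "in_l2 x" "l2_norm x = 1"
      using sq by (auto simp: in_l2_def l2_norm_def sums_iff)
    have Ax: "inf_mat_vec A x = (\<lambda>k. complex_of_real (A k m))"
    proof
      fix k
      have "(\<lambda>j. complex_of_real (A k j) * x j) = (\<lambda>j. if j = m then complex_of_real (A k m) else 0)"
        by (auto simp: x_def)
      then show "inf_mat_vec A x k = complex_of_real (A k m)"
        using sums_single[of m "\<lambda>_. complex_of_real (A k m)"] by (simp add: inf_mat_vec_def sums_iff)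
    qed
    have sm: "summable (\<lambda>k. (A k m)\<^sup>2)" using C[OF x(1)] unfolding Ax in_l2_def by simp
    have "\<bar>A i m\<bar> = sqrt ((A i m)\<^sup>2)" by simp
    also have "(A i m)\<^sup>2 = (\<Sum>k\<in>{i}. (A k m)\<^sup>2)" by simp
    also have "\<dots> \<le> (\<Sum>k. (A k m)\<^sup>2)" by (rule sum_le_suminf[OF sm]) auto
    finally have "\<bar>A i m\<bar> \<le> l2_norm (inf_mat_vec A x)" unfolding Ax l2_norm_def by simp
    then show ?thesis using C[OF x(1)] x(2) by simp
  qed
  then show ?thesis using that by blast
qed

text \<open>A lower triangular matrix with \<open>w\<close> diagonals and bounded entries is bounded: it is a sum of \<open>w\<close>
  weighted shifts.\<close>

lemma bounded_in_l2_banded: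
  assumes band: "\<And>i m. A i m \<noteq> 0 \<Longrightarrow> m \<le> i \<and> i < m + w" and bd: "\<And>i m. \<bar>A i m\<bar> \<le> C"
  shows "bounded_in_l2 A"
proof -
  have C0: "C \<ge> 0" using bd[of 0 0] by simp
  have "(\<forall>i. summable (\<lambda>m. complex_of_real (A i m) * x m)) \<and>
     in_l2 (inf_mat_vec A x) \<and> l2_norm (inf_mat_vec A x) \<le> (w * C) * l2_norm x" if x: "in_l2 x" for x
  proof -
    define f where "f k = (cmod (x k))\<^sup>2" for k
    have f: "summable f" using x by (simp add: in_l2_def f_def[abs_def])
    define g where "g i d = (if d \<le> i then complex_of_real (A i (i - d)) * x (i - d) else 0)" for i d
    have fin: "summable (\<lambda>m. complex_of_real (A i m) * x m)" for i
      by (rule summable_finite[of "{..i}"]) (use band in auto)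
    have Ax: "inf_mat_vec A x i = (\<Sum>d<w. g i d)" for i
    proof -
      have "inf_mat_vec A x i = (\<Sum>m\<le>i. complex_of_real (A i m) * x m)"
        unfolding inf_mat_vec_def by (rule suminf_finite) (use band in auto)
      also have "\<dots> = (\<Sum>m \<in> {m. m \<le> i \<and> i < m + w}. complex_of_real (A i m) * x m)"
        by (rule sum.mono_neutral_right) (use band in auto)
      also have "\<dots> = (\<Sum>d \<in> {d. d < w \<and> d \<le> i}. complex_of_real (A i (i - d)) * x (i - d))"
        by (rule sum.reindex_bij_witness[of _ "\<lambda>d. i - d" "\<lambda>m. i - m"]) auto
      also have "\<dots> = (\<Sum>d<w. g i d)"
        by (rule sum.mono_neutral_cong_left) (auto simp: g_def)
      finally show ?thesis .
    qed
    have le: "(cmod (inf_mat_vec A x i))\<^sup>2 \<le> w * C\<^sup>2 * (\<Sum>d<w. if d \<le> i then f (i - d) else 0)" for i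
    proof -
      have "(cmod (inf_mat_vec A x i))\<^sup>2 \<le> (\<Sum>d<w. cmod (g i d))\<^sup>2"
        unfolding Ax by (intro power_mono norm_sum) auto
      also have "\<dots> \<le> w * (\<Sum>d<w. (cmod (g i d))\<^sup>2)"
        using sum_squared_le_sum_of_squares[of "\<lambda>d. cmod (g i d)" "{..<w}"] by (simp add: mult.commute)
      also have "\<dots> \<le> w * (\<Sum>d<w. C\<^sup>2 * (if d \<le> i then f (i - d) else 0))"
      proof (intro mult_left_mono sum_mono)
        fix d
        have "(A i (i - d))\<^sup>2 \<le> C\<^sup>2" using bd C0 by (metis abs_ge_zero power2_abs power_mono)
        then show "(cmod (g i d))\<^sup>2 \<le> C\<^sup>2 * (if d \<le> i then f (i - d) else 0)"
          by (auto simp: g_def f_def norm_mult power_mult_distrib intro: mult_right_mono)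
      qed auto
      finally show ?thesis by (simp add: sum_distrib_left mult_ac)
    qed
    have s: "(\<lambda>i. w * C\<^sup>2 * (\<Sum>d<w. if d \<le> i then f (i - d) else 0)) sums (w * C\<^sup>2 * (\<Sum>d<w. suminf f))"
      by (intro sums_mult sums_sum shifted_sums f)
    have sA: "summable (\<lambda>i. (cmod (inf_mat_vec A x i))\<^sup>2)"
      by (rule summable_comparison_test'[OF sums_summable[OF s], of 0]) (use le in auto)
    have "(\<Sum>i. (cmod (inf_mat_vec A x i))\<^sup>2) \<le> (w * C)\<^sup>2 * suminf f"
      using suminf_le[OF le sA sums_summable[OF s]] sums_unique[OF s]
      by (simp add: power2_eq_square mult_ac)
    then have "l2_norm (inf_mat_vec A x) \<le> sqrt ((w * C)\<^sup>2 * suminf f)"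
      unfolding l2_norm_def by simp
    also have "\<dots> = (w * C) * l2_norm x"
      using C0 by (simp add: real_sqrt_mult l2_norm_def f_def[abs_def])
    finally show ?thesis using sA fin unfolding in_l2_def by blast
  qed
  then show ?thesis unfolding bounded_in_l2_def by blast
qed

lemma inf_mat_mult_row:
  assumes "finite N" "\<And>m. m \<notin> N \<Longrightarrow> A i m = 0"
  shows "inf_mat_mult A B i k = (\<Sum>m\<in>N. A i m * B m k)"
  unfolding inf_mat_mult_def by (rule suminf_finite) (use assms in auto)

text \<open>Partitions of the indices into blocks of size \<open>1\<close> and \<open>2\<close>, with the rows of the block matrices of the
  two factors written out.\<close>

locale small_blocks =
  fixes n :: "nat \<Rightarrow> nat"
  assumes n_0: "n 0 = 0" and n_Suc: "n (Suc j) = Suc (n j) \<or> n (Suc j) = Suc (Suc (n j))"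
begin

lemma n_less: "n j < n (Suc j)" using n_Suc[of j] by auto

lemma n_strict_mono: "i < j \<Longrightarrow> n i < n j"
  using lift_Suc_mono_less[of n] n_less by blast

lemma n_mono: "i \<le> j \<Longrightarrow> n i \<le> n j"
  using n_strict_mono by (cases "i = j") (auto intro: less_imp_le)

lemma block_of_eq:
  assumes "r < block_size n j" shows "block_of n (n j + r) = j"
  unfolding block_of_def
proof (rule Least_equality)
  show "n j + r < n (Suc j)" using assms by simp
next
  fix y assume "n j + r < n (Suc y)"
  then have "n j < n (Suc y)" by simp
  then show "j \<le> y" using n_mono[of "Suc y" j] by (meson not_less not_less_eq_eq)
qed

lemma block_matrix_entry:
  "r < block_size n i \<Longrightarrow> c < block_size n j \<Longrightarrow> block_matrix n B (n i + r) (n j + c) = B i j r c"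
  by (simp add: block_matrix_def block_of_eq)

lemma index_eq_iff:
  assumes "r < block_size n i" "c < block_size n j"
  shows "n i + r = n j + c \<longleftrightarrow> i = j \<and> r = c"
  using block_of_eq[OF assms(1)] block_of_eq[OF assms(2)] by auto

lemma index_cases: obtains j r where "k = n j + r" "r < block_size n j"
proof -
  have "\<exists>j r. k = n j + r \<and> r < block_size n j"
  proof (induction k)
    case 0
    show ?case using n_less[of 0] by (intro exI[of _ 0]) (auto simp: n_0)
  next
    case (Suc k)
    then obtain j r where k: "k = n j + r" "r < block_size n j" by blast
    show ?case
    proof (cases "Suc r < block_size n j")
      case True
      then show ?thesis using k by (intro exI[of _ j] exI[of _ "Suc r"]) auto
    next
      case False
      then have "Suc k = n (Suc j) + 0" using k by simp
      then show ?thesis using n_less[of "Suc j"] by (intro exI[of _ "Suc j"] exI[of _ 0]) auto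
    qed
  qed
  then show ?thesis using that by blast
qed

lemma eq_n_iff: "r < block_size n i \<Longrightarrow> n i + r = n j \<longleftrightarrow> i = j \<and> r = 0"
  using index_eq_iff[of r i 0 j] n_less[of j] by simp

lemma eq_Suc_n_iff:
  "r < block_size n i \<Longrightarrow> n (Suc j) = Suc (Suc (n j)) \<Longrightarrow> n i + r = Suc (n j) \<longleftrightarrow> i = j \<and> r = 1"
  using index_eq_iff[of r i 1 j] by simp

lemma Suc_eq_n_iff:
  assumes "r < block_size n i"
  shows "Suc (n i + r) = n j \<longleftrightarrow> j = Suc i \<and> r = block_size n i - 1"
proof (cases "Suc r < block_size n i")
  case True
  then show ?thesis using eq_n_iff[OF True, of j] by auto
next
  case False
  then have "Suc (n i + r) = n (Suc i) + 0" and r: "r = block_size n i - 1" using assms by auto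
  then show ?thesis using eq_n_iff[of 0 "Suc i" j] n_less[of "Suc i"] by auto
qed

lemma block_U_last_row:
  "block_U n u (n (Suc j) - 1) k = (if k = n j then u j else if k = n (Suc j) then 1 else 0)"
proof -
  obtain i c where k: "k = n i + c" "c < block_size n i" by (rule index_cases)
  have eq: "n (Suc j) - 1 = n j + (block_size n j - 1)" "block_size n j - 1 < block_size n j"
    using n_less[of j] by auto
  show ?thesis unfolding block_U_def eq(1) k(1) block_matrix_entry[OF eq(2) k(2)] eq_n_iff[OF k(2)]
    using n_Suc[of j] k(2) by (auto simp: less_Suc_eq less_2_cases_iff)
qed

lemma block_U_first_row:
  assumes "n (Suc j) = Suc (Suc (n j))"
  shows "block_U n u (n j) k = (if k = Suc (n j) then 1 else 0)"
proof -
  obtain i c where k: "k = n i + c" "c < block_size n i" by (rule index_cases)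
  have z: "0 < block_size n j" using n_less by simp
  show ?thesis using block_matrix_entry[OF z k(2)] eq_Suc_n_iff[OF k(2) assms] assms k
    unfolding block_U_def k(1) by (auto simp: less_Suc_eq less_2_cases_iff)
qed

lemma block_L_single_row:
  assumes "n (Suc j) = Suc (n j)"
  shows "block_L n l e (n j) k = (if k = n j then 1 else if Suc k = n j then l j else 0)"
proof -
  obtain i c where k: "k = n i + c" "c < block_size n i" by (rule index_cases)
  have z: "0 < block_size n j" using n_less by simp
  show ?thesis using block_matrix_entry[OF z k(2)] assms k
    unfolding block_L_def k(1) eq_n_iff[OF k(2)] Suc_eq_n_iff[OF k(2)] by (auto simp: less_Suc_eq less_2_cases_iff)
qed

lemma block_L_first_row:
  assumes "n (Suc j) = Suc (Suc (n j))"
  shows "block_L n l e (n j) k = (if k = n j then 1 else 0)"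
proof -
  obtain i c where k: "k = n i + c" "c < block_size n i" by (rule index_cases)
  have z: "0 < block_size n j" using n_less by simp
  show ?thesis using block_matrix_entry[OF z k(2)] assms k
    unfolding block_L_def k(1) eq_n_iff[OF k(2)] Suc_eq_n_iff[OF k(2)] by (auto simp: less_Suc_eq less_2_cases_iff)
qed

lemma block_L_second_row:
  assumes "n (Suc j) = Suc (Suc (n j))"
  shows "block_L n l e (Suc (n j)) k =
    (if k = n j then e j else if k = Suc (n j) then 1 else if Suc k = n j then l j else 0)"
proof -
  obtain i c where k: "k = n i + c" "c < block_size n i" by (rule index_cases)
  have z: "1 < block_size n j" using assms by simp
  have bs: "block_size n j \<noteq> 1" "1 = block_size n j - 1 \<longleftrightarrow> True" using assms by simp_all
  have if_eq: "(if A then if B then x else f y else if D then if True \<and> E then z else 0 else 0) =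
      (if A then f y' else if D \<and> E then z else 0)"
    if "A \<Longrightarrow> \<not> B \<and> y = y'" for A B D E and x z :: real and f :: "nat \<Rightarrow> real" and y y'
    using that by auto
  have "block_L n l e (n j + 1) k = (if j = i then [[1, 0], [e j, 1]] ! 1 ! c
     else if j = Suc i \<and> c = block_size n i - 1 then l j else 0)"
    unfolding block_L_def k(1) block_matrix_entry[OF z k(2)] bs(2)
    by (rule if_eq[where f = "\<lambda>i. [[1, 0], [e i, 1]] ! 1 ! c"]) (use bs(1) in auto)
  moreover have "c = 0 \<or> c = 1" using n_Suc[of i] k(2) by auto
  ultimately show ?thesis
    using eq_n_iff[OF k(2), of j] Suc_eq_n_iff[OF k(2), of j] eq_Suc_n_iff[OF k(2) assms] k(1)
    by (elim disjE) simp_all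
qed

lemma row_cases:
  obtains (single) j where "i = n j" "n (Suc j) = Suc (n j)"
  | (first) j where "i = n j" "n (Suc j) = Suc (Suc (n j))"
  | (second) j where "i = Suc (n j)" "n (Suc j) = Suc (Suc (n j))"
proof -
  obtain j r where i: "i = n j + r" "r < block_size n j" by (rule index_cases)
  show ?thesis
  proof (cases "n (Suc j) = Suc (n j)")
    case True
    then show ?thesis using i that(1) by simp
  next
    case False
    then have d: "n (Suc j) = Suc (Suc (n j))" using n_Suc by blast
    then have "r = 0 \<or> r = 1" using i by auto
    then show ?thesis using d i that(2,3) by auto
  qed
qed

text \<open>The value \<open>l 0\<close> does not occur in the matrix.\<close>

lemma bounded_block_L_iff:
  assumes e: "\<And>j. n (Suc j) = Suc (Suc (n j)) \<Longrightarrow> \<bar>e j\<bar> \<le> E"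
  shows "bounded_in_l2 (block_L n l e) \<longleftrightarrow> (\<exists>C. \<forall>j. \<bar>l (Suc j)\<bar> \<le> C)"
proof
  assume "bounded_in_l2 (block_L n l e)"
  then obtain C where C: "\<And>i m. \<bar>block_L n l e i m\<bar> \<le> C" using bounded_in_l2_entries by blast
  have "\<bar>l (Suc j)\<bar> \<le> C" for j
    using n_Suc[of "Suc j"] C[of "n (Suc j)" "n (Suc j) - 1"] C[of "Suc (n (Suc j))" "n (Suc j) - 1"] n_less[of j]
    by (auto simp: block_L_single_row block_L_second_row split: if_splits)
  then show "\<exists>C. \<forall>j. \<bar>l (Suc j)\<bar> \<le> C" by blast
next
  assume "\<exists>C. \<forall>j. \<bar>l (Suc j)\<bar> \<le> C"
  then obtain C where C: "\<And>j. \<bar>l (Suc j)\<bar> \<le> C" by blast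
  have l: "\<bar>l j\<bar> \<le> C" if "Suc k = n j" for j k
    using that C[of "j - 1"] n_0 by (cases j) auto
  show "bounded_in_l2 (block_L n l e)"
  proof (rule bounded_in_l2_banded[where w = 3 and C = "max 1 (max \<bar>E\<bar> C)"])
    fix i m
    show "m \<le> i \<and> i < m + 3" if "block_L n l e i m \<noteq> 0"
    proof (cases i rule: row_cases)
      case (single j)
      then show ?thesis using that by (auto simp: block_L_single_row split: if_splits)
    next
      case (first j)
      then show ?thesis using that by (auto simp: block_L_first_row split: if_splits)
    next
      case (second j)
      then show ?thesis using that by (auto simp: block_L_second_row split: if_splits)
    qed
    show "\<bar>block_L n l e i m\<bar> \<le> max 1 (max \<bar>E\<bar> C)"
    proof (cases i rule: row_cases)
      case (single j)
      then show ?thesis using l[of m j] by (simp add: block_L_single_row le_max_iff_disj)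
    next
      case (first j)
      then show ?thesis by (simp add: block_L_first_row le_max_iff_disj)
    next
      case (second j)
      then have "\<bar>e j\<bar> \<le> \<bar>E\<bar>" using e[of j] by simp
      then show ?thesis using second l[of m j] by (simp add: block_L_second_row le_max_iff_disj)
    qed
  qed
qed

end

section \<open>The two block factorizations\<close>

context shifted_moments
begin

sublocale small_blocks \<nu>
  by unfold_locales (auto simp: \<nu>_Suc)

lemma single_iff: "\<nu> (Suc j) = Suc (\<nu> j) \<longleftrightarrow> \<xi> (\<nu> j) \<noteq> 0"
  and double_iff: "\<nu> (Suc j) = Suc (Suc (\<nu> j)) \<longleftrightarrow> \<xi> (\<nu> j) = 0"
  by (auto simp: \<nu>_Suc)

text \<open>The common lower triangular factor of both factorizations.\<close>

definition Lfac :: inf_mat where "Lfac = block_L \<nu> ell (\<lambda>j. \<beta> (\<nu> j))"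

lemma Lfac_eq_block_L:
  assumes "\<And>j. l (Suc j) = ell (Suc j)" "\<And>j. \<xi> (\<nu> j) = 0 \<Longrightarrow> e j = \<beta> (\<nu> j)"
  shows "block_L \<nu> l e = Lfac"
proof (intro ext)
  fix i k
  have l: "l j = ell j" if "Suc k = \<nu> j" for j
    using that assms(1)[of "j - 1"] by (cases j) auto
  show "block_L \<nu> l e i k = Lfac i k" unfolding Lfac_def
  proof (cases i rule: row_cases)
    case (single j)
    then show "block_L \<nu> l e i k = block_L \<nu> ell (\<lambda>j. \<beta> (\<nu> j)) i k"
      using l by (simp add: block_L_single_row)
  next
    case (first j)
    then show "block_L \<nu> l e i k = block_L \<nu> ell (\<lambda>j. \<beta> (\<nu> j)) i k"
      by (simp add: block_L_first_row)
  next
    case (second j)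
    then show "block_L \<nu> l e i k = block_L \<nu> ell (\<lambda>j. \<beta> (\<nu> j)) i k"
      using l assms(2)[of j] by (simp add: block_L_second_row double_iff)
  qed
qed

lemma Lfac_head_row:
  "Lfac (\<nu> j) k = (if k = \<nu> j then 1 else if Suc k = \<nu> j then - \<delta> j else 0)"
proof (cases "\<xi> (\<nu> j) = 0")
  case True
  then show ?thesis using block_L_first_row[of j] by (simp add: Lfac_def double_iff \<delta>_double)
next
  case False
  moreover have "j > 0" if "Suc k = \<nu> j" using that by (cases j) auto
  ultimately show ?thesis using block_L_single_row[of j] by (simp add: Lfac_def single_iff ell_single)
qed

lemma Lfac_second_row:
  "\<nu> (Suc j) = Suc (Suc (\<nu> j)) \<Longrightarrow> Lfac (Suc (\<nu> j)) k =
    (if k = \<nu> j then \<beta> (\<nu> j) else if k = Suc (\<nu> j) then 1 else if Suc k = \<nu> j then ell j else 0)"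
  by (simp add: Lfac_def block_L_second_row)

text \<open>The entries \<open>u\<close> of the upper triangular factor in \<open>J = U L\<close>. For \<open>j = 0\<close> and a block of size \<open>1\<close> the
  entry is fixed by the diagonal of \<open>J\<close> alone.\<close>

definition u_UL :: "nat \<Rightarrow> real" where
  "u_UL j = (if \<xi> (\<nu> j) = 0 then \<gamma> (\<nu> j) else if j = 0 then \<beta> 0 + \<delta> (Suc 0) else \<gamma> (\<nu> j - 1) / ell j)"

lemma u_UL_single:
  assumes "\<xi> (\<nu> j) \<noteq> 0" shows "\<beta> (\<nu> j) = u_UL j - \<delta> (Suc j)"
proof (cases "j = 0")
  case True
  then show ?thesis using assms by (simp add: u_UL_def)
next
  case False
  then obtain n where n: "\<nu> j = Suc n" using \<nu>_pos[of j] by (cases "\<nu> j") auto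
  have nz: "\<xi> n \<noteq> 0" using \<Xi>_nz[of j] False n by (simp add: \<Xi>_def)
  have "\<delta> (Suc j) = \<xi> (Suc (Suc n)) / \<xi> (Suc n)" using assms n by (simp add: \<delta>_def \<Xi>_def \<nu>_Suc)
  also have "\<dots> = - \<beta> (Suc n) - \<gamma> n * \<xi> n / \<xi> (Suc n)"
    using assms n by (simp add: \<xi>_Suc_Suc field_simps)
  finally have d: "\<delta> (Suc j) = - \<beta> (Suc n) - \<gamma> n * \<xi> n / \<xi> (Suc n)" .
  have "u_UL j = - (\<gamma> n * \<xi> n / \<xi> (Suc n))"
    using assms n False nz by (simp add: u_UL_def ell_def \<Xi>_def \<nu>_Suc field_simps)
  then show ?thesis using d n by simp
qed

lemma \<beta>_double:
  assumes "\<xi> (\<nu> j) = 0" shows "\<beta> (Suc (\<nu> j)) = - \<delta> (Suc j)"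
  using assms \<xi>_no_consecutive_zeros[OF assms]
  by (simp add: \<delta>_def \<Xi>_def \<nu>_Suc \<xi>_Suc_Suc)

lemma jacobi_matrix_UL: "jacobi_matrix \<sigma> = inf_mat_mult (block_U \<nu> u_UL) Lfac"
proof (intro ext)
  fix i k
  have last_row: "inf_mat_mult (block_U \<nu> u_UL) Lfac (\<nu> (Suc j) - 1) k = u_UL j * Lfac (\<nu> j) k + Lfac (\<nu> (Suc j)) k" for j
    using \<nu>_less[of j]
    by (subst inf_mat_mult_row[where N = "{\<nu> j, \<nu> (Suc j)}"]) (auto simp: block_U_last_row simp del: One_nat_def)
  have first_row: "inf_mat_mult (block_U \<nu> u_UL) Lfac (\<nu> j) k = Lfac (Suc (\<nu> j)) k"
    if "\<nu> (Suc j) = Suc (Suc (\<nu> j))" for j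
    by (subst inf_mat_mult_row[where N = "{Suc (\<nu> j)}"]) (auto simp: block_U_first_row[OF that])
  show "jacobi_matrix \<sigma> i k = inf_mat_mult (block_U \<nu> u_UL) Lfac i k"
  proof (cases i rule: row_cases)
    case (single j)
    then have nz: "\<xi> (\<nu> j) \<noteq> 0" by (simp add: single_iff)
    have "\<gamma> k = - (u_UL j * \<delta> j)" if k: "Suc k = \<nu> j"
    proof -
      have "j > 0" using k by (cases j) auto
      then show ?thesis using nz k[symmetric] ell_single[of j] ell_nz[of j] by (auto simp: u_UL_def)
    qed
    then show ?thesis using last_row[of j] u_UL_single[OF nz] single
        Lfac_head_row[of j k] Lfac_head_row[of "Suc j" k]
      by (auto simp: jacobi_matrix_eq)
  next
    case (first j)
    then have z: "\<xi> (\<nu> j) = 0" by (simp add: double_iff)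
    have "\<gamma> k = ell j" if k: "Suc k = \<nu> j"
    proof -
      have "j > 0" using k by (cases j) auto
      then show ?thesis using ell_double[OF _ z] k[symmetric] by simp
    qed
    then show ?thesis using first first_row[OF first(2)]
        Lfac_second_row[OF first(2), of k]
      by (auto simp: jacobi_matrix_eq)
  next
    case (second j)
    then have z: "\<xi> (\<nu> j) = 0" by (simp add: double_iff)
    have "u_UL j * \<delta> j = 0" using z by (simp add: \<delta>_double)
    then show ?thesis using last_row[of j] second \<beta>_double[OF z] z
        Lfac_head_row[of j k] Lfac_head_row[of "Suc j" k]
      by (auto simp: jacobi_matrix_eq u_UL_def \<delta>_double)
  qed
qed

text \<open>The monic generalized Jacobi matrix formed from the coefficients of the recurrence for \<open>G\<close>.\<close>

definition gen_jacobi :: inf_mat where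
  "gen_jacobi = block_matrix \<nu> (\<lambda>i j r c.
       if i = j then
         (if block_size \<nu> j = 1 then - coeff (pp j) 0
          else [[0, 1], [- coeff (pp j) 0, - coeff (pp j) 1]] ! r ! c)
       else if j = Suc i then
         (if r = block_size \<nu> i - 1 \<and> c = 0 then 1 else 0)
       else if i = Suc j then
         (if r = block_size \<nu> i - 1 \<and> c = 0 then cc j else 0)
       else 0)"

text \<open>The entries \<open>u\<close> of the upper triangular factor of the generalized Jacobi matrix.\<close>

definition u_LU :: "nat \<Rightarrow> real" where "u_LU j = - poly (G (Suc j)) 0 / poly (G j) 0"

lemma u_LU_nz: "u_LU j \<noteq> 0" using G_at_0_nz by (simp add: u_LU_def)

lemma cc_eq: "cc j = ell (Suc j) * u_LU j"
  using cc_quotient[of j] u_LU_nz[of j] unfolding u_LU_def[symmetric] by (simp add: field_simps)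

lemma u_LU_0: "- coeff (pp 0) 0 = u_LU 0"
  by (simp add: u_LU_def G_Suc_0 G_0 poly_0_coeff_0)

lemma u_LU_Suc: "- coeff (pp (Suc j)) 0 = u_LU (Suc j) + ell (Suc j)"
proof -
  have "poly (G (Suc (Suc j))) 0 = coeff (pp (Suc j)) 0 * poly (G (Suc j)) 0 - ell (Suc j) * (u_LU j * poly (G j) 0)"
    by (simp only: G_Suc_Suc cc_eq poly_diff poly_mult poly_smult poly_0_coeff_0[of "pp (Suc j)"] mult.assoc)
  also have "u_LU j * poly (G j) 0 = - poly (G (Suc j)) 0" using G_at_0_nz[of j] by (simp add: u_LU_def)
  finally have "poly (G (Suc (Suc j))) 0 = (coeff (pp (Suc j)) 0 + ell (Suc j)) * poly (G (Suc j)) 0"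
    by (simp add: algebra_simps)
  then show ?thesis using G_at_0_nz[of "Suc j"] by (simp add: u_LU_def)
qed

lemma gen_jacobi_single_row:
  assumes "\<nu> (Suc j) = Suc (\<nu> j)"
  shows "gen_jacobi (\<nu> j) k = (if k = \<nu> j then - coeff (pp j) 0 else if k = \<nu> (Suc j) then 1
     else if j > 0 \<and> k = \<nu> (j - 1) then cc (j - 1) else 0)"
proof -
  obtain i c where k: "k = \<nu> i + c" "c < block_size \<nu> i" by (rule index_cases)
  have z: "0 < block_size \<nu> j" using assms by simp
  have "j = Suc i \<longleftrightarrow> j > 0 \<and> i = j - 1" by auto
  then show ?thesis using block_matrix_entry[OF z k(2)] assms k
    unfolding gen_jacobi_def k(1) eq_n_iff[OF k(2)] by (auto simp: less_Suc_eq)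
qed

lemma gen_jacobi_first_row:
  assumes "\<nu> (Suc j) = Suc (Suc (\<nu> j))"
  shows "gen_jacobi (\<nu> j) k = (if k = Suc (\<nu> j) then 1 else 0)"
proof -
  obtain i c where k: "k = \<nu> i + c" "c < block_size \<nu> i" by (rule index_cases)
  have z: "0 < block_size \<nu> j" using assms by simp
  have bs: "block_size \<nu> j \<noteq> 1" "0 = block_size \<nu> j - 1 \<longleftrightarrow> False" using assms by simp_all
  have "gen_jacobi (\<nu> j + 0) k = (if j = i then [[0, 1], [- coeff (pp i) 0, - coeff (pp i) 1]] ! 0 ! c else 0)"
    unfolding gen_jacobi_def k(1) block_matrix_entry[OF z k(2)] bs(2) using bs(1) by (cases "j = i") simp_all
  moreover have "c = 0 \<or> c = 1" using n_Suc[of i] k(2) by auto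
  ultimately show ?thesis
    using eq_Suc_n_iff[OF k(2) assms] k(1) by (elim disjE) simp_all
qed

lemma gen_jacobi_second_row:
  assumes "\<nu> (Suc j) = Suc (Suc (\<nu> j))"
  shows "gen_jacobi (Suc (\<nu> j)) k = (if k = \<nu> j then - coeff (pp j) 0 else if k = Suc (\<nu> j) then - coeff (pp j) 1
     else if k = \<nu> (Suc j) then 1 else if j > 0 \<and> k = \<nu> (j - 1) then cc (j - 1) else 0)"
proof -
  obtain i c where k: "k = \<nu> i + c" "c < block_size \<nu> i" by (rule index_cases)
  have z: "1 < block_size \<nu> j" using assms by simp
  have bs: "block_size \<nu> j \<noteq> 1" "1 = block_size \<nu> j - 1 \<longleftrightarrow> True" using assms by simp_all
  have "gen_jacobi (\<nu> j + 1) k = (if j = i then [[0, 1], [- coeff (pp i) 0, - coeff (pp i) 1]] ! 1 ! c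
      else if i = Suc j then if c = 0 then 1 else 0 else if j = Suc i then if c = 0 then cc i else 0 else 0)"
    unfolding gen_jacobi_def k(1) block_matrix_entry[OF z k(2)] bs(2) using bs(1) by (cases "j = i") simp_all
  moreover have "c = 0 \<or> c = 1" using n_Suc[of i] k(2) by auto
  moreover have "j > 0 \<and> i = j - 1 \<longleftrightarrow> j = Suc i" by auto
  ultimately show ?thesis
    using eq_n_iff[OF k(2), of j] eq_n_iff[OF k(2), of "Suc j"] eq_n_iff[OF k(2), of "j - 1"]
      eq_Suc_n_iff[OF k(2) assms] k(1)
    by (elim disjE) auto
qed

lemma gen_jacobi_LU: "gen_jacobi = inf_mat_mult Lfac (block_U \<nu> u_LU)"
proof (intro ext)
  fix i k
  let ?U = "block_U \<nu> u_LU"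
  \<comment> \<open>the contribution of the last row of the preceding block\<close>
  define w where "w j = (if j = 0 then 0 else ell j * ?U (\<nu> j - 1) k)" for j
  have w: "w (Suc j) = (if k = \<nu> j then cc j else if k = \<nu> (Suc j) then ell (Suc j) else 0)" for j
    using block_U_last_row[of u_LU j k] by (simp add: w_def cc_eq)
  have mid: "?U (\<nu> (Suc j) - 1) k + w j = (if k = \<nu> j then - coeff (pp j) 0 else if k = \<nu> (Suc j) then 1
     else if j > 0 \<and> k = \<nu> (j - 1) then cc (j - 1) else 0)" for j
  proof (cases j)
    case 0
    then show ?thesis using u_LU_0 block_U_last_row[of u_LU j k] by (simp add: w_def)
  next
    case (Suc m)
    then show ?thesis using u_LU_Suc[of m] block_U_last_row[of u_LU j k] w[of m] \<nu>_less[of m] \<nu>_less[of "Suc m"]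
      by auto
  qed
  have pos: "j > 0 \<Longrightarrow> \<nu> j > 0" for j by (rule \<nu>_pos)
  show "gen_jacobi i k = inf_mat_mult Lfac ?U i k"
  proof (cases i rule: row_cases)
    case (single j)
    have row: "Lfac i m = (if m = \<nu> j then 1 else if Suc m = \<nu> j then ell j else 0)" for m
      using single block_L_single_row[of j] by (simp add: Lfac_def)
    have "inf_mat_mult Lfac ?U i k = ?U (\<nu> j) k + w j"
    proof (cases "j = 0")
      case True
      then show ?thesis
        by (subst inf_mat_mult_row[where N = "{\<nu> j}"]) (auto simp: row w_def)
    next
      case False
      then show ?thesis using pos[of j]
        by (subst inf_mat_mult_row[where N = "{\<nu> j, \<nu> j - 1}"]) (auto simp: row w_def)
    qed
    then show ?thesis using mid[of j] gen_jacobi_single_row[of j k] single by simp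
  next
    case (first j)
    have "inf_mat_mult Lfac ?U i k = ?U (\<nu> j) k"
      using first block_L_first_row[of j]
      by (subst inf_mat_mult_row[where N = "{\<nu> j}"]) (auto simp: Lfac_def)
    then show ?thesis using first gen_jacobi_first_row[of j k] block_U_first_row[of j u_LU k] by simp
  next
    case (second j)
    then have z: "\<xi> (\<nu> j) = 0" by (simp add: double_iff)
    have row: "Lfac i m = (if m = \<nu> j then \<beta> (\<nu> j) else if m = Suc (\<nu> j) then 1 else if Suc m = \<nu> j then ell j else 0)" for m
      using second block_L_second_row[of j] by (simp add: Lfac_def)
    have "inf_mat_mult Lfac ?U i k = \<beta> (\<nu> j) * ?U (\<nu> j) k + (?U (Suc (\<nu> j)) k + w j)"
    proof (cases "j = 0")
      case True
      then show ?thesis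
        by (subst inf_mat_mult_row[where N = "{\<nu> j, Suc (\<nu> j)}"]) (auto simp: row w_def)
    next
      case False
      then show ?thesis using pos[of j]
        by (subst inf_mat_mult_row[where N = "{\<nu> j, Suc (\<nu> j), \<nu> j - 1}"]) (auto simp: row w_def)
    qed
    then show ?thesis
      using mid[of j] gen_jacobi_second_row[of j k] block_U_first_row[of j u_LU k] coeff_pp_double[OF z] second \<nu>_less[of "j - 1"]
      by (cases j) auto
  qed
qed

text \<open>For \<open>j > 0\<close> and a block of size \<open>2\<close> the entry \<open>ell j\<close> lies in \<open>(0, 1]\<close> and \<open>\<delta> j = 0\<close>; for a block of size \<open>1\<close> it is
  \<open>- \<delta> j\<close>.\<close>

lemma bounded_Lfac_iff: "bounded_in_l2 Lfac \<longleftrightarrow> (\<exists>C. \<forall>j. \<bar>\<delta> j\<bar> \<le> C)"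
proof -
  have *: "\<bar>ell (Suc j)\<bar> \<le> max 1 \<bar>\<delta> (Suc j)\<bar>" "\<bar>\<delta> (Suc j)\<bar> \<le> \<bar>ell (Suc j)\<bar>" for j
  proof -
    have "\<bar>ell (Suc j)\<bar> \<le> max 1 \<bar>\<delta> (Suc j)\<bar> \<and> \<bar>\<delta> (Suc j)\<bar> \<le> \<bar>ell (Suc j)\<bar>"
    proof (cases "\<xi> (\<nu> (Suc j)) = 0")
      case True
      then show ?thesis using ell_double[of "Suc j"] \<gamma>_le[of "\<nu> (Suc j) - 1"] \<gamma>_pos[of "\<nu> (Suc j) - 1"]
        by (simp add: \<delta>_double)
    qed (use ell_single[of "Suc j"] in simp)
    then show "\<bar>ell (Suc j)\<bar> \<le> max 1 \<bar>\<delta> (Suc j)\<bar>" "\<bar>\<delta> (Suc j)\<bar> \<le> \<bar>ell (Suc j)\<bar>" by auto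
  qed
  have "bounded_in_l2 Lfac \<longleftrightarrow> (\<exists>C. \<forall>j. \<bar>ell (Suc j)\<bar> \<le> C)"
    unfolding Lfac_def by (rule bounded_block_L_iff[where E = 1]) (rule \<beta>_le)
  also have "\<dots> \<longleftrightarrow> (\<exists>C. \<forall>j. \<bar>\<delta> j\<bar> \<le> C)"
  proof
    assume "\<exists>C. \<forall>j. \<bar>ell (Suc j)\<bar> \<le> C"
    then obtain C where C: "\<And>j. \<bar>ell (Suc j)\<bar> \<le> C" by blast
    have "\<bar>\<delta> j\<bar> \<le> C" for j
    proof (cases j)
      case 0
      then show ?thesis using C[of 0] by (simp add: \<delta>_def)
    next
      case (Suc m)
      then show ?thesis using *(2)[of m] C[of m] by simp
    qed
    then show "\<exists>C. \<forall>j. \<bar>\<delta> j\<bar> \<le> C" by blast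
  next
    assume "\<exists>C. \<forall>j. \<bar>\<delta> j\<bar> \<le> C"
    then obtain C where C: "\<And>j. \<bar>\<delta> j\<bar> \<le> C" by blast
    have "\<bar>ell (Suc j)\<bar> \<le> max 1 C" for j using *(1)[of j] C[of "Suc j"] by linarith
    then show "\<exists>C. \<forall>j. \<bar>ell (Suc j)\<bar> \<le> C" by blast
  qed
  finally show ?thesis .
qed

lemma P_hat_0: "P_hat \<sigma> s_m1 n 0 = \<xi> n"
proof -
  obtain a q where p: "P n = pCons a q" by (cases "P n")
  have "diff_quotient (P n) 0 t = poly q t" for t
    unfolding diff_quotient_def p by (simp add: pderiv_pCons)
  then have "second_kind \<sigma> n 0 = lint q" by (simp add: second_kind_def lint_def)
  then show ?thesis unfolding P_hat_def \<xi>_def using p by (simp add: sf_pCons)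
qed

lemma block_UL_bounded_iff:
  "(\<exists>U L. block_UL_factors \<sigma> s_m1 \<nu> U L \<and> bounded_in_l2 L) \<longleftrightarrow> (\<exists>C. \<forall>j. \<bar>\<delta> j\<bar> \<le> C)"
proof -
  have ell: "- P_hat \<sigma> s_m1 (\<nu> (Suc j) - 1) 0 / P_hat \<sigma> s_m1 (\<nu> j - 1) 0 = ell j" if "j \<ge> 1" for j
    using that by (simp add: P_hat_0 ell_def \<Xi>_def)
  show ?thesis
  proof
    assume "\<exists>U L. block_UL_factors \<sigma> s_m1 \<nu> U L \<and> bounded_in_l2 L"
    then obtain U L where UL: "block_UL_factors \<sigma> s_m1 \<nu> U L" and bL: "bounded_in_l2 L" by blast
    from UL obtain l e where L: "L = block_L \<nu> l e"
      and l': "\<forall>j\<ge>1. l j = - P_hat \<sigma> s_m1 (\<nu> (Suc j) - 1) 0 / P_hat \<sigma> s_m1 (\<nu> j - 1) 0"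
      unfolding block_UL_factors_def by blast
    have l: "l j = ell j" if "j \<ge> 1" for j using l' ell[OF that] that by simp
    have bl: "bounded_in_l2 (block_L \<nu> l e)" using bL L by simp
    obtain C where C: "\<And>i k. \<bar>block_L \<nu> l e i k\<bar> \<le> C" using bounded_in_l2_entries[OF bl] by blast
    have "\<bar>ell (Suc j)\<bar> \<le> C" for j
      using n_Suc[of "Suc j"] C[of "\<nu> (Suc j)" "\<nu> (Suc j) - 1"] C[of "Suc (\<nu> (Suc j))" "\<nu> (Suc j) - 1"] \<nu>_less[of j] l[of "Suc j"]
      by (auto simp: block_L_single_row block_L_second_row split: if_splits)
    then have "bounded_in_l2 Lfac"
      unfolding Lfac_def using bounded_block_L_iff[where E = 1 and l = ell, OF \<beta>_le] by blast
    then show "\<exists>C. \<forall>j. \<bar>\<delta> j\<bar> \<le> C" by (simp add: bounded_Lfac_iff)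
  next
    assume "\<exists>C. \<forall>j. \<bar>\<delta> j\<bar> \<le> C"
    then have "bounded_in_l2 Lfac" by (simp add: bounded_Lfac_iff)
    moreover have "block_UL_factors \<sigma> s_m1 \<nu> (block_U \<nu> u_UL) Lfac"
      unfolding block_UL_factors_def
    proof (rule exI[of _ u_UL], rule exI[of _ ell], rule exI[of _ "\<lambda>j. \<beta> (\<nu> j)"], intro conjI allI impI)
      show "Lfac = block_L \<nu> ell (\<lambda>j. \<beta> (\<nu> j))" by (rule Lfac_def)
      show "ell j = - P_hat \<sigma> s_m1 (\<nu> (Suc j) - 1) 0 / P_hat \<sigma> s_m1 (\<nu> j - 1) 0" if "1 \<le> j" for j
        using ell[OF that] by simp
    qed (simp_all add: jacobi_matrix_UL)
    ultimately show "\<exists>U L. block_UL_factors \<sigma> s_m1 \<nu> U L \<and> bounded_in_l2 L" by blast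
  qed
qed

text \<open>For any function with the asymptotic coefficients and the continued fraction data of \<open>sf\<close>.\<close>

lemma block_LU_bounded_iff:
  assumes ac: "asymp_coeffs f = \<ss>" and p: "gj_p f = pp" and c: "gj_c f = cc"
  shows "(\<exists>L U. block_LU_factors f L U \<and> bounded_in_l2 L) \<longleftrightarrow> (\<exists>C. \<forall>j. \<bar>\<delta> j\<bar> \<le> C)"
proof -
  have n: "normal_index (asymp_coeffs f) = \<nu>" by (simp add: ac \<nu>_def)
  have "gj_P f j = G j \<and> gj_P f (Suc j) = G (Suc j)" for j
    by (induction j) (simp_all add: p c G_0 G_Suc_0 G_Suc_Suc)
  then have P: "gj_P f j = G j" for j by blast
  have J: "gen_jacobi_matrix f = gen_jacobi"
    unfolding gen_jacobi_matrix_def gen_jacobi_def n p c Let_def ..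
  have e: "- coeff (pp j) 1 = \<beta> (\<nu> j)" if "block_size \<nu> j = 2" for j
    using coeff_pp_double[of j] that by (auto simp: \<nu>_Suc split: if_splits)
  have bs: "block_size \<nu> j = 2" if "\<xi> (\<nu> j) = 0" for j using that by (simp add: \<nu>_Suc)
  have fac: "block_LU_factors f Lfac (block_U \<nu> u_LU)"
    unfolding block_LU_factors_def n Let_def P p c J
  proof (rule exI[of _ u_LU], rule exI[of _ ell], rule exI[of _ "\<lambda>j. \<beta> (\<nu> j)"], intro conjI allI impI)
    show "Lfac = block_L \<nu> ell (\<lambda>j. \<beta> (\<nu> j))" by (rule Lfac_def)
    show "ell (Suc j) = cc j / u_LU j" for j unfolding u_LU_def by (rule cc_quotient[symmetric])
    show "\<beta> (\<nu> j) = - coeff (pp j) 1" if "block_size \<nu> j = 2" for j using e[OF that] by simp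
    show "gen_jacobi = inf_mat_mult Lfac (block_U \<nu> u_LU)" by (rule gen_jacobi_LU)
  qed (simp_all add: u_LU_def)
  have uniq: "L = Lfac" if "block_LU_factors f L U" for L U
  proof -
    from that obtain u l e' where L: "L = block_L \<nu> l e'"
      and u: "\<And>j. u j = u_LU j" and l: "\<And>j. l (Suc j) = cc j / u j"
      and e': "\<And>j. block_size \<nu> j = 2 \<Longrightarrow> e' j = - coeff (pp j) 1"
      unfolding block_LU_factors_def n Let_def P p c u_LU_def by blast
    have "l (Suc j) = ell (Suc j)" for j using l[of j] u[of j] cc_quotient[of j] by (simp add: u_LU_def)
    then show ?thesis unfolding L using e e' bs by (intro Lfac_eq_block_L) auto
  qed
  show ?thesis using fac uniq bounded_Lfac_iff by blast
qed

end

section \<open>Cauchy transforms\<close>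

text \<open>A real polynomial at a complex argument.\<close>

definition cp :: "real poly \<Rightarrow> complex \<Rightarrow> complex" where
  "cp p z = poly (map_poly complex_of_real p) z"

lemma cp_0 [simp]: "cp 0 z = 0" by (simp add: cp_def)

lemma cp_pCons: "cp (pCons a p) z = complex_of_real a + z * cp p z"
  by (simp add: cp_def map_poly_pCons)

lemma cp_1 [simp]: "cp 1 z = 1" by (simp add: one_pCons cp_pCons)

lemma cp_add: "cp (p + q) z = cp p z + cp q z"
proof -
  have "map_poly complex_of_real (p + q) = map_poly complex_of_real p + map_poly complex_of_real q"
    by (rule poly_eqI) (simp add: coeff_map_poly)
  then show ?thesis by (simp add: cp_def)
qed

lemma cp_smult: "cp (Polynomial.smult a p) z = complex_of_real a * cp p z"
proof -
  have "map_poly complex_of_real (Polynomial.smult a p) = Polynomial.smult (complex_of_real a) (map_poly complex_of_real p)"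
    by (rule poly_eqI) (simp add: coeff_map_poly)
  then show ?thesis by (simp add: cp_def)
qed

lemma cp_diff: "cp (p - q) z = cp p z - cp q z"
  using cp_add[of p "Polynomial.smult (-1) q" z] cp_smult[of "-1" q z] by simp

lemma cp_mult: "cp (p * q) z = cp p z * cp q z"
  by (induction p) (simp_all add: cp_pCons cp_add cp_smult algebra_simps)

lemma cp_of_real: "cp p (complex_of_real x) = complex_of_real (poly p x)"
  by (induction p) (simp_all add: cp_pCons)

context interval_measure
begin

lemma borel_measurable_poly [measurable]: "poly (p :: real poly) \<in> borel_measurable borel"
  by (intro borel_measurable_continuous_onI continuous_intros)

lemma integrable_continuous:
  fixes f :: "real \<Rightarrow> 'b::{banach, second_countable_topology}"
  assumes "f \<in> borel_measurable borel" "continuous_on {-1..1} f"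
  shows "integrable \<sigma> f"
proof -
  have "bounded (f ` {-1..1})"
    using assms(2) by (intro compact_imp_bounded compact_continuous_image) auto
  then obtain B where "\<forall>y \<in> f ` {-1..1}. norm y \<le> B" unfolding bounded_iff by blast
  then show ?thesis by (intro integrable_bounded[where B = B] assms(1)) auto
qed

text \<open>The complement of the interval in the complex plane.\<close>

definition off :: "complex set" where "off = - (complex_of_real ` {-1..1})"

lemma off_nz: "z \<in> off \<Longrightarrow> t \<in> {-1..1} \<Longrightarrow> complex_of_real t - z \<noteq> 0"
  by (auto simp: off_def)

lemma off_not_0: "z \<in> off \<Longrightarrow> z \<noteq> 0"
  using off_nz[of z 0] by auto

lemma off_nonreal: "Im z \<noteq> 0 \<Longrightarrow> z \<in> off"
  by (auto simp: off_def)

lemma off_large: "cmod z > 1 \<Longrightarrow> z \<in> off"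
  by (auto simp: off_def)

text \<open>The Cauchy transform of the signed measure with density \<open>p\<close>.\<close>

definition ct :: "real poly \<Rightarrow> complex \<Rightarrow> complex" where
  "ct p z = (\<integral>t. complex_of_real (poly p t) / (complex_of_real t - z) \<partial>\<sigma>)"

lemma cauchy_transform_eq_ct: "cauchy_transform \<sigma> z = ct 1 z"
  by (simp add: cauchy_transform_def ct_def)

lemma integrable_ct:
  assumes "z \<in> off"
  shows "integrable \<sigma> (\<lambda>t. complex_of_real (poly p t) * (complex_of_real t - a) ^ m / (complex_of_real t - z))"
proof (rule integrable_continuous)
  show "continuous_on {-1..1} (\<lambda>t. complex_of_real (poly p t) * (complex_of_real t - a) ^ m / (complex_of_real t - z))"
    using off_nz[OF assms] by (intro continuous_intros) auto
qed measurable

lemma integrable_ct_0: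
  assumes "z \<in> off"
  shows "integrable \<sigma> (\<lambda>t. complex_of_real (poly p t) / (complex_of_real t - z))"
  using integrable_ct[OF assms, where m = 0] by simp

lemma ct_add: "z \<in> off \<Longrightarrow> ct (p + q) z = ct p z + ct q z"
  by (simp add: ct_def add_divide_distrib integrable_ct_0)

lemma ct_smult: "ct (Polynomial.smult a p) z = complex_of_real a * ct p z"
  by (simp add: ct_def flip: integral_mult_right_zero)

lemma ct_0 [simp]: "ct 0 z = 0" by (simp add: ct_def)

lemma lint_complex: "complex_of_real (lint p) = (\<integral>t. complex_of_real (poly p t) \<partial>\<sigma>)"
  unfolding lint_def by (simp add: integral_of_real)

lemma integral_shift_step:
  assumes z: "z \<in> off"
  shows "(\<integral>t. complex_of_real (poly p t) * (complex_of_real t - a) ^ Suc m / (complex_of_real t - z) \<partial>\<sigma>) =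
    (z - a) * (\<integral>t. complex_of_real (poly p t) * (complex_of_real t - a) ^ m / (complex_of_real t - z) \<partial>\<sigma>)
    + (\<integral>t. complex_of_real (poly p t) * (complex_of_real t - a) ^ m \<partial>\<sigma>)"
proof -
  let ?f = "\<lambda>t. complex_of_real (poly p t) * (complex_of_real t - a) ^ m / (complex_of_real t - z)"
  let ?g = "\<lambda>t. complex_of_real (poly p t) * (complex_of_real t - a) ^ m"
  have f: "integrable \<sigma> ?f" by (rule integrable_ct[OF z])
  have g: "integrable \<sigma> ?g"
  proof (rule integrable_continuous)
    show "continuous_on {-1..1} ?g" by (intro continuous_intros)
  qed measurable
  have "(\<integral>t. complex_of_real (poly p t) * (complex_of_real t - a) ^ Suc m / (complex_of_real t - z) \<partial>\<sigma>)
      = (\<integral>t. (z - a) * ?f t + ?g t \<partial>\<sigma>)"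
  proof (rule integral_cong_AE)
    show "AE t in \<sigma>. complex_of_real (poly p t) * (complex_of_real t - a) ^ Suc m / (complex_of_real t - z) = (z - a) * ?f t + ?g t"
      using AE_interval
    proof eventually_elim
      case (elim t)
      then show ?case using off_nz[OF z elim] by (simp add: field_simps)
    qed
  qed (rule borel_sigma, measurable)+
  also have "\<dots> = (z - a) * (\<integral>t. ?f t \<partial>\<sigma>) + (\<integral>t. ?g t \<partial>\<sigma>)"
    unfolding Bochner_Integration.integral_add[OF integrable_mult_right[OF f] g] integral_mult_right_zero ..
  finally show ?thesis .
qed

lemma ct_pCons_0: "z \<in> off \<Longrightarrow> ct (pCons 0 p) z = z * ct p z + complex_of_real (lint p)"
  using integral_shift_step[of z p 0 0] by (simp add: ct_def lint_complex mult.commute)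

lemma ct_monom:
  assumes "z \<in> off"
  shows "ct (p * monom 1 N) z =
    z ^ N * (ct p z + (\<Sum>k<N. complex_of_real (lint (p * monom 1 k)) / z ^ Suc k))"
proof (induction N)
  case 0
  show ?case by (simp add: monom_0 one_pCons[symmetric])
next
  case (Suc N)
  have "ct (p * monom 1 (Suc N)) z = z * ct (p * monom 1 N) z + complex_of_real (lint (p * monom 1 N))"
    using ct_pCons_0[OF assms, of "p * monom 1 N"] by (simp add: monom_Suc)
  then show ?case using Suc off_not_0[OF assms] by (simp add: algebra_simps)
qed

lemma ct_mult:
  assumes z: "z \<in> off" and orth: "\<And>r. degree r < N \<Longrightarrow> lint (r * p) = 0" and q: "degree q \<le> N"
  shows "ct (q * p) z = cp q z * ct p z"
  using q
proof (induction q)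
  case (pCons a q)
  have lint: "lint (q * p) = 0" using pCons.prems orth[of q] by (cases "q = 0") auto
  have "degree q \<le> N" using pCons.prems by (cases "q = 0") auto
  then show ?case using pCons.IH lint
    by (simp add: ct_add[OF z] ct_smult ct_pCons_0[OF z] cp_pCons algebra_simps)
qed simp

text \<open>For \<open>q\<close> of degree \<open>N + 1\<close> the two sides still agree up to the integral of \<open>p\<close> against the quotient of
  \<open>q - q(0)\<close> by \<open>t\<close>, which is real.\<close>

lemma Im_ct_mult:
  assumes z: "z \<in> off" and orth: "\<And>r. degree r < N \<Longrightarrow> lint (r * p) = 0" and q: "degree q \<le> Suc N"
  shows "Im (cp q z * ct p z) = Im (ct (q * p) z)"
proof (cases q)
  case (pCons a r)
  have "degree r \<le> N" using q pCons by (cases "r = 0") auto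
  then have "ct (r * p) z = cp r z * ct p z" using ct_mult[OF z orth] by blast
  then show ?thesis using pCons
    by (simp add: ct_add[OF z] ct_smult ct_pCons_0[OF z] cp_pCons algebra_simps)
qed

lemma Im_ct_square:
  assumes z: "Im z \<noteq> 0"
  shows "\<bar>Im (ct (p * p) z)\<bar> \<ge> \<bar>Im z\<bar> / (cmod z + 1)\<^sup>2 * lint (p * p)"
proof -
  note off = off_nonreal[OF z]
  let ?f = "\<lambda>t. poly (p * p) t / (cmod (complex_of_real t - z))\<^sup>2"
  have nz: "complex_of_real t - z \<noteq> 0" for t using z by (auto simp: complex_eq_iff)
  have int: "integrable \<sigma> ?f"
  proof (rule integrable_continuous)
    show "continuous_on {-1..1} ?f" using nz by (intro continuous_intros) auto
  qed measurable
  have "Im (ct (p * p) z) = (\<integral>t. Im (complex_of_real (poly (p * p) t) / (complex_of_real t - z)) \<partial>\<sigma>)"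
    unfolding ct_def by (rule integral_Im[symmetric]) (rule integrable_ct_0[OF off])
  also have "\<dots> = (\<integral>t. Im z * ?f t \<partial>\<sigma>)"
    by (rule Bochner_Integration.integral_cong) (simp_all add: Im_divide cmod_def)
  finally have eq: "Im (ct (p * p) z) = Im z * (\<integral>t. ?f t \<partial>\<sigma>)"
    unfolding integral_mult_right_zero .
  have "lint (p * p) / (cmod z + 1)\<^sup>2 = (\<integral>t. poly (p * p) t / (cmod z + 1)\<^sup>2 \<partial>\<sigma>)"
    unfolding lint_def by (rule integral_divide_zero[symmetric])
  also have "\<dots> \<le> (\<integral>t. ?f t \<partial>\<sigma>)"
  proof (rule integral_mono_AE)
    show "AE t in \<sigma>. poly (p * p) t / (cmod z + 1)\<^sup>2 \<le> ?f t"
      using AE_interval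
    proof eventually_elim
      case (elim t)
      have "cmod (complex_of_real t - z) \<le> cmod z + 1"
      proof -
        have "\<bar>t\<bar> \<le> 1" using elim by auto
        then show ?thesis using norm_triangle_ineq4[of "complex_of_real t" z] by simp
      qed
      then have "(cmod (complex_of_real t - z))\<^sup>2 \<le> (cmod z + 1)\<^sup>2" by (intro power_mono) auto
      then show ?case using nz[of t] by (intro divide_left_mono) (auto intro!: mult_pos_pos)
    qed
  qed (rule integrable_divide, rule integrable_poly, rule int)
  finally have "\<bar>Im z\<bar> * (lint (p * p) / (cmod z + 1)\<^sup>2) \<le> \<bar>Im z\<bar> * \<bar>\<integral>t. ?f t \<partial>\<sigma>\<bar>"
    by (intro mult_left_mono) auto
  then show ?thesis unfolding eq by (simp add: abs_mult)
qed

text \<open>The Cauchy-Schwarz inequality, from the variance of \<open>\<bar>p\<bar>\<close>.\<close>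

lemma integral_abs_poly_le: "(\<integral>t. \<bar>poly p t\<bar> \<partial>\<sigma>) \<le> sqrt (lint 1 * lint (p * p))"
proof -
  define I where "I = (\<integral>t. \<bar>poly p t\<bar> \<partial>\<sigma>)"
  \<comment> \<open>the mean of \<open>\<bar>p\<bar>\<close>\<close>
  define m where "m = I / lint 1"
  have int: "integrable \<sigma> (\<lambda>t. \<bar>poly p t\<bar>)" by (intro integrable_abs integrable_poly)
  have i2: "integrable \<sigma> (\<lambda>t. poly p t * poly p t)" using integrable_poly[of "p * p"] by (simp only: poly_mult[abs_def])
  have l1: "lint 1 = (\<integral>t. 1 \<partial>\<sigma>)" by (simp add: lint_def)
  have "0 \<le> (\<integral>t. (\<bar>poly p t\<bar> - m)\<^sup>2 \<partial>\<sigma>)" by (intro integral_nonneg_AE) auto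
  also have "\<dots> = (\<integral>t. poly p t * poly p t - 2 * m * \<bar>poly p t\<bar> + m\<^sup>2 \<partial>\<sigma>)"
    by (rule Bochner_Integration.integral_cong) (auto simp: power2_eq_square algebra_simps)
  also have "\<dots> = lint (p * p) - 2 * m * I + m\<^sup>2 * lint 1"
    using int i2 by (simp add: lint_def I_def l1)
  also have "\<dots> = lint (p * p) - I\<^sup>2 / lint 1" using lint_1_pos by (simp add: m_def power2_eq_square field_simps)
  finally have "I\<^sup>2 \<le> lint 1 * lint (p * p)" using lint_1_pos by (simp add: field_simps)
  then show ?thesis unfolding I_def[symmetric] by (rule real_le_rsqrt)
qed

lemma norm_integral_le:
  assumes D: "D > 0" "\<And>t. t \<in> {-1..1} \<Longrightarrow> D \<le> cmod (complex_of_real t - z)"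
    and T: "\<And>t. t \<in> {-1..1} \<Longrightarrow> cmod (complex_of_real t - a) \<le> T"
  shows "cmod (\<integral>t. complex_of_real (poly p t) * (complex_of_real t - a) ^ m / (complex_of_real t - z) \<partial>\<sigma>)
    \<le> T ^ m / D * sqrt (lint 1 * lint (p * p))"
proof -
  have T0: "T \<ge> 0" using T[of 0] norm_ge_zero[of "complex_of_real 0 - a"] by (meson atLeastAtMost_iff neg_le_0_iff_le order_trans zero_le_one)
  have z: "z \<in> off" using D by (force simp: off_def)
  let ?f = "\<lambda>t. complex_of_real (poly p t) * (complex_of_real t - a) ^ m / (complex_of_real t - z)"
  have "cmod (\<integral>t. ?f t \<partial>\<sigma>) \<le> (\<integral>t. cmod (?f t) \<partial>\<sigma>)"
    by (rule integral_norm_bound)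
  also have "\<dots> \<le> (\<integral>t. T ^ m / D * \<bar>poly p t\<bar> \<partial>\<sigma>)"
  proof (rule integral_mono_AE)
    show "AE t in \<sigma>. cmod (?f t) \<le> T ^ m / D * \<bar>poly p t\<bar>"
      using AE_interval
    proof eventually_elim
      case (elim t)
      have "cmod (complex_of_real t - a) ^ m / cmod (complex_of_real t - z) \<le> T ^ m / D"
        using D T[OF elim] D(2)[OF elim] T0 by (intro frac_le power_mono) auto
      then have "\<bar>poly p t\<bar> * (cmod (complex_of_real t - a) ^ m / cmod (complex_of_real t - z)) \<le> \<bar>poly p t\<bar> * (T ^ m / D)"
        by (intro mult_left_mono) auto
      then show ?case by (simp add: norm_mult norm_divide norm_power mult.commute)
    qed
  qed (use integrable_ct[OF z] in \<open>auto intro!: integrable_mult_right integrable_abs\<close>)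
  also have "\<dots> = T ^ m / D * (\<integral>t. \<bar>poly p t\<bar> \<partial>\<sigma>)" by simp
  also have "\<dots> \<le> T ^ m / D * sqrt (lint 1 * lint (p * p))"
    using T0 D by (intro mult_left_mono integral_abs_poly_le) auto
  finally show ?thesis .
qed

lemma norm_ct_le:
  assumes "D > 0" "\<And>t. t \<in> {-1..1} \<Longrightarrow> D \<le> cmod (complex_of_real t - z)"
  shows "cmod (ct p z) \<le> sqrt (lint 1 * lint (p * p)) / D"
proof -
  have "cmod (complex_of_real t - 0) \<le> 1" if "t \<in> {-1..1}" for t using that by auto
  from norm_integral_le[OF assms this, where m = 0] show ?thesis by (simp add: ct_def)
qed

text \<open>By orthogonality, \<open>1 / (t - z)\<close> may be replaced by \<open>((t - a) / (z - a)) ^ m / (t - z)\<close>, the remainder after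
  subtraction of its Taylor polynomial about any centre \<open>a\<close>.\<close>

lemma ct_shift:
  assumes z: "z \<in> off" and orth: "\<And>i. i < N \<Longrightarrow> lint (p * monom 1 i) = 0" and m: "m \<le> N"
  shows "(\<integral>t. complex_of_real (poly p t) * (complex_of_real t - a) ^ m / (complex_of_real t - z) \<partial>\<sigma>) = (z - a) ^ m * ct p z"
  using m
proof (induction m)
  case 0
  show ?case by (simp add: ct_def)
next
  case (Suc m)
  have "(\<integral>t. complex_of_real (poly p t) * (complex_of_real t - a) ^ m \<partial>\<sigma>)
      = (\<integral>t. (\<Sum>k\<le>m. (of_nat (m choose k) * (- a) ^ (m - k)) * complex_of_real (poly (p * monom 1 k) t)) \<partial>\<sigma>)"
  proof (rule Bochner_Integration.integral_cong[OF refl])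
    fix t
    have "(complex_of_real t - a) ^ m = (\<Sum>k\<le>m. of_nat (m choose k) * complex_of_real t ^ k * (- a) ^ (m - k))"
      using binomial_ring[of "complex_of_real t" "- a" m] by simp
    then show "complex_of_real (poly p t) * (complex_of_real t - a) ^ m =
      (\<Sum>k\<le>m. (of_nat (m choose k) * (- a) ^ (m - k)) * complex_of_real (poly (p * monom 1 k) t))"
      by (simp add: poly_monom sum_distrib_left mult_ac)
  qed
  also have "\<dots> = (\<Sum>k\<le>m. (of_nat (m choose k) * (- a) ^ (m - k)) * complex_of_real (lint (p * monom 1 k)))"
    by (subst Bochner_Integration.integral_sum)
      (auto simp: lint_complex intro!: integrable_mult_right integrable_of_real integrable_poly simp del: poly_mult)
  also have "\<dots> = 0" using orth Suc.prems by (intro sum.neutral) auto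
  finally show ?case using Suc integral_shift_step[OF z, of p a m] by simp
qed

end

context shifted_moments
begin

text \<open>The Cauchy transform with respect to the functional \<open>sf\<close>, that is, \<open>sf\<close> applied to the function
  \<open>t \<mapsto> p(t) / (t - z)\<close>. The given function is \<open>rt 1\<close>.\<close>

definition rt :: "real poly \<Rightarrow> complex \<Rightarrow> complex" where
  "rt p z = (ct p z - complex_of_real (sf p)) / z"

lemma sf_1: "sf 1 = s_m1"
  using sf_pCons[of 1 0] by (simp add: one_pCons)

lemma rt_0 [simp]: "rt 0 z = 0" by (simp add: rt_def)

lemma rt_add: "z \<in> off \<Longrightarrow> rt (p + q) z = rt p z + rt q z"
  by (simp add: rt_def ct_add sf_add add_divide_distrib diff_divide_distrib)

lemma rt_smult: "rt (Polynomial.smult a p) z = complex_of_real a * rt p z"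
  by (simp add: rt_def ct_smult sf_smult algebra_simps diff_divide_distrib)

lemma rt_diff: "z \<in> off \<Longrightarrow> rt (p - q) z = rt p z - rt q z"
  using rt_add[of z p "Polynomial.smult (-1) q"] rt_smult[of "-1" q z] by simp

lemma rt_pCons_0: "z \<in> off \<Longrightarrow> rt (pCons 0 p) z = z * rt p z + complex_of_real (sf p)"
  using off_not_0[of z] by (simp add: rt_def ct_pCons_0 sf_pCons field_simps)

lemma rt_mult:
  assumes z: "z \<in> off" and orth: "\<And>r. degree r < N \<Longrightarrow> sf (p * r) = 0" and q: "degree q \<le> N"
  shows "rt (q * p) z = cp q z * rt p z"
  using q
proof (induction q)
  case (pCons a q)
  have sf: "sf (q * p) = 0" using pCons.prems orth[of q] by (cases "q = 0") (auto simp: mult.commute)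
  have "degree q \<le> N" using pCons.prems by (cases "q = 0") auto
  then show ?case using pCons.IH sf
    by (simp add: rt_add[OF z] rt_smult rt_pCons_0[OF z] cp_pCons algebra_simps)
qed simp

text \<open>The recurrence at the start has the form of the general step, with \<open>-1\<close> in place of \<open>rt (G (-1))\<close> and
  the coefficient \<open>\<eta> 0\<close>.\<close>

lemma rt_G_Suc_0: assumes z: "z \<in> off"
  shows "rt (G (Suc 0)) z = cp (pp 0) z * rt (G 0) z + complex_of_real (\<eta> 0)"
proof -
  obtain a q where p: "pp 0 = pCons a q" by (cases "pp 0")
  have d: "degree (pp 0) = \<nu> (Suc 0)" "lead_coeff (pp 0) = 1" using pp_degree[of 0] pp_lead[of 0] by auto
  have dpos: "\<nu> (Suc 0) > 0" by (rule \<nu>_pos) simp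
  have q0: "q \<noteq> 0" using d dpos p by auto
  then have dq: "\<nu> (Suc 0) = Suc (degree q)" using d p by simp
  have q: "degree q = \<nu> (Suc 0) - 1" "lead_coeff q = 1" using d(2) q0 p dq by simp_all
  have "rt (q * 1) z = cp q z * rt 1 z"
    by (rule rt_mult[OF z, where N = "\<nu> (Suc 0) - 1"]) (use sf_G_degree_less[of _ 0] q in \<open>auto simp: G_0\<close>)
  moreover have "sf q = \<eta> 0" using sf_G_monic[of q 0] q by (simp add: G_0)
  moreover have eq: "pp 0 = Polynomial.smult a 1 + pCons 0 q" by (simp add: p)
  moreover have "rt (pp 0) z = complex_of_real a * rt 1 z + (z * rt q z + complex_of_real (sf q))"
    by (simp only: eq rt_add[OF z] rt_smult rt_pCons_0[OF z])
  ultimately show ?thesis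
    by (simp add: G_Suc_0 G_0 cp_pCons algebra_simps)
qed

lemma rt_G_Suc_Suc:
  assumes z: "z \<in> off"
  shows "rt (G (Suc (Suc j))) z = cp (pp (Suc j)) z * rt (G (Suc j)) z - complex_of_real (cc j) * rt (G j) z"
proof -
  have "rt (pp (Suc j) * G (Suc j)) z = cp (pp (Suc j)) z * rt (G (Suc j)) z"
  proof (rule rt_mult[OF z])
    show "sf (G (Suc j) * r) = 0" if "degree r < \<nu> (Suc (Suc j)) - 1" for r
      using that by (rule sf_G_degree_less)
    show "degree (pp (Suc j)) \<le> \<nu> (Suc (Suc j)) - 1"
      using pp_degree[of "Suc j"] \<nu>_pos[of "Suc j"] by simp
  qed
  then show ?thesis by (simp add: G_Suc_Suc rt_diff[OF z] rt_smult)
qed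

text \<open>The Wronskian of the solutions \<open>rt (G j)\<close> and \<open>G j\<close> of the same recurrence.\<close>

lemma rt_wronskian:
  assumes z: "z \<in> off"
  shows "rt (G (Suc j)) z * cp (G j) z - rt (G j) z * cp (G (Suc j)) z = complex_of_real (\<eta> j)"
proof (induction j)
  case 0
  show ?case using rt_G_Suc_0[OF z] by (simp add: G_0 G_Suc_0)
next
  case (Suc j)
  have "rt (G (Suc (Suc j))) z * cp (G (Suc j)) z - rt (G (Suc j)) z * cp (G (Suc (Suc j))) z
    = complex_of_real (cc j) * (rt (G (Suc j)) z * cp (G j) z - rt (G j) z * cp (G (Suc j)) z)"
    by (simp only: rt_G_Suc_Suc[OF z]) (simp add: G_Suc_Suc cp_diff cp_mult cp_smult algebra_simps)
  also have "\<dots> = complex_of_real (\<eta> (Suc j))"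
    unfolding Suc using \<eta>_nz[of j] by (simp add: cc_def)
  finally show ?case .
qed

text \<open>The polynomial of the second kind is built by recursion on \<open>p\<close>: for \<open>a + t p\<close> it is
  \<open>sf p + z v\<close>, where \<open>v\<close> belongs to \<open>p\<close>.\<close>

lemma second_kind_exists:
  "\<exists>v. (v = 0 \<or> degree v < degree p) \<and> (\<forall>z\<in>off. rt p z = cp p z * rt 1 z + cp v z)"
proof (induction p)
  case 0
  show ?case by (intro exI[of _ 0]) simp
next
  case (pCons a p)
  then obtain v where v: "v = 0 \<or> degree v < degree p" "\<And>z. z \<in> off \<Longrightarrow> rt p z = cp p z * rt 1 z + cp v z" by blast
  have "rt (pCons a p) z = cp (pCons a p) z * rt 1 z + cp (pCons (sf p) v) z" if z: "z \<in> off" for z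
  proof -
    have "pCons a p = Polynomial.smult a 1 + pCons 0 p" by simp
    then have "rt (pCons a p) z = complex_of_real a * rt 1 z + (z * rt p z + complex_of_real (sf p))"
      by (metis rt_add[OF z] rt_smult rt_pCons_0[OF z])
    then show ?thesis using v(2)[OF z] by (simp add: cp_pCons algebra_simps)
  qed
  moreover have "pCons (sf p) v = 0 \<or> degree (pCons (sf p) v) < degree (pCons a p)"
    using v(1) by (cases "p = 0") (auto simp: degree_pCons_eq_if)
  ultimately show ?case by blast
qed

text \<open>The polynomials of the second kind of \<open>sf\<close>, up to sign the numerators of the Pade approximants.\<close>

definition V :: "nat \<Rightarrow> real poly" where
  "V j = (SOME v. (v = 0 \<or> degree v < \<nu> j) \<and> (\<forall>z\<in>off. rt (G j) z = cp (G j) z * rt 1 z + cp v z))"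

lemma V_degree: "V j = 0 \<or> degree (V j) < \<nu> j"
  and rt_G: "z \<in> off \<Longrightarrow> rt (G j) z = cp (G j) z * rt 1 z + cp (V j) z"
proof -
  have "(V j = 0 \<or> degree (V j) < \<nu> j) \<and> (\<forall>z\<in>off. rt (G j) z = cp (G j) z * rt 1 z + cp (V j) z)"
    unfolding V_def using second_kind_exists[of "G j"] unfolding G_degree by (rule someI_ex)
  then show "V j = 0 \<or> degree (V j) < \<nu> j"
    "z \<in> off \<Longrightarrow> rt (G j) z = cp (G j) z * rt 1 z + cp (V j) z" by auto
qed

text \<open>The identity extends from the complement of the interval to the whole plane, which shows that \<open>G j\<close>
  and \<open>V j\<close> are coprime.\<close>

lemma wronskian: "cp (V (Suc j)) z * cp (G j) z - cp (V j) z * cp (G (Suc j)) z = complex_of_real (\<eta> j)"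
proof -
  define w where "w = map_poly complex_of_real (V (Suc j) * G j - V j * G (Suc j) - [:\<eta> j:])"
  have w: "poly w z = cp (V (Suc j)) z * cp (G j) z - cp (V j) z * cp (G (Suc j)) z - complex_of_real (\<eta> j)" for z
    unfolding w_def cp_def[symmetric] by (simp add: cp_diff cp_mult cp_pCons)
  have "poly w z = 0" if z: "z \<in> off" for z
    using rt_wronskian[OF z, of j] unfolding w rt_G[OF z] by (simp add: algebra_simps)
  then have "off \<subseteq> {z. poly w z = 0}" by blast
  moreover have "infinite off"
  proof
    assume "finite off"
    then have "finite ((\<lambda>n. complex_of_real (real n + 2)) ` UNIV)"
      by (rule finite_subset[rotated]) (auto intro!: off_large simp del: of_real_add)
    moreover have "inj (\<lambda>n. complex_of_real (real n + 2))" by (auto simp: inj_on_def)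
    ultimately show False by (simp add: finite_image_iff)
  qed
  ultimately have "w = 0" using poly_roots_finite[of w] finite_subset by blast
  then show ?thesis using w[of z] by simp
qed

lemma G_V_no_common_zero: "cp (G j) z = 0 \<Longrightarrow> cp (V j) z \<noteq> 0"
  using wronskian[of j z] \<eta>_nz[of j] by auto

end

section \<open>Expansions at infinity\<close>

text \<open>A power series with real coefficients, viewed over the complex numbers.\<close>

definition cfps :: "real fps \<Rightarrow> complex fps" where
  "cfps A = Abs_fps (\<lambda>n. complex_of_real (fps_nth A n))"

lemma cfps_nth [simp]: "fps_nth (cfps A) n = complex_of_real (fps_nth A n)"
  by (simp add: cfps_def)

lemma cfps_add: "cfps (A + B) = cfps A + cfps B"
  by (rule fps_ext) simp

lemma cfps_mult: "cfps (A * B) = cfps A * cfps B"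
  by (rule fps_ext) (simp add: fps_mult_nth)

lemma cfps_const: "cfps (fps_const a) = fps_const (complex_of_real a)"
  by (rule fps_ext) simp

lemma cfps_X: "cfps fps_X = fps_X"
  by (rule fps_ext) (simp add: fps_X_def)

lemma cfps_1: "cfps 1 = 1"
  by (rule fps_ext) simp

lemma cfps_0: "cfps 0 = 0"
  by (rule fps_ext) simp

lemma cfps_shift: "cfps (fps_shift n A) = fps_shift n (cfps A)"
  by (rule fps_ext) simp

lemma cfps_inverse:
  assumes "fps_nth A 0 \<noteq> 0" shows "cfps (inverse A) = inverse (cfps A)"
proof -
  have "cfps A * cfps (inverse A) = cfps (inverse A * A)" by (simp add: cfps_mult mult.commute)
  also have "\<dots> = 1" using assms by (simp add: inverse_mult_eq_1 cfps_1)
  finally show ?thesis using fps_inverse_unique[of "cfps A" "cfps (inverse A)"] by simp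
qed

text \<open>\<open>f\<close> has, near infinity, the convergent expansion \<open>\<Sum>n. A n / z ^ n\<close> with real coefficients.\<close>

definition rexp :: "(complex \<Rightarrow> complex) \<Rightarrow> real fps \<Rightarrow> bool" where
  "rexp f A \<longleftrightarrow> (\<exists>g. g has_fps_expansion cfps A \<and> eventually (\<lambda>z. f z = g (1 / z)) at_infinity)"

lemma rexp_cong: "rexp f A \<Longrightarrow> eventually (\<lambda>z. f' z = f z) at_infinity \<Longrightarrow> rexp f' A"
proof -
  assume "rexp f A" and ev: "eventually (\<lambda>z. f' z = f z) at_infinity"
  then obtain g where g: "g has_fps_expansion cfps A" "eventually (\<lambda>z. f z = g (1 / z)) at_infinity"
    unfolding rexp_def by blast
  have "eventually (\<lambda>z. f' z = g (1 / z)) at_infinity"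
    using g(2) ev by eventually_elim simp
  then show "rexp f' A" using g(1) unfolding rexp_def by blast
qed

lemma rexp_add: assumes "rexp f A" "rexp f' B" shows "rexp (\<lambda>z. f z + f' z) (A + B)"
proof -
  obtain g g' where g: "g has_fps_expansion cfps A" "eventually (\<lambda>z. f z = g (1 / z)) at_infinity"
    and g': "g' has_fps_expansion cfps B" "eventually (\<lambda>z. f' z = g' (1 / z)) at_infinity"
    using assms unfolding rexp_def by blast
  have "eventually (\<lambda>z. f z + f' z = g (1 / z) + g' (1 / z)) at_infinity"
    using g(2) g'(2) by eventually_elim simp
  then show ?thesis unfolding rexp_def cfps_add using has_fps_expansion_add[OF g(1) g'(1)] by blast
qed

lemma rexp_mult: assumes "rexp f A" "rexp f' B" shows "rexp (\<lambda>z. f z * f' z) (A * B)"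
proof -
  obtain g g' where g: "g has_fps_expansion cfps A" "eventually (\<lambda>z. f z = g (1 / z)) at_infinity"
    and g': "g' has_fps_expansion cfps B" "eventually (\<lambda>z. f' z = g' (1 / z)) at_infinity"
    using assms unfolding rexp_def by blast
  have "eventually (\<lambda>z. f z * f' z = g (1 / z) * g' (1 / z)) at_infinity"
    using g(2) g'(2) by eventually_elim simp
  then show ?thesis unfolding rexp_def cfps_mult using has_fps_expansion_mult[OF g(1) g'(1)] by blast
qed

lemma rexp_inverse:
  assumes "rexp f A" "fps_nth A 0 \<noteq> 0" shows "rexp (\<lambda>z. inverse (f z)) (inverse A)"
proof -
  obtain g where g: "g has_fps_expansion cfps A" "eventually (\<lambda>z. f z = g (1 / z)) at_infinity"
    using assms unfolding rexp_def by blast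
  have "eventually (\<lambda>z. inverse (f z) = inverse (g (1 / z))) at_infinity"
    using g(2) by eventually_elim simp
  then show ?thesis unfolding rexp_def cfps_inverse[OF assms(2)]
    using has_fps_expansion_inverse[OF g(1)] assms(2) by auto
qed

lemma rexp_const: "rexp (\<lambda>_. complex_of_real a) (fps_const a)"
  unfolding rexp_def cfps_const by (intro exI[of _ "\<lambda>_. complex_of_real a"]) auto

lemma rexp_cmult: "rexp f A \<Longrightarrow> rexp (\<lambda>z. complex_of_real a * f z) (fps_const a * A)"
  by (rule rexp_mult[OF rexp_const])

lemma rexp_inverse_power: "rexp (\<lambda>z. 1 / z ^ n) (fps_X ^ n)"
proof (induction n)
  case 0
  show ?case using rexp_const[of 1] by simp
next
  case (Suc n)
  have "rexp (\<lambda>z. 1 / z) fps_X"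
    unfolding rexp_def cfps_X by (intro exI[of _ "\<lambda>w. w"]) (auto intro: has_fps_expansion_fps_X)
  from rexp_mult[OF this Suc] show ?case by simp
qed

lemma eventually_nonzero_at_infinity: "eventually (\<lambda>z::complex. z \<noteq> 0) at_infinity"
  by (rule eventually_at_infinityI[of 1]) auto

lemma one_divide_tendsto_0_at_infinity: "filterlim (\<lambda>z::complex. 1 / z) (nhds 0) at_infinity"
proof -
  have "inverse = (\<lambda>z::complex. 1 / z)" by (simp add: fun_eq_iff inverse_eq_divide)
  then show ?thesis using tendsto_inverse_0[where 'a = complex] by simp
qed

lemma rexp_shift:
  assumes f: "rexp f A" and A: "\<And>n. n < N \<Longrightarrow> fps_nth A n = 0"
  shows "rexp (\<lambda>z. z ^ N * f z) (fps_shift N A)"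
proof (cases "A = 0")
  case True
  obtain g where g: "g has_fps_expansion 0" "eventually (\<lambda>z. f z = g (1 / z)) at_infinity"
    using f unfolding rexp_def True cfps_0 by blast
  have "eventually (\<lambda>w. g w = 0) (nhds 0)" using g(1) by (simp add: has_fps_expansion_0_iff)
  then have "eventually (\<lambda>z. g (1 / z) = 0) at_infinity" using one_divide_tendsto_0_at_infinity by (rule eventually_compose_filterlim)
  then have ev: "eventually (\<lambda>z. z ^ N * f z = 0) at_infinity" using g(2) by eventually_elim simp
  have "rexp (\<lambda>_. 0) 0" using rexp_const[of 0] by simp
  then show ?thesis using ev True by (auto intro: rexp_cong)
next
  case False
  obtain g where g: "g has_fps_expansion cfps A" "eventually (\<lambda>z. f z = g (1 / z)) at_infinity"
    using f unfolding rexp_def by blast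
  obtain n where "fps_nth A n \<noteq> 0" using False by (auto simp: fps_eq_iff)
  then have "cfps A \<noteq> 0" by (auto simp: fps_eq_iff)
  then have "N \<le> subdegree (cfps A)" using A by (intro subdegree_geI) auto
  from has_fps_expansion_shift[OF g(1) this refl]
  have "(\<lambda>x. if x = 0 then fps_nth (cfps A) N else g x / x ^ N) has_fps_expansion cfps (fps_shift N A)"
    by (simp add: cfps_shift)
  moreover have "eventually (\<lambda>z. z ^ N * f z = (if 1 / z = 0 then fps_nth (cfps A) N else g (1 / z) / (1 / z) ^ N)) at_infinity"
    using g(2) eventually_nonzero_at_infinity by eventually_elim (simp add: power_divide)
  ultimately show ?thesis unfolding rexp_def by blast
qed

lemma rexp_tendsto: assumes "rexp f A" shows "(f \<longlongrightarrow> complex_of_real (fps_nth A 0)) at_infinity"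
proof -
  obtain g where g: "g has_fps_expansion cfps A" "eventually (\<lambda>z. f z = g (1 / z)) at_infinity"
    using assms unfolding rexp_def by blast
  have "((\<lambda>z. g (1 / z)) \<longlongrightarrow> complex_of_real (fps_nth A 0)) at_infinity"
    using filterlim_compose[OF has_fps_expansion_imp_tendsto_0[OF g(1)] one_divide_tendsto_0_at_infinity] by simp
  then show ?thesis using g(2) by (subst tendsto_cong)
qed

lemma rexp_sum_powers: "rexp (\<lambda>z. \<Sum>j<n. complex_of_real (a j) / z ^ (j + k)) (\<Sum>j<n. fps_const (a j) * fps_X ^ (j + k))"
proof (induction n)
  case 0
  show ?case using rexp_const[of 0] by simp
next
  case (Suc n)
  show ?case using rexp_add[OF Suc rexp_cmult[OF rexp_inverse_power[of "n + k"], of "a n"]] by simp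
qed

lemma sector_le_at_infinity: "sector_at_infinity \<epsilon> \<le> at_infinity"
  by (simp add: sector_at_infinity_def)

text \<open>The sector contains the positive imaginary axis, so limits along it are unique.\<close>

lemma sector_nontrivial: "sector_at_infinity (pi / 4) \<noteq> bot"
proof
  assume bot: "sector_at_infinity (pi / 4) = bot"
  have "eventually (\<lambda>z. \<not> (pi / 4 < Arg z \<and> Arg z < pi - pi / 4)) (at_infinity :: complex filter)"
    using bot unfolding sector_at_infinity_def trivial_limit_def eventually_inf_principal by simp
  then obtain b where b: "\<And>z. b \<le> cmod z \<Longrightarrow> \<not> (pi / 4 < Arg z \<and> Arg z < pi - pi / 4)"
    unfolding eventually_at_infinity by blast
  define y where "y = max 1 b"
  have y: "y > 0" "b \<le> y" by (simp_all add: y_def)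
  have "Arg (complex_of_real y * \<i>) = Arg \<i>" using y by (intro Arg_times_of_real)
  then have "Arg (complex_of_real y * \<i>) = pi / 2" by simp
  then show False using b[of "complex_of_real y * \<i>"] y pi_gt_zero by (simp add: norm_mult)
qed

lemma asymp_expansion_unique:
  assumes "asymp_expansion f s" "asymp_expansion f s'"
  shows "s = s'"
proof
  fix n show "s n = s' n"
  proof (induction n rule: less_induct)
    case (less n)
    let ?F = "sector_at_infinity (pi / 4)"
    have pos: "pi / 4 > 0" by simp
    have "(\<lambda>z. (f z + (\<Sum>j<Suc n. complex_of_real (s j) / z ^ (j + 1))) - (f z + (\<Sum>j<Suc n. complex_of_real (s' j) / z ^ (j + 1))))
      \<in> o[?F](\<lambda>z. 1 / z ^ Suc n)"
      by (rule sum_in_smallo(2))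
        (rule assms[unfolded asymp_expansion_def, rule_format, OF pos, of "Suc n"])+
    also have "(\<lambda>z. (f z + (\<Sum>j<Suc n. complex_of_real (s j) / z ^ (j + 1))) - (f z + (\<Sum>j<Suc n. complex_of_real (s' j) / z ^ (j + 1))))
      = (\<lambda>z. complex_of_real (s n - s' n) * (1 / z ^ Suc n))"
    proof
      fix z
      have "(\<Sum>j<n. complex_of_real (s j) / z ^ (j + 1)) = (\<Sum>j<n. complex_of_real (s' j) / z ^ (j + 1))"
        using less by (intro sum.cong) auto
      then show "(f z + (\<Sum>j<Suc n. complex_of_real (s j) / z ^ (j + 1))) - (f z + (\<Sum>j<Suc n. complex_of_real (s' j) / z ^ (j + 1)))
        = complex_of_real (s n - s' n) * (1 / z ^ Suc n)"
        by (simp add: diff_divide_distrib)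
    qed
    finally have small: "(\<lambda>z. complex_of_real (s n - s' n) * (1 / z ^ Suc n)) \<in> o[?F](\<lambda>z. 1 / z ^ Suc n)" .
    show "s n = s' n"
    proof (rule ccontr)
      assume ne: "s n \<noteq> s' n"
      define c where "c = \<bar>s n - s' n\<bar> / 2"
      have c: "c > 0" "\<bar>s n - s' n\<bar> = 2 * c" using ne by (simp_all add: c_def)
      have "eventually (\<lambda>z. norm (complex_of_real (s n - s' n) * (1 / z ^ Suc n)) \<le> c * norm (1 / z ^ Suc n)) ?F"
        using landau_o.smallD[OF small c(1)] .
      moreover have "eventually (\<lambda>z. z \<noteq> 0) ?F"
        using eventually_nonzero_at_infinity sector_le_at_infinity by (rule filter_leD[rotated])
      ultimately have "eventually (\<lambda>z. False) ?F"
      proof eventually_elim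
        case (elim z)
        have "norm (complex_of_real (s n - s' n)) = 2 * c" using c(2) by (simp only: norm_of_real)
        then have "2 * c * norm (1 / z ^ Suc n) \<le> c * norm (1 / z ^ Suc n)"
          using elim(1) by (simp only: norm_mult)
        moreover have "norm (1 / z ^ Suc n) > 0" using elim(2) by simp
        ultimately show False using c(1) by simp
      qed
      then show False using sector_nontrivial by simp
    qed
  qed
qed

lemma rexp_asymp_expansion:
  assumes f: "rexp f A" and A0: "fps_nth A 0 = 0"
  shows "asymp_expansion f (\<lambda>j. - fps_nth A (Suc j))"
  unfolding asymp_expansion_def
proof (intro allI impI)
  fix \<epsilon> :: real and n :: nat
  define E where "E z = f z + (\<Sum>j<n. complex_of_real (- fps_nth A (Suc j)) / z ^ (j + 1))" for z
  define B where "B = A + (\<Sum>j<n. fps_const (- fps_nth A (Suc j)) * fps_X ^ (j + 1))"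
  have E: "rexp E B" unfolding E_def B_def by (intro rexp_add f rexp_sum_powers)
  have B: "fps_nth B i = 0" if "i \<le> n" for i
  proof (cases i)
    case 0
    then show ?thesis using A0 by (simp add: B_def fps_sum_nth)
  next
    case (Suc k)
    then have "k < n" using that by simp
    then show ?thesis using Suc by (simp add: B_def fps_sum_nth fps_X_power_nth if_distrib cong: if_cong)
  qed
  have "rexp (\<lambda>z. z ^ n * E z) (fps_shift n B)" using B by (intro rexp_shift[OF E]) auto
  from rexp_tendsto[OF this] have lim: "((\<lambda>z. z ^ n * E z) \<longlongrightarrow> 0) at_infinity"
    using B[of n] by simp
  have "E \<in> o[at_infinity](\<lambda>z. 1 / z ^ n)"
  proof (rule smalloI_tendsto)
    show "((\<lambda>z. E z / (1 / z ^ n)) \<longlongrightarrow> 0) at_infinity" using lim by (simp add: mult.commute)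
    show "eventually (\<lambda>z. 1 / z ^ n \<noteq> 0) (at_infinity :: complex filter)"
      using eventually_nonzero_at_infinity by eventually_elim simp
  qed
  then have "E \<in> o[sector_at_infinity \<epsilon>](\<lambda>z. 1 / z ^ n)"
    using landau_o.small.filter_mono[OF sector_le_at_infinity] by blast
  then show "(\<lambda>z. f z + (\<Sum>j<n. complex_of_real (- fps_nth A (Suc j)) / z ^ (j + 1))) \<in> o[sector_at_infinity \<epsilon>](\<lambda>z. 1 / z ^ n)"
    unfolding E_def .
qed

lemma rexp_asymp_coeffs:
  assumes "rexp f A" "fps_nth A 0 = 0" shows "asymp_coeffs f = (\<lambda>j. - fps_nth A (Suc j))"
  unfolding asymp_coeffs_def
  using rexp_asymp_expansion[OF assms] asymp_expansion_unique by (intro the_equality) auto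

lemma rexp_first_coeff:
  assumes f: "rexp f (fps_X ^ k * B)" and k: "k \<ge> 1" and B: "fps_nth B 0 \<noteq> 0"
  shows "first_coeff f = - fps_nth B 0"
proof -
  have nth: "fps_nth (fps_X ^ k * B) n = (if n < k then 0 else fps_nth B (n - k))" for n
    by (rule fps_X_power_mult_nth)
  have ac: "asymp_coeffs f = (\<lambda>j. - fps_nth (fps_X ^ k * B) (Suc j))"
    using f k by (intro rexp_asymp_coeffs) (auto simp: nth)
  have "(LEAST n. asymp_coeffs f n \<noteq> 0) = k - 1"
    using k B by (intro Least_equality) (auto simp: ac nth split: if_splits)
  then show ?thesis using k by (simp add: first_coeff_def ac nth)
qed

lemma polynomial_small_in_sector:
  assumes "(\<lambda>z. cp r z) \<in> o[sector_at_infinity (pi / 4)](\<lambda>_. 1)"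
  shows "r = 0"
proof (rule ccontr)
  assume r: "r \<noteq> 0"
  let ?F = "sector_at_infinity (pi / 4)"
  have big: "\<exists>c>0. eventually (\<lambda>z. c \<le> cmod (cp r z)) at_infinity"
  proof (cases "degree r = 0")
    case True
    then obtain a where "r = [:a:]" by (rule degree_eq_zeroE)
    then show ?thesis using r by (intro exI[of _ "\<bar>a\<bar>"]) (auto simp: cp_pCons)
  next
    case False
    have "degree (map_poly complex_of_real r) = degree r" by (rule degree_map_poly) auto
    then have "filterlim (cp r) at_infinity at_infinity"
      using False filterlim_poly_at_infinity[of "map_poly complex_of_real r"] by (simp add: cp_def[abs_def])
    then have "filterlim (\<lambda>z. cmod (cp r z)) at_top at_infinity"
      by (rule filterlim_at_infinity_imp_norm_at_top)
    then have "eventually (\<lambda>z. 1 \<le> cmod (cp r z)) at_infinity"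
      unfolding filterlim_at_top by blast
    then show ?thesis by (intro exI[of _ 1]) auto
  qed
  then obtain c where c: "c > 0" "eventually (\<lambda>z. c \<le> cmod (cp r z)) at_infinity" by blast
  have "eventually (\<lambda>z. c \<le> cmod (cp r z)) ?F" by (rule filter_leD[OF sector_le_at_infinity c(2)])
  moreover have "eventually (\<lambda>z. norm (cp r z) \<le> c / 2 * norm (1 :: complex)) ?F"
    using landau_o.smallD[OF assms, of "c / 2"] c(1) by simp
  ultimately have "eventually (\<lambda>z. False) ?F"
    by eventually_elim (use c(1) in auto)
  then show False using sector_nontrivial by simp
qed

text \<open>One step of the continued fraction, for a function known up to equality near infinity: the data of
  the step can be read off any decomposition \<open>- 1 / \<phi> = \<epsilon> p + \<kappa> \<psi>\<close> of the required form.\<close>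

lemma expansion_step:
  fixes f \<phi> \<psi> :: "complex \<Rightarrow> complex"
  assumes f: "eventually (\<lambda>z. f z = \<phi> z) at_infinity"
    and step: "eventually (\<lambda>z. - 1 / \<phi> z = complex_of_real \<epsilon> * cp p z + complex_of_real \<kappa> * \<psi> z) at_infinity"
    and p: "lead_coeff p = 1" and \<epsilon>: "\<bar>\<epsilon>\<bar> = 1" and \<epsilon>': "\<bar>\<epsilon>'\<bar> = 1" and \<kappa>: "\<kappa> > 0"
    and \<phi>: "rexp \<phi> (fps_X ^ k * B)" "k \<ge> 1" "fps_nth B 0 = - \<epsilon>"
    and \<psi>: "rexp \<psi> (fps_X ^ m * C)" "m \<ge> 1" "fps_nth C 0 = - \<epsilon>'"
  shows "first_coeff f = \<epsilon>" and "step_poly f = p" and "step_b f = sqrt \<kappa>"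
    and "eventually (\<lambda>z. step_remainder f z / complex_of_real ((step_b f)\<^sup>2) = \<psi> z) at_infinity"
proof -
  have \<epsilon>0: "\<epsilon> \<noteq> 0" using \<epsilon> by auto
  have \<epsilon>0': "\<epsilon>' \<noteq> 0" using \<epsilon>' by auto
  have "rexp f (fps_X ^ k * B)" by (rule rexp_cong[OF \<phi>(1) f])
  then show fc: "first_coeff f = \<epsilon>" using \<phi>(2,3) \<epsilon>0 rexp_first_coeff[of f k B] by simp
  have ev: "eventually (\<lambda>z. - 1 / f z - complex_of_real \<epsilon> * cp p z = complex_of_real \<kappa> * \<psi> z) at_infinity"
    using f step by eventually_elim simp
  have small: "(\<lambda>z. - 1 / f z - complex_of_real \<epsilon> * cp p z) \<in> o[sector_at_infinity \<delta>](\<lambda>_. 1)" for \<delta>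
  proof -
    have "((\<lambda>z. complex_of_real \<kappa> * \<psi> z) \<longlongrightarrow> 0) at_infinity"
      using rexp_tendsto[OF rexp_cmult[OF \<psi>(1)], of \<kappa>] \<psi>(2) by simp
    then have "((\<lambda>z. - 1 / f z - complex_of_real \<epsilon> * cp p z) \<longlongrightarrow> 0) at_infinity"
      using ev by (subst tendsto_cong)
    then have "(\<lambda>z. - 1 / f z - complex_of_real \<epsilon> * cp p z) \<in> o[at_infinity](\<lambda>_. 1)"
      by (intro smalloI_tendsto) auto
    then show ?thesis using landau_o.small.filter_mono[OF sector_le_at_infinity] by blast
  qed
  show sp: "step_poly f = p"
    unfolding step_poly_def fc cp_def[symmetric]
  proof (rule the_equality)
    show "lead_coeff p = 1 \<and> (\<forall>\<delta>>0. (\<lambda>z. - 1 / f z - complex_of_real \<epsilon> * cp p z) \<in> o[sector_at_infinity \<delta>](\<lambda>_. 1))"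
      using p small by blast
  next
    fix q
    assume q: "lead_coeff q = 1 \<and> (\<forall>\<delta>>0. (\<lambda>z. - 1 / f z - complex_of_real \<epsilon> * cp q z) \<in> o[sector_at_infinity \<delta>](\<lambda>_. 1))"
    have "(\<lambda>z. (- 1 / f z - complex_of_real \<epsilon> * cp q z) - (- 1 / f z - complex_of_real \<epsilon> * cp p z)) \<in> o[sector_at_infinity (pi / 4)](\<lambda>_. 1)"
      by (rule sum_in_smallo(2)) (use q small in auto)
    also have "(\<lambda>z. (- 1 / f z - complex_of_real \<epsilon> * cp q z) - (- 1 / f z - complex_of_real \<epsilon> * cp p z))
      = (\<lambda>z. cp (Polynomial.smult \<epsilon> (p - q)) z)"
      by (simp add: fun_eq_iff cp_smult cp_diff algebra_simps)
    finally have "Polynomial.smult \<epsilon> (p - q) = 0" by (rule polynomial_small_in_sector)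
    then show "q = p" using \<epsilon>0 by simp
  qed
  have rem: "eventually (\<lambda>z. step_remainder f z = complex_of_real \<kappa> * \<psi> z) at_infinity"
    using ev unfolding step_remainder_def fc sp cp_def .
  have norm_iff: "normalized (\<lambda>z. step_remainder f z / complex_of_real (b\<^sup>2)) \<longleftrightarrow> b\<^sup>2 = \<kappa>" if b: "b > 0" for b
  proof -
    have "rexp (\<lambda>z. complex_of_real (\<kappa> / b\<^sup>2) * \<psi> z) (fps_X ^ m * (fps_const (\<kappa> / b\<^sup>2) * C))"
      using rexp_cmult[OF \<psi>(1), of "\<kappa> / b\<^sup>2"] by (simp add: mult_ac)
    moreover have "eventually (\<lambda>z. step_remainder f z / complex_of_real (b\<^sup>2) = complex_of_real (\<kappa> / b\<^sup>2) * \<psi> z) at_infinity"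
      using rem by eventually_elim simp
    ultimately have "rexp (\<lambda>z. step_remainder f z / complex_of_real (b\<^sup>2)) (fps_X ^ m * (fps_const (\<kappa> / b\<^sup>2) * C))"
      by (rule rexp_cong)
    then have "first_coeff (\<lambda>z. step_remainder f z / complex_of_real (b\<^sup>2)) = \<kappa> / b\<^sup>2 * \<epsilon>'"
      using rexp_first_coeff[OF _ \<psi>(2)] \<psi>(3) \<epsilon>0' \<kappa> b by simp
    then show ?thesis using \<epsilon>' \<kappa> b by (auto simp: normalized_def abs_mult)
  qed
  show sb: "step_b f = sqrt \<kappa>"
    unfolding step_b_def
  proof (rule the_equality)
    show "sqrt \<kappa> > 0 \<and> normalized (\<lambda>z. step_remainder f z / complex_of_real ((sqrt \<kappa>)\<^sup>2))"
      using norm_iff[of "sqrt \<kappa>"] \<kappa> by simp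
  next
    fix b assume "b > 0 \<and> normalized (\<lambda>z. step_remainder f z / complex_of_real (b\<^sup>2))"
    then have "b > 0" "b\<^sup>2 = \<kappa>" using norm_iff by auto
    then show "b = sqrt \<kappa>" by (intro real_sqrt_unique[symmetric]) auto
  qed
  show "eventually (\<lambda>z. step_remainder f z / complex_of_real ((step_b f)\<^sup>2) = \<psi> z) at_infinity"
    using rem unfolding sb by eventually_elim (use \<kappa> in simp)
qed

lemma tendsto_0_mult_bounded:
  fixes f g :: "nat \<Rightarrow> complex"
  assumes "f \<longlonglongrightarrow> 0" "\<And>n. cmod (g n) \<le> K"
  shows "(\<lambda>n. f n * g n) \<longlonglongrightarrow> 0"
proof (rule tendsto_norm_zero_cancel, rule tendsto_sandwich[of "\<lambda>_. 0" _ _ "\<lambda>n. cmod (f n) * K"])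
  show "(\<lambda>n. cmod (f n) * K) \<longlonglongrightarrow> 0"
    using tendsto_mult_left_zero[OF tendsto_norm_zero[OF assms(1)]] .
qed (auto simp: norm_mult intro!: mult_left_mono assms(2) always_eventually)

context interval_measure
begin

text \<open>The moment expansion; its remainders are \<open>w ^ N\<close> times bounded Cauchy transforms, where \<open>w = 1 / z\<close>.\<close>

lemma ct_rexp: "rexp (ct p) (Abs_fps (\<lambda>n. if n = 0 then 0 else - lint (p * monom 1 (n - 1))))"
proof -
  define A where "A = Abs_fps (\<lambda>n. if n = 0 then 0 else - lint (p * monom 1 (n - 1)))"
  obtain B where B: "\<And>t. t \<in> {-1..1} \<Longrightarrow> \<bar>poly p t\<bar> \<le> B" using poly_bounded_interval[of p] by blast
  define g where "g w = (if w = 0 then 0 else ct p (1 / w))" for w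
  have "g has_fps_expansion cfps A"
  proof (rule has_fps_expansionI)
    have "eventually (\<lambda>w::complex. w \<in> ball 0 1) (nhds 0)" by (intro eventually_nhds_in_open) auto
    then show "eventually (\<lambda>w. (\<lambda>n. fps_nth (cfps A) n * w ^ n) sums g w) (nhds 0)"
    proof eventually_elim
      case (elim w)
      show ?case
      proof (cases "w = 0")
        case True
        have "(\<lambda>n. fps_nth (cfps A) n * w ^ n) = (\<lambda>n. 0)" using True by (auto simp: A_def power_0_left)
        then show ?thesis using True by (simp add: g_def)
      next
        case False
        define z where "z = 1 / w"
        have w: "cmod w < 1" using elim by simp
        have cz: "cmod z > 1" using w False by (simp add: z_def norm_divide)
        have z: "z \<in> off" by (rule off_large[OF cz])
        have zn: "z \<noteq> 0" by (rule off_not_0[OF z])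
        define D where "D = cmod z - 1"
        have D: "D > 0" "\<And>t. t \<in> {-1..1} \<Longrightarrow> D \<le> cmod (complex_of_real t - z)"
        proof -
          show "D > 0" using cz by (simp add: D_def)
          fix t :: real assume "t \<in> {-1..1}"
          then have "\<bar>t\<bar> \<le> 1" by auto
          then show "D \<le> cmod (complex_of_real t - z)"
            using norm_triangle_ineq2[of z "complex_of_real t"] by (simp add: D_def norm_minus_commute)
        qed
        have bound: "cmod (ct (p * monom 1 N) z) \<le> lint 1 * (\<bar>B\<bar> / D)" for N
        proof -
          have "cmod (ct (p * monom 1 N) z) \<le> (\<integral>t. cmod (complex_of_real (poly (p * monom 1 N) t) / (complex_of_real t - z)) \<partial>\<sigma>)"
            unfolding ct_def by (rule integral_norm_bound)
          also have "\<dots> \<le> (\<integral>t. \<bar>B\<bar> / D \<partial>\<sigma>)"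
          proof (rule integral_mono_AE)
            show "AE t in \<sigma>. cmod (complex_of_real (poly (p * monom 1 N) t) / (complex_of_real t - z)) \<le> \<bar>B\<bar> / D"
              using AE_interval
            proof eventually_elim
              case (elim t)
              have t: "\<bar>t\<bar> \<le> 1" using elim by auto
              have "\<bar>poly p t\<bar> * \<bar>t\<bar> ^ N \<le> \<bar>B\<bar> * 1"
                using B[OF elim] t by (intro mult_mono power_le_one) auto
              then show ?case using D(1) D(2)[OF elim]
                by (simp add: norm_divide norm_mult norm_power poly_monom abs_mult power_abs del: of_real_mult of_real_power) (intro frac_le, auto)
            qed
          qed (use integrable_ct_0[OF z] in \<open>auto intro!: integrable_norm simp del: poly_mult\<close>)
          finally show ?thesis by (simp add: lint_def mult.commute)
        qed
        have part: "(\<Sum>n<Suc N. fps_nth (cfps A) n * w ^ n) = ct p z - w ^ N * ct (p * monom 1 N) z" for N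
        proof -
          have "(\<Sum>n<Suc N. fps_nth (cfps A) n * w ^ n) = (\<Sum>k<N. - (complex_of_real (lint (p * monom 1 k)) / z ^ Suc k))"
            unfolding sum.lessThan_Suc_shift by (simp add: A_def z_def power_divide del: power_Suc)
          also have "\<dots> = - (\<Sum>k<N. complex_of_real (lint (p * monom 1 k)) / z ^ Suc k)" by (rule sum_negf)
          also have "\<dots> = ct p z - w ^ N * ct (p * monom 1 N) z"
          proof -
            have "w ^ N * z ^ N = 1" using False by (simp add: z_def power_divide)
            then have "w ^ N * ct (p * monom 1 N) z = ct p z + (\<Sum>k<N. complex_of_real (lint (p * monom 1 k)) / z ^ Suc k)"
              unfolding ct_monom[OF z] by (simp flip: mult.assoc)
            then show ?thesis by simp
          qed
          finally show ?thesis .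
        qed
        have "(\<lambda>N. w ^ N * ct (p * monom 1 N) z) \<longlonglongrightarrow> 0"
        proof (rule tendsto_0_mult_bounded)
          show "(\<lambda>N. w ^ N) \<longlonglongrightarrow> 0" using w by (rule LIMSEQ_power_zero)
          show "\<And>N. cmod (ct (p * monom 1 N) z) \<le> lint 1 * (\<bar>B\<bar> / D)" by (rule bound)
        qed
        then have "(\<lambda>N. ct p z - w ^ N * ct (p * monom 1 N) z) \<longlonglongrightarrow> ct p z - 0" by (intro tendsto_intros)
        then have "(\<lambda>N. \<Sum>n<Suc N. fps_nth (cfps A) n * w ^ n) \<longlonglongrightarrow> g w"
          unfolding part using False by (simp add: g_def z_def)
        then show ?thesis unfolding sums_def by (rule LIMSEQ_imp_Suc)
      qed
    qed
  qed
  moreover have "eventually (\<lambda>z. ct p z = g (1 / z)) at_infinity"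
    using eventually_nonzero_at_infinity by eventually_elim (simp add: g_def)
  ultimately show ?thesis unfolding rexp_def A_def by blast
qed

end

section \<open>The continued fraction of the shifted Cauchy transform\<close>

context shifted_moments
begin

lemma rt_rexp: "rexp (rt p) (Abs_fps (\<lambda>n. if n = 0 then 0 else - sf (p * monom 1 (n - 1))))"
proof -
  let ?A = "Abs_fps (\<lambda>n. if n = 0 then 0 else - lint (p * monom 1 (n - 1)))"
  have "rexp (\<lambda>z. 1 / z ^ 1 * (ct p z + complex_of_real (- sf p))) (fps_X ^ 1 * (?A + fps_const (- sf p)))"
    by (intro rexp_mult rexp_inverse_power rexp_add ct_rexp rexp_const)
  also have "(\<lambda>z. 1 / z ^ 1 * (ct p z + complex_of_real (- sf p))) = rt p"
    by (simp add: rt_def fun_eq_iff)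
  also have "fps_X ^ 1 * (?A + fps_const (- sf p)) = Abs_fps (\<lambda>n. if n = 0 then 0 else - sf (p * monom 1 (n - 1)))"
  proof (rule fps_ext)
    fix n
    consider "n = 0" | "n = 1" | m where "n = Suc (Suc m)" by (cases n; cases "n - 1") auto
    then show "fps_nth (fps_X ^ 1 * (?A + fps_const (- sf p))) n =
        fps_nth (Abs_fps (\<lambda>n. if n = 0 then 0 else - sf (p * monom 1 (n - 1)))) n"
      by cases (simp_all add: sf_monom_Suc monom_0)
  qed
  finally show ?thesis .
qed

lemma fps_shift_X_power_mult: "fps_shift n (fps_X ^ n * B) = (B :: real fps)"
  by (rule fps_ext) (simp add: fps_X_power_mult_nth)

text \<open>By orthogonality the expansion starts at order \<open>\<nu> (j + 1)\<close>.\<close>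

lemma rt_G_rexp:
  obtains B where "rexp (rt (G j)) (fps_X ^ \<nu> (Suc j) * B)" "fps_nth B 0 = - \<eta> j"
proof
  let ?N = "\<nu> (Suc j)"
  let ?A = "Abs_fps (\<lambda>n. if n = 0 then 0 else - sf (G j * monom 1 (n - 1)))"
  have pos: "?N > 0" by (rule \<nu>_pos) simp
  have "fps_X ^ ?N * fps_shift ?N ?A = ?A"
  proof (rule fps_ext)
    fix n show "fps_nth (fps_X ^ ?N * fps_shift ?N ?A) n = fps_nth ?A n"
      using sf_G_less[of "n - 1" j] by (auto simp: fps_X_power_mult_nth)
  qed
  then show "rexp (rt (G j)) (fps_X ^ ?N * fps_shift ?N ?A)" using rt_rexp[of "G j"] by simp
  show "fps_nth (fps_shift ?N ?A) 0 = - \<eta> j" using pos sf_G_eq[of j] by simp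
qed

lemma rt_G_shift_rexp:
  obtains B where "rexp (\<lambda>z. z ^ \<nu> (Suc j) * rt (G j) z) B" "fps_nth B 0 = - \<eta> j"
proof -
  obtain B where B: "rexp (rt (G j)) (fps_X ^ \<nu> (Suc j) * B)" "fps_nth B 0 = - \<eta> j" by (rule rt_G_rexp)
  have "rexp (\<lambda>z. z ^ \<nu> (Suc j) * rt (G j) z) (fps_shift (\<nu> (Suc j)) (fps_X ^ \<nu> (Suc j) * B))"
    by (rule rexp_shift[OF B(1)]) (simp add: fps_X_power_mult_nth)
  then show ?thesis using B(2) that unfolding fps_shift_X_power_mult by blast
qed

lemma rt_G_eventually_nz: "eventually (\<lambda>z. rt (G j) z \<noteq> 0) at_infinity"
proof -
  obtain B where B: "rexp (\<lambda>z. z ^ \<nu> (Suc j) * rt (G j) z) B" "fps_nth B 0 = - \<eta> j" by (rule rt_G_shift_rexp)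
  have "eventually (\<lambda>z. z ^ \<nu> (Suc j) * rt (G j) z \<noteq> 0) at_infinity"
    by (rule tendsto_imp_eventually_ne[OF rexp_tendsto[OF B(1)]]) (use B(2) \<eta>_nz in auto)
  then show ?thesis by eventually_elim auto
qed

text \<open>The functions of the continued fraction, near infinity.\<close>

primrec gfun :: "nat \<Rightarrow> complex \<Rightarrow> complex" where
  "gfun 0 = (\<lambda>z. complex_of_real (1 / \<bar>\<eta> 0\<bar>) * rt (G 0) z)"
| "gfun (Suc j) = (\<lambda>z. complex_of_real (- sgn (\<eta> (Suc j)) / cc j) * (rt (G (Suc j)) z / rt (G j) z))"

lemma gfun_rexp:
  obtains B where "rexp (gfun j) (fps_X ^ (\<nu> (Suc j) - \<nu> j) * B)" "fps_nth B 0 = - sgn (\<eta> j)"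
proof (cases j)
  case 0
  obtain B where B: "rexp (rt (G 0)) (fps_X ^ \<nu> (Suc 0) * B)" "fps_nth B 0 = - \<eta> 0" by (rule rt_G_rexp)
  have "rexp (gfun 0) (fps_X ^ (\<nu> (Suc 0) - \<nu> 0) * (fps_const (1 / \<bar>\<eta> 0\<bar>) * B))"
    using rexp_cmult[OF B(1), of "1 / \<bar>\<eta> 0\<bar>"] by (simp add: mult_ac)
  moreover have "fps_nth (fps_const (1 / \<bar>\<eta> 0\<bar>) * B) 0 = - sgn (\<eta> 0)"
    using B(2) by (simp add: sgn_real_def)
  ultimately show ?thesis using 0 that by blast
next
  case (Suc m)
  define k where "k = \<nu> (Suc j) - \<nu> j"
  have N: "\<nu> (Suc j) = k + \<nu> j" using \<nu>_less[of j] by (simp add: k_def)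
  obtain B where B: "rexp (\<lambda>z. z ^ \<nu> (Suc j) * rt (G j) z) B" "fps_nth B 0 = - \<eta> j" by (rule rt_G_shift_rexp)
  obtain B' where B': "rexp (\<lambda>z. z ^ \<nu> j * rt (G m) z) B'" "fps_nth B' 0 = - \<eta> m"
    using rt_G_shift_rexp[of m] Suc by metis
  let ?a = "- sgn (\<eta> j) / cc m"
  have "rexp (\<lambda>z. complex_of_real ?a * (1 / z ^ k * ((z ^ \<nu> (Suc j) * rt (G j) z) * inverse (z ^ \<nu> j * rt (G m) z))))
    (fps_const ?a * (fps_X ^ k * (B * inverse B')))"
    by (intro rexp_cmult rexp_mult rexp_inverse_power B rexp_inverse B') (use B'(2) \<eta>_nz in auto)
  moreover have "eventually (\<lambda>z. gfun j z = complex_of_real ?a * (1 / z ^ k * ((z ^ \<nu> (Suc j) * rt (G j) z) * inverse (z ^ \<nu> j * rt (G m) z)))) at_infinity"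
    using eventually_nonzero_at_infinity
    by eventually_elim (simp add: Suc N[unfolded Suc] power_add divide_simps)
  ultimately have "rexp (gfun j) (fps_const ?a * (fps_X ^ k * (B * inverse B')))" by (rule rexp_cong)
  then have "rexp (gfun j) (fps_X ^ k * (fps_const ?a * (B * inverse B')))" by (simp add: mult_ac)
  moreover have "fps_nth (fps_const ?a * (B * inverse B')) 0 = - sgn (\<eta> j)"
    using B(2) B'(2) \<eta>_nz[of j] \<eta>_nz[of m] Suc by (simp add: cc_def field_simps)
  ultimately show ?thesis using that k_def by blast
qed

lemma cc_sgn: "\<bar>cc j\<bar> * sgn (\<eta> (Suc j)) / cc j = sgn (\<eta> j)"
  using \<eta>_nz[of j] \<eta>_nz[of "Suc j"] by (auto simp: cc_def sgn_real_def abs_divide divide_simps)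

lemma cc_eq_sgn: "cc j = sgn (\<eta> j) * sgn (\<eta> (Suc j)) * \<bar>cc j\<bar>"
  using \<eta>_nz[of j] \<eta>_nz[of "Suc j"] by (auto simp: cc_def sgn_real_def abs_divide)

lemma eventually_off: "eventually (\<lambda>z. z \<in> off) at_infinity"
  by (rule eventually_at_infinityI[of 2]) (auto intro: off_large)

lemma gfun_step:
  "eventually (\<lambda>z. - 1 / gfun j z = complex_of_real (sgn (\<eta> j)) * cp (pp j) z
      + complex_of_real \<bar>cc j\<bar> * gfun (Suc j) z) at_infinity"
  using eventually_off rt_G_eventually_nz[of j]
proof eventually_elim
  case (elim z)
  let ?s = "complex_of_real (sgn (\<eta> j))"
  have "complex_of_real \<bar>cc j\<bar> * gfun (Suc j) z = - ?s * (rt (G (Suc j)) z / rt (G j) z)"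
  proof -
    have "\<bar>cc j\<bar> * (- sgn (\<eta> (Suc j)) / cc j) = - sgn (\<eta> j)" using cc_sgn[of j] by simp
    then show ?thesis by (simp only: gfun.simps mult.assoc[symmetric] of_real_mult[symmetric]) simp
  qed
  moreover have "- 1 / gfun j z = ?s * (cp (pp j) z - rt (G (Suc j)) z / rt (G j) z)"
  proof (cases j)
    case 0
    have "\<bar>\<eta> 0\<bar> = sgn (\<eta> 0) * \<eta> 0" by (rule trans[OF abs_sgn mult.commute])
    then have a: "complex_of_real \<bar>\<eta> 0\<bar> = complex_of_real (sgn (\<eta> 0)) * complex_of_real (\<eta> 0)"
      by (simp only: of_real_mult)
    have "- 1 / gfun j z = - complex_of_real \<bar>\<eta> 0\<bar> / rt (G 0) z" using 0 by simp
    also have "\<dots> = ?s * (- complex_of_real (\<eta> 0) / rt (G 0) z)" unfolding a 0 by simp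
    also have "- complex_of_real (\<eta> 0) = cp (pp 0) z * rt (G 0) z - rt (G (Suc 0)) z"
      using rt_G_Suc_0[OF elim(1)] by simp
    finally show ?thesis using elim(2) 0 by (simp add: diff_divide_distrib)
  next
    case (Suc m)
    have "- 1 / gfun j z = ?s * (complex_of_real (cc m) * rt (G m) z / rt (G j) z)"
    proof -
      have "- 1 / gfun j z = complex_of_real (cc m) * rt (G m) z / rt (G j) z / ?s" using Suc by simp
      also have "\<dots> = ?s * (complex_of_real (cc m) * rt (G m) z / rt (G j) z)"
        using \<eta>_nz[of j] by (simp add: sgn_real_def)
      finally show ?thesis .
    qed
    also have "complex_of_real (cc m) * rt (G m) z = cp (pp j) z * rt (G j) z - rt (G (Suc j)) z"
      using rt_G_Suc_Suc[OF elim(1), of m] Suc by simp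
    finally show ?thesis using elim(2) by (simp add: diff_divide_distrib)
  qed
  ultimately show ?case by (simp add: algebra_simps)
qed

lemma gj_identification:
  assumes f: "eventually (\<lambda>z. f z = rt 1 z) at_infinity"
  shows "asymp_coeffs f = \<ss>" "gj_p f = pp" "gj_c f = cc"
proof -
  have "rexp f (Abs_fps (\<lambda>n. if n = 0 then 0 else - sf (1 * monom 1 (n - 1))))"
    by (rule rexp_cong[OF rt_rexp f])
  then have "asymp_coeffs f = (\<lambda>j. - fps_nth (Abs_fps (\<lambda>n. if n = 0 then 0 else - sf (1 * monom 1 (n - 1)))) (Suc j))"
    by (rule rexp_asymp_coeffs) simp
  then show "asymp_coeffs f = \<ss>" by (simp add: \<ss>_eq fun_eq_iff)
  have k: "\<nu> (Suc j) - \<nu> j \<ge> 1" for j using \<nu>_less[of j] by simp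
  have "first_coeff f = \<eta> 0"
  proof -
    obtain B where B: "rexp (rt (G 0)) (fps_X ^ \<nu> (Suc 0) * B)" "fps_nth B 0 = - \<eta> 0" by (rule rt_G_rexp)
    have "rexp f (fps_X ^ \<nu> (Suc 0) * B)" using rexp_cong[OF B(1)] f by (simp add: G_0)
    then show ?thesis using rexp_first_coeff[of f "\<nu> (Suc 0)" B] B(2) \<eta>_nz[of 0] k[of 0] by simp
  qed
  have main: "first_coeff h = sgn (\<eta> j) \<and> step_poly h = pp j \<and> step_b h = sqrt \<bar>cc j\<bar> \<and>
      eventually (\<lambda>z. step_remainder h z / complex_of_real ((step_b h)\<^sup>2) = gfun (Suc j) z) at_infinity"
    if h: "eventually (\<lambda>z. h z = gfun j z) at_infinity" for h j
  proof -
    obtain B where B: "rexp (gfun j) (fps_X ^ (\<nu> (Suc j) - \<nu> j) * B)" "fps_nth B 0 = - sgn (\<eta> j)" by (rule gfun_rexp)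
    obtain C where C: "rexp (gfun (Suc j)) (fps_X ^ (\<nu> (Suc (Suc j)) - \<nu> (Suc j)) * C)" "fps_nth C 0 = - sgn (\<eta> (Suc j))" by (rule gfun_rexp)
    have s: "\<bar>sgn (\<eta> i)\<bar> = 1" for i using \<eta>_nz[of i] by (simp add: abs_sgn_eq)
    have c: "\<bar>cc j\<bar> > 0" using cc_nz[of j] by simp
    note * = expansion_step[OF h gfun_step pp_lead s s c B(1) k B(2) C(1) k C(2)]
    show ?thesis using * by blast
  qed
  have ev: "eventually (\<lambda>z. gj_fun f j z = gfun j z) at_infinity" for j
  proof (induction j)
    case 0
    show ?case using f by eventually_elim (simp add: \<open>first_coeff f = \<eta> 0\<close> G_0)
  next
    case (Suc j)
    show ?case
      using main[OF Suc, THEN conjunct2, THEN conjunct2, THEN conjunct2] unfolding gj_fun.simps .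
  qed
  show "gj_p f = pp" using main[OF ev] by (simp add: gj_p_def fun_eq_iff)
  show "gj_c f = cc"
  proof
    fix j
    show "gj_c f j = cc j"
      using main[OF ev[of j]] main[OF ev[of "Suc j"]] cc_eq_sgn[of j] by (simp add: gj_c_def)
  qed
qed

end

section \<open>Rational maps of the sphere\<close>

text \<open>The point of the sphere with homogeneous coordinates \<open>(a, b)\<close>.\<close>

definition ratio :: "complex \<Rightarrow> complex \<Rightarrow> csphere" where
  "ratio a b = (if b = 0 then Infty else Fin (a / b))"

lemma to_sphere_ratio:
  assumes "a \<noteq> 0 \<or> b \<noteq> 0"
  shows "to_sphere (ratio a b) =
    (2 * a * cnj b / complex_of_real ((cmod a)\<^sup>2 + (cmod b)\<^sup>2),
     ((cmod a)\<^sup>2 - (cmod b)\<^sup>2) / ((cmod a)\<^sup>2 + (cmod b)\<^sup>2))"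
proof (cases "b = 0")
  case False
  have b: "(cmod b)\<^sup>2 > 0" using False by simp
  then have nz: "(cmod a)\<^sup>2 + (cmod b)\<^sup>2 > 0" by (simp add: add_nonneg_pos)
  have e: "complex_of_real ((cmod b)\<^sup>2) = b * cnj b" by (rule complex_norm_square)
  have "1 + (cmod (a / b))\<^sup>2 = ((cmod a)\<^sup>2 + (cmod b)\<^sup>2) / (cmod b)\<^sup>2"
    using b by (simp add: norm_divide power_divide field_simps)
  then have "2 * (a / b) / complex_of_real (1 + (cmod (a / b))\<^sup>2)
      = 2 * (a / b) * complex_of_real ((cmod b)\<^sup>2) / complex_of_real ((cmod a)\<^sup>2 + (cmod b)\<^sup>2)"
    by (simp only: of_real_divide) simp
  also have "2 * (a / b) * complex_of_real ((cmod b)\<^sup>2) = 2 * a * cnj b"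
    unfolding e using False by simp
  finally have 1: "2 * (a / b) / complex_of_real (1 + (cmod (a / b))\<^sup>2)
      = 2 * a * cnj b / complex_of_real ((cmod a)\<^sup>2 + (cmod b)\<^sup>2)" .
  have 2: "((cmod (a / b))\<^sup>2 - 1) / ((cmod (a / b))\<^sup>2 + 1) = ((cmod a)\<^sup>2 - (cmod b)\<^sup>2) / ((cmod a)\<^sup>2 + (cmod b)\<^sup>2)"
  proof -
    have "(cmod (a / b))\<^sup>2 - 1 = ((cmod a)\<^sup>2 - (cmod b)\<^sup>2) / (cmod b)\<^sup>2"
      and "(cmod (a / b))\<^sup>2 + 1 = ((cmod a)\<^sup>2 + (cmod b)\<^sup>2) / (cmod b)\<^sup>2"
      using b by (simp_all add: norm_divide power_divide field_simps)
    then show ?thesis using b by simp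
  qed
  show ?thesis using False 1 2 by (simp add: ratio_def)
qed (use assms in \<open>auto simp: ratio_def\<close>)

lemma tendsto_csphere_iff:
  "(f \<longlongrightarrow> (l :: csphere)) F \<longleftrightarrow> ((\<lambda>x. to_sphere (f x)) \<longlongrightarrow> to_sphere l) F"
  by (subst (1 2) tendsto_dist_iff) (simp add: dist_csphere_def)

lemma tendsto_ratio:
  assumes a: "(a \<longlongrightarrow> \<alpha>) F" and b: "(b \<longlongrightarrow> \<beta>) F" and nz: "\<alpha> \<noteq> 0 \<or> \<beta> \<noteq> 0"
  shows "((\<lambda>x. ratio (a x) (b x)) \<longlongrightarrow> ratio \<alpha> \<beta>) F"
proof -
  let ?n = "\<lambda>x. (cmod (a x))\<^sup>2 + (cmod (b x))\<^sup>2"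
  have n: "(?n \<longlongrightarrow> (cmod \<alpha>)\<^sup>2 + (cmod \<beta>)\<^sup>2) F" by (intro tendsto_intros a b)
  have n0: "(cmod \<alpha>)\<^sup>2 + (cmod \<beta>)\<^sup>2 \<noteq> 0" using nz by (simp add: sum_power2_eq_zero_iff)
  have n0': "complex_of_real ((cmod \<alpha>)\<^sup>2 + (cmod \<beta>)\<^sup>2) \<noteq> 0" using n0 by (metis of_real_eq_0_iff)
  have ev: "eventually (\<lambda>x. a x \<noteq> 0 \<or> b x \<noteq> 0) F"
    using tendsto_imp_eventually_ne[OF n n0] by eventually_elim auto
  have "((\<lambda>x. (2 * a x * cnj (b x) / complex_of_real (?n x), ((cmod (a x))\<^sup>2 - (cmod (b x))\<^sup>2) / ?n x))
     \<longlongrightarrow> (2 * \<alpha> * cnj \<beta> / complex_of_real ((cmod \<alpha>)\<^sup>2 + (cmod \<beta>)\<^sup>2),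
        ((cmod \<alpha>)\<^sup>2 - (cmod \<beta>)\<^sup>2) / ((cmod \<alpha>)\<^sup>2 + (cmod \<beta>)\<^sup>2))) F"
    by (intro tendsto_Pair tendsto_divide tendsto_intros a b n0 n0')
  then have "((\<lambda>x. to_sphere (ratio (a x) (b x))) \<longlongrightarrow> to_sphere (ratio \<alpha> \<beta>)) F"
    unfolding to_sphere_ratio[OF nz]
    by (rule Lim_transform_eventually) (use ev in eventually_elim, simp add: to_sphere_ratio)
  then show ?thesis by (simp add: tendsto_csphere_iff)
qed

lemma tendsto_Fin: "(f \<longlongrightarrow> l) F \<Longrightarrow> ((\<lambda>x. Fin (f x)) \<longlongrightarrow> Fin l) F"
  using tendsto_ratio[of f l F "\<lambda>_. 1" 1] by (simp add: ratio_def)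

lemma tendsto_Fin_Infty: "(Fin \<longlongrightarrow> Infty) at_infinity"
proof -
  have "((\<lambda>z. ratio 1 (1 / z)) \<longlongrightarrow> ratio 1 0) at_infinity"
    by (intro tendsto_ratio tendsto_const one_divide_tendsto_0_at_infinity) simp
  then have "((\<lambda>z. ratio 1 (1 / z)) \<longlongrightarrow> Infty) at_infinity" by (simp add: ratio_def)
  then show ?thesis
    by (rule Lim_transform_eventually) (use eventually_nonzero_at_infinity in eventually_elim, simp add: ratio_def)
qed

text \<open>The coordinate \<open>z\<close> at finite points, and the coordinate \<open>1 / z\<close> away from \<open>0\<close>.\<close>

definition zcoord :: "csphere \<Rightarrow> complex" where
  "zcoord p = fst (to_sphere p) / complex_of_real (1 - snd (to_sphere p))"

definition wcoord :: "csphere \<Rightarrow> complex" where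
  "wcoord p = cnj (fst (to_sphere p)) / complex_of_real (1 + snd (to_sphere p))"

lemma snd_Fin: "snd (to_sphere (Fin z)) = 1 - 2 / (1 + (cmod z)\<^sup>2)"
proof -
  have "1 + (cmod z)\<^sup>2 > 0" by (simp add: add_pos_nonneg)
  then show ?thesis by (simp add: field_simps)
qed

lemma zcoord_Fin: "zcoord (Fin z) = z"
proof -
  have "1 + (cmod z)\<^sup>2 \<noteq> 0" using zero_le_power2[of "cmod z"] by linarith
  then have "complex_of_real (1 + (cmod z)\<^sup>2) \<noteq> 0" by (metis of_real_eq_0_iff)
  then show ?thesis unfolding zcoord_def snd_Fin by simp
qed

lemma wcoord_Infty: "wcoord Infty = 0" by (simp add: wcoord_def)

lemma wcoord_Fin: assumes "z \<noteq> 0" shows "wcoord (Fin z) = 1 / z"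
proof -
  have p: "1 + (cmod z)\<^sup>2 \<noteq> 0" using zero_le_power2[of "cmod z"] by linarith
  then have "1 + snd (to_sphere (Fin z)) = 2 * (cmod z)\<^sup>2 / (1 + (cmod z)\<^sup>2)"
    by (simp only: snd_Fin) (simp add: field_simps)
  then have "wcoord (Fin z) = (2 * cnj z / complex_of_real (1 + (cmod z)\<^sup>2)) / complex_of_real (2 * (cmod z)\<^sup>2 / (1 + (cmod z)\<^sup>2))"
    unfolding wcoord_def by simp
  also have "\<dots> = cnj z / complex_of_real ((cmod z)\<^sup>2)"
  proof -
    have "complex_of_real (1 + (cmod z)\<^sup>2) \<noteq> 0" using p by (metis of_real_eq_0_iff)
    then show ?thesis by (simp only: of_real_divide of_real_mult) simp
  qed
  also have "\<dots> = 1 / z" unfolding complex_norm_square using assms by simp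
  finally show ?thesis .
qed

lemma tendsto_to_sphere: "(to_sphere \<longlongrightarrow> to_sphere p) (nhds p)"
  using tendsto_csphere_iff[of "\<lambda>x. x" p "nhds p"] by (simp add: filterlim_ident)

lemma tendsto_zcoord: "(zcoord \<longlongrightarrow> z) (nhds (Fin z))"
proof -
  have "1 - snd (to_sphere (Fin z)) \<noteq> 0"
    unfolding snd_Fin by (simp add: add_nonneg_eq_0_iff)
  then have "complex_of_real (1 - snd (to_sphere (Fin z))) \<noteq> 0" by (metis of_real_eq_0_iff)
  then have "(zcoord \<longlongrightarrow> zcoord (Fin z)) (nhds (Fin z))"
    unfolding zcoord_def[abs_def] by (intro tendsto_intros tendsto_to_sphere)
  then show ?thesis by (simp add: zcoord_Fin)
qed

lemma tendsto_wcoord: "(wcoord \<longlongrightarrow> 0) (nhds Infty)"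
proof -
  have "(wcoord \<longlongrightarrow> wcoord Infty) (nhds Infty)"
    unfolding wcoord_def[abs_def] by (intro tendsto_intros tendsto_to_sphere) simp
  then show ?thesis by (simp add: wcoord_Infty)
qed

lemma eventually_not_eq: "p \<noteq> q \<Longrightarrow> eventually (\<lambda>x. x \<noteq> q) (nhds (p :: csphere))"
  by (rule t1_space_nhds)

lemma continuous_csphereI:
  assumes "\<And>z. (R \<longlongrightarrow> R (Fin z)) (nhds (Fin z))" "(R \<longlongrightarrow> R Infty) (nhds Infty)"
  shows "continuous_on UNIV (R :: csphere \<Rightarrow> csphere)"
proof -
  have "isCont R p" for p
    using assms by (cases p) (simp_all add: isCont_def tendsto_at_iff_tendsto_nhds)
  then show ?thesis by (simp add: continuous_at_imp_continuous_on)
qed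

text \<open>Continuity of the map \<open>a / b\<close> of the sphere for functions \<open>a\<close>, \<open>b\<close> without common zeros, where \<open>A\<close> and \<open>B\<close>
  express it in the coordinate \<open>1 / z\<close>.\<close>

lemma continuous_rational:
  fixes a b A B :: "complex \<Rightarrow> complex"
  assumes cont: "continuous_on UNIV a" "continuous_on UNIV b" "isCont A 0" "isCont B 0"
    and nz: "\<And>z. a z \<noteq> 0 \<or> b z \<noteq> 0" and B0: "B 0 \<noteq> 0"
    and eq: "\<And>z. z \<noteq> 0 \<Longrightarrow> ratio (a z) (b z) = ratio (A (1 / z)) (B (1 / z))"
  shows "continuous_on UNIV (\<lambda>p. case p of Fin z \<Rightarrow> ratio (a z) (b z) | Infty \<Rightarrow> ratio (A 0) (B 0))"
    (is "continuous_on UNIV ?R")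
proof (rule continuous_csphereI)
  fix z
  have c: "(a \<longlongrightarrow> a z) (nhds z)" "(b \<longlongrightarrow> b z) (nhds z)"
    using cont(1,2) by (simp_all add: continuous_on_eq_continuous_at isCont_def tendsto_nhds_iff)
  have "((\<lambda>p. ratio (a (zcoord p)) (b (zcoord p))) \<longlongrightarrow> ratio (a z) (b z)) (nhds (Fin z))"
    by (intro tendsto_ratio nz filterlim_compose[OF c(1) tendsto_zcoord] filterlim_compose[OF c(2) tendsto_zcoord])
  then have "(?R \<longlongrightarrow> ratio (a z) (b z)) (nhds (Fin z))"
  proof (rule Lim_transform_eventually)
    show "eventually (\<lambda>p. ratio (a (zcoord p)) (b (zcoord p)) = ?R p) (nhds (Fin z))"
      using eventually_not_eq[OF csphere.distinct(1)[of z]]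
    proof eventually_elim
      case (elim p)
      then show ?case by (cases p) (auto simp: zcoord_Fin)
    qed
  qed
  then show "(?R \<longlongrightarrow> ?R (Fin z)) (nhds (Fin z))" by simp
next
  have c: "(A \<longlongrightarrow> A 0) (nhds 0)" "(B \<longlongrightarrow> B 0) (nhds 0)"
    using cont(3,4) by (simp_all add: isCont_def tendsto_nhds_iff)
  have "((\<lambda>p. ratio (A (wcoord p)) (B (wcoord p))) \<longlongrightarrow> ratio (A 0) (B 0)) (nhds Infty)"
    using B0
    by (intro tendsto_ratio filterlim_compose[OF c(1) tendsto_wcoord] filterlim_compose[OF c(2) tendsto_wcoord]) simp
  then have "(?R \<longlongrightarrow> ratio (A 0) (B 0)) (nhds Infty)"
  proof (rule Lim_transform_eventually)
    show "eventually (\<lambda>p. ratio (A (wcoord p)) (B (wcoord p)) = ?R p) (nhds Infty)"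
      using eventually_not_eq[OF csphere.distinct(2)[of 0]]
    proof eventually_elim
      case (elim p)
      then show ?case
        by (cases p) (auto simp: wcoord_Fin wcoord_Infty eq)
    qed
  qed
  then show "(?R \<longlongrightarrow> ?R Infty) (nhds Infty)" by simp
qed

lemma continuous_on_csphere_unique:
  fixes R R' :: "csphere \<Rightarrow> csphere"
  assumes c: "continuous_on UNIV R" "continuous_on UNIV R'"
    and fin: "finite {z. R (Fin z) \<noteq> R' (Fin z)}"
  shows "R = R'"
proof -
  let ?S = "{z. R (Fin z) = R' (Fin z)}"
  have cF: "continuous_on UNIV (\<lambda>z. Fin z)"
    by (simp add: continuous_on_eq_continuous_at isCont_def tendsto_Fin)
  have "closed ?S"
    by (intro closed_Collect_eq continuous_on_compose2[OF c(1) cF] continuous_on_compose2[OF c(2) cF]) auto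
  moreover have "closure ?S = UNIV"
  proof -
    have "?S = - {z. R (Fin z) \<noteq> R' (Fin z)}" by auto
    then show ?thesis using fin by (simp add: closure_complement empty_interior_finite)
  qed
  ultimately have F: "R (Fin z) = R' (Fin z)" for z
    using closure_closed by blast
  have lim: "((\<lambda>z. Q (Fin z)) \<longlongrightarrow> Q Infty) at_infinity" if "continuous_on UNIV Q" for Q :: "csphere \<Rightarrow> csphere"
  proof -
    have "(Q \<longlongrightarrow> Q Infty) (nhds Infty)"
      using that by (simp add: continuous_on_eq_continuous_at isCont_def tendsto_nhds_iff)
    then show ?thesis using tendsto_Fin_Infty by (rule filterlim_compose)
  qed
  have "R Infty = R' Infty"
    using lim[OF c(1)] lim[OF c(2)] unfolding F
    by (intro tendsto_unique[OF trivial_limit_at_infinity])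
  then show ?thesis using F by (intro ext) (metis csphere.exhaust)
qed

lemma dist_Fin_le: "dist (Fin a) (Fin b) \<le> 2 * cmod (a - b)"
proof -
  define p q where "p = 1 + (cmod a)\<^sup>2" and "q = 1 + (cmod b)\<^sup>2"
  have p: "p \<ge> 1" and q: "q \<ge> 1" by (simp_all add: p_def q_def)
  have A: "(cmod a)\<^sup>2 = p - 1" and B: "(cmod b)\<^sup>2 = q - 1" by (simp_all add: p_def q_def)
  define r where "r = Re (a * cnj b)"
  have sq: "(cmod (complex_of_real x * a - complex_of_real y * b))\<^sup>2 = x\<^sup>2 * (p - 1) + y\<^sup>2 * (q - 1) - 2 * x * y * r" for x y
    unfolding A[symmetric] B[symmetric] r_def cmod_power2 by (simp add: power2_eq_square algebra_simps)
  have d1: "(cmod (2 * a / complex_of_real p - 2 * b / complex_of_real q))\<^sup>2 =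
    (2 / p)\<^sup>2 * (p - 1) + (2 / q)\<^sup>2 * (q - 1) - 2 * (2 / p) * (2 / q) * r"
    using sq[of "2 / p" "2 / q"] by simp
  have "(dist (Fin a) (Fin b))\<^sup>2 = (cmod (2 * a / complex_of_real p - 2 * b / complex_of_real q))\<^sup>2
      + ((p - 2) / p - (q - 2) / q)\<^sup>2"
    by (simp add: dist_csphere_def dist_prod_def dist_norm A B p_def[symmetric] q_def[symmetric] add.commute[of _ 1] sum_power2_ge_zero)
  also have "\<dots> = 4 * (p + q - 2 - 2 * r) / (p * q)"
    unfolding d1 using p q by (simp add: field_simps power2_eq_square)
  also have "p + q - 2 - 2 * r = (cmod (a - b))\<^sup>2"
    using sq[of 1 1] by simp
  also have "4 * (cmod (a - b))\<^sup>2 / (p * q) \<le> 4 * (cmod (a - b))\<^sup>2 / 1"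
    using p q by (intro divide_left_mono) (auto simp: mult_ge1_I)
  finally have "(dist (Fin a) (Fin b))\<^sup>2 \<le> (2 * cmod (a - b))\<^sup>2" by (simp add: power_mult_distrib)
  then show ?thesis by (rule power2_le_imp_le) simp
qed

lemma dist_Infty_Fin_ge: assumes "cmod b \<le> 1" shows "dist Infty (Fin b) \<ge> 1"
proof -
  have "(cmod b)\<^sup>2 \<le> 1" using assms by (simp add: power_le_one)
  then have "snd (to_sphere (Fin b)) \<le> 0"
    by (simp add: divide_nonpos_pos add_nonneg_pos)
  then have "1 \<le> dist (snd (to_sphere Infty)) (snd (to_sphere (Fin b)))"
    by (simp add: dist_real_def)
  also have "\<dots> \<le> dist (to_sphere Infty) (to_sphere (Fin b))" by (rule dist_snd_le)
  finally show ?thesis by (simp add: dist_csphere_def)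
qed

section \<open>Uniqueness of Pade approximants\<close>

lemma poly_tendsto_0_at_infinity:
  fixes p :: "complex poly"
  assumes "(poly p \<longlongrightarrow> 0) at_infinity" shows "p = 0"
proof (cases "degree p = 0")
  case True
  then obtain c where c: "p = [:c:]" by (rule degree_eq_zeroE)
  then have "poly p = (\<lambda>_. c)" by (simp add: fun_eq_iff)
  then have "((\<lambda>_. c) \<longlongrightarrow> 0) (at_infinity :: complex filter)" using assms by simp
  then show ?thesis using c tendsto_unique[OF trivial_limit_at_infinity tendsto_const] by fastforce
next
  case False
  then have "filterlim (poly p) at_infinity at_infinity" by (intro filterlim_poly_at_infinity) simp
  then show ?thesis using assms not_tendsto_and_filterlim_at_infinity[OF trivial_limit_at_infinity] by blast
qed

lemma poly_reflect_inverse: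
  fixes p :: "complex poly"
  assumes "z \<noteq> 0" shows "poly (reflect_poly p) (1 / z) = poly p z / z ^ degree p"
  using assms poly_reflect_poly_nz[of "1 / z" p] by (simp add: power_divide)

text \<open>A polynomial of degree at most \<open>N\<close> with a zero of order \<open>N + 1\<close> at \<open>0\<close> vanishes.\<close>

lemma poly_inverse_bigo_eq_0:
  fixes D :: "complex poly"
  assumes d: "degree D \<le> N" and O: "(\<lambda>z. poly D (1 / z)) \<in> O[at_infinity](\<lambda>z. 1 / z ^ Suc N)"
  shows "D = 0"
proof -
  \<comment> \<open>\<open>z ^ N * D (1 / z)\<close> is a polynomial that tends to \<open>0\<close> at infinity\<close>
  define E where "E = monom 1 (N - degree D) * reflect_poly D"
  have E: "poly E z = z ^ N * poly D (1 / z)" if z: "z \<noteq> 0" for z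
  proof -
    have "z ^ N = z ^ (N - degree D) * z ^ degree D" using d by (simp flip: power_add)
    moreover have "poly (reflect_poly D) z = z ^ degree D * poly D (1 / z)"
      using poly_reflect_poly_nz[OF z, of D] by (simp add: inverse_eq_divide)
    ultimately show ?thesis by (simp add: E_def poly_monom)
  qed
  have "(\<lambda>z. z ^ N * poly D (1 / z)) \<in> O[at_infinity](\<lambda>z. z ^ N * (1 / z ^ Suc N))"
    by (rule landau_o.big.mult[OF landau_o.big_refl O])
  then obtain c where c: "eventually (\<lambda>z. norm (z ^ N * poly D (1 / z)) \<le> c * norm (z ^ N * (1 / z ^ Suc N))) at_infinity"
    by (rule landau_o.bigE)
  have ev: "eventually (\<lambda>z. norm (poly E z) \<le> c * norm (1 / z)) at_infinity"
    using c eventually_nonzero_at_infinity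
  proof eventually_elim
    case (elim z)
    then show ?case by (simp add: E norm_mult norm_divide norm_power field_simps)
  qed
  have "((\<lambda>z::complex. c * norm (1 / z)) \<longlongrightarrow> c * norm (0::complex)) at_infinity"
    by (intro tendsto_intros one_divide_tendsto_0_at_infinity)
  then have "((\<lambda>z::complex. c * norm (1 / z)) \<longlongrightarrow> 0) at_infinity" by simp
  then have "(poly E \<longlongrightarrow> 0) at_infinity" using ev by (rule Lim_null_comparison[rotated])
  then have "E = 0" by (rule poly_tendsto_0_at_infinity)
  then show ?thesis by (simp add: E_def)
qed

lemma pade_unique:
  assumes R: "is_pade_approximant s n n R" and R': "is_pade_approximant s n n R'"
  shows "R = R'"
proof -
  let ?S = "\<lambda>z. \<Sum>j<n + n. complex_of_real (s j) / z ^ (j + 1)"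
  let ?o = "O[at_infinity](\<lambda>z::complex. 1 / z ^ (n + n + 1))"
  from R obtain A B where c: "continuous_on UNIV R" and A: "degree A \<le> n" and B: "degree B \<le> n" "poly B 0 \<noteq> 0"
    and eq: "\<And>z. z \<noteq> 0 \<Longrightarrow> poly B (1 / z) \<noteq> 0 \<Longrightarrow> R (Fin z) = Fin (poly A (1 / z) / poly B (1 / z))"
    and O: "(\<lambda>z. ?S z + poly A (1 / z) / poly B (1 / z)) \<in> ?o"
    unfolding is_pade_approximant_def by blast
  from R' obtain A' B' where c': "continuous_on UNIV R'" and A': "degree A' \<le> n" and B': "degree B' \<le> n" "poly B' 0 \<noteq> 0"
    and eq': "\<And>z. z \<noteq> 0 \<Longrightarrow> poly B' (1 / z) \<noteq> 0 \<Longrightarrow> R' (Fin z) = Fin (poly A' (1 / z) / poly B' (1 / z))"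
    and O': "(\<lambda>z. ?S z + poly A' (1 / z) / poly B' (1 / z)) \<in> ?o"
    unfolding is_pade_approximant_def by blast
  have lim: "((\<lambda>z. poly C (1 / z)) \<longlongrightarrow> poly C 0) at_infinity" for C :: "complex poly"
    by (intro tendsto_intros one_divide_tendsto_0_at_infinity)
  have ev: "eventually (\<lambda>z. poly B (1 / z) \<noteq> 0) at_infinity" "eventually (\<lambda>z. poly B' (1 / z) \<noteq> 0) at_infinity"
    using tendsto_imp_eventually_ne[OF lim B(2)] tendsto_imp_eventually_ne[OF lim B'(2)] by auto
  let ?D = "A * B' - A' * B"
  have "(\<lambda>z. (?S z + poly A (1 / z) / poly B (1 / z)) - (?S z + poly A' (1 / z) / poly B' (1 / z))) \<in> ?o"
    by (rule sum_in_bigo(2)[OF O O'])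
  then have "(\<lambda>z. poly A (1 / z) / poly B (1 / z) - poly A' (1 / z) / poly B' (1 / z)) \<in> ?o" by simp
  moreover have "(\<lambda>z. poly B (1 / z) * poly B' (1 / z)) \<in> O[at_infinity](\<lambda>_. 1)"
    by (rule bigoI_tendsto[where c = "poly B 0 * poly B' 0"]) (use tendsto_mult[OF lim[of B] lim[of B']] in simp_all)
  ultimately have "(\<lambda>z. (poly A (1 / z) / poly B (1 / z) - poly A' (1 / z) / poly B' (1 / z)) * (poly B (1 / z) * poly B' (1 / z)))
      \<in> O[at_infinity](\<lambda>z. 1 / z ^ (n + n + 1) * 1)"
    by (rule landau_o.big.mult)
  moreover have "eventually (\<lambda>z. (poly A (1 / z) / poly B (1 / z) - poly A' (1 / z) / poly B' (1 / z)) * (poly B (1 / z) * poly B' (1 / z)) = poly ?D (1 / z)) at_infinity"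
    using ev by eventually_elim (simp add: field_simps)
  ultimately have "(\<lambda>z. poly ?D (1 / z)) \<in> O[at_infinity](\<lambda>z. 1 / z ^ Suc (n + n))"
    by (subst (asm) landau_o.big.in_cong) simp_all
  then have "?D = 0"
    using A B A' B' by (intro poly_inverse_bigo_eq_0[of _ "n + n"] degree_diff_le)
      (auto intro!: order_trans[OF degree_mult_le] add_mono)
  then have cross: "poly A w * poly B' w = poly A' w * poly B w" for w
    by (metis eq_iff_diff_eq_0 poly_mult)
  have fin: "finite {z. poly C (1 / z) = 0}" if "poly C 0 \<noteq> 0" for C :: "complex poly"
  proof -
    have "C \<noteq> 0" using that by auto
    then have "finite ((\<lambda>w. 1 / w) ` {w. poly C w = 0})" by (intro finite_imageI poly_roots_finite)
    moreover have "{z. poly C (1 / z) = 0} \<subseteq> (\<lambda>w. 1 / w) ` {w. poly C w = 0}"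
    proof
      fix z assume "z \<in> {z. poly C (1 / z) = 0}"
      then show "z \<in> (\<lambda>w. 1 / w) ` {w. poly C w = 0}" by (intro image_eqI[of _ _ "1 / z"]) auto
    qed
    ultimately show ?thesis using finite_subset by blast
  qed
  have "{z. R (Fin z) \<noteq> R' (Fin z)} \<subseteq> {0} \<union> {z. poly B (1 / z) = 0} \<union> {z. poly B' (1 / z) = 0}"
  proof
    fix z assume z: "z \<in> {z. R (Fin z) \<noteq> R' (Fin z)}"
    show "z \<in> {0} \<union> {z. poly B (1 / z) = 0} \<union> {z. poly B' (1 / z) = 0}"
    proof (rule ccontr)
      assume "\<not> ?thesis"
      then have nz: "z \<noteq> 0" "poly B (1 / z) \<noteq> 0" "poly B' (1 / z) \<noteq> 0" by auto
      then have "poly A (1 / z) / poly B (1 / z) = poly A' (1 / z) / poly B' (1 / z)"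
        using cross[of "1 / z"] by (simp add: frac_eq_eq)
      then show False using z eq[OF nz(1,2)] eq'[OF nz(1,3)] by simp
    qed
  qed
  moreover have "finite ({0} \<union> {z. poly B (1 / z) = 0} \<union> {z. poly B' (1 / z) = 0})"
    using fin B(2) B'(2) by auto
  ultimately have "finite {z. R (Fin z) \<noteq> R' (Fin z)}" by (rule finite_subset)
  then show ?thesis by (rule continuous_on_csphere_unique[OF c c'])
qed

section \<open>Convergence of the diagonal Pade approximants\<close>

lemma rexp_bigo:
  assumes f: "rexp f A" and A: "\<And>n. n < N \<Longrightarrow> fps_nth A n = 0"
  shows "f \<in> O[at_infinity](\<lambda>z. 1 / z ^ N)"
proof (rule bigoI_tendsto)
  show "((\<lambda>z. f z / (1 / z ^ N)) \<longlongrightarrow> complex_of_real (fps_nth (fps_shift N A) 0)) at_infinity"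
    using rexp_tendsto[OF rexp_shift[OF f A]] by (simp add: mult.commute)
  show "eventually (\<lambda>z::complex. 1 / z ^ N \<noteq> 0) at_infinity"
    using eventually_nonzero_at_infinity by eventually_elim simp
qed

lemma inverse_power_bigo: "m \<le> n \<Longrightarrow> (\<lambda>z::complex. 1 / z ^ n) \<in> O[at_infinity](\<lambda>z. 1 / z ^ m)"
proof (rule bigoI[where c = 1], rule eventually_at_infinityI[of 1])
  fix z :: complex assume "m \<le> n" "1 \<le> cmod z"
  then have "cmod z ^ m \<le> cmod z ^ n" "cmod z > 0" by (auto intro: power_increasing)
  then show "norm (1 / z ^ n) \<le> 1 * norm (1 / z ^ m)"
    by (simp add: norm_divide norm_power) (intro frac_le, auto)
qed

context shifted_moments
begin

text \<open>The Pade approximant \<open>- V j / G j\<close> as a map of the sphere, and its numerator and denominator in the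
  coordinate \<open>1 / z\<close>.\<close>

definition padeR :: "nat \<Rightarrow> csphere \<Rightarrow> csphere" where
  "padeR j p = (case p of Fin z \<Rightarrow> ratio (- cp (V j) z) (cp (G j) z) | Infty \<Rightarrow> ratio 0 1)"

definition padeA :: "nat \<Rightarrow> complex poly" where
  "padeA j = - (monom 1 (\<nu> j - degree (V j)) * reflect_poly (map_poly complex_of_real (V j)))"

definition padeB :: "nat \<Rightarrow> complex poly" where
  "padeB j = reflect_poly (map_poly complex_of_real (G j))"

lemma degree_map_poly_real [simp]: "degree (map_poly complex_of_real p) = degree p"
  by (rule degree_map_poly) auto

lemma V_degree_le: "degree (V j) \<le> \<nu> j"
  using V_degree[of j] by auto

lemma poly_padeA: "z \<noteq> 0 \<Longrightarrow> poly (padeA j) (1 / z) = - cp (V j) z / z ^ \<nu> j"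
  using V_degree_le[of j]
  by (simp add: padeA_def poly_monom poly_reflect_inverse cp_def power_divide flip: power_add)

lemma poly_padeB: "z \<noteq> 0 \<Longrightarrow> poly (padeB j) (1 / z) = cp (G j) z / z ^ \<nu> j"
  by (simp add: padeB_def poly_reflect_inverse cp_def G_degree)

lemma padeA_degree: "degree (padeA j) \<le> \<nu> j"
proof -
  have "degree (padeA j) \<le> degree (monom (1::complex) (\<nu> j - degree (V j))) + degree (reflect_poly (map_poly complex_of_real (V j)))"
    unfolding padeA_def degree_minus by (rule degree_mult_le)
  also have "\<dots> \<le> (\<nu> j - degree (V j)) + degree (V j)"
    using degree_reflect_poly_le[of "map_poly complex_of_real (V j)"] by (intro add_mono degree_monom_le) simp
  finally show ?thesis using V_degree_le[of j] by simp
qed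

lemma padeB_degree: "degree (padeB j) \<le> \<nu> j"
  using degree_reflect_poly_le[of "map_poly complex_of_real (G j)"] by (simp add: padeB_def G_degree)

lemma padeA_0: "poly (padeA j) 0 = 0"
  using V_degree[of j] by (auto simp: padeA_def poly_monom)

lemma padeB_0: "poly (padeB j) 0 = 1"
  by (simp add: padeB_def poly_0_coeff_0 coeff_map_poly G_lead G_degree)

lemma ratio_scale: "c \<noteq> 0 \<Longrightarrow> ratio (a / c) (b / c) = ratio a b"
  by (simp add: ratio_def)

lemma pade_continuous: "continuous_on UNIV (padeR j)"
proof -
  have "continuous_on UNIV (\<lambda>p. case p of Fin z \<Rightarrow> ratio (- cp (V j) z) (cp (G j) z)
     | Infty \<Rightarrow> ratio (poly (padeA j) 0) (poly (padeB j) 0))"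
  proof (rule continuous_rational)
    show "continuous_on UNIV (\<lambda>z. - cp (V j) z)" "continuous_on UNIV (cp (G j))"
      unfolding cp_def[abs_def] by (intro continuous_intros)+
    show "- cp (V j) z \<noteq> 0 \<or> cp (G j) z \<noteq> 0" for z using G_V_no_common_zero by auto
    show "ratio (- cp (V j) z) (cp (G j) z) = ratio (poly (padeA j) (1 / z)) (poly (padeB j) (1 / z))" if "z \<noteq> 0" for z
      unfolding poly_padeA[OF that] poly_padeB[OF that] by (rule ratio_scale[symmetric]) (use that in simp)
  qed (simp_all add: padeB_0)
  then show ?thesis unfolding padeR_def[abs_def] padeA_0 padeB_0 .
qed

lemma rt_1_expansion_bigo:
  "(\<lambda>z. rt 1 z + (\<Sum>j<n. complex_of_real (\<ss> j) / z ^ (j + 1))) \<in> O[at_infinity](\<lambda>z. 1 / z ^ Suc n)"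
proof (rule rexp_bigo)
  let ?A = "Abs_fps (\<lambda>n. if n = 0 then 0 else - sf (1 * monom 1 (n - 1))) + (\<Sum>j<n. fps_const (\<ss> j) * fps_X ^ (j + 1))"
  show "rexp (\<lambda>z. rt 1 z + (\<Sum>j<n. complex_of_real (\<ss> j) / z ^ (j + 1))) ?A"
    by (intro rexp_add rt_rexp rexp_sum_powers)
  fix i assume i: "i < Suc n"
  show "fps_nth ?A i = 0"
  proof (cases i)
    case (Suc k)
    then have "k < n" using i by simp
    then show ?thesis using Suc by (simp add: fps_sum_nth fps_X_power_nth \<ss>_eq if_distrib cong: if_cong)
  qed (simp add: fps_sum_nth)
qed

lemma eventually_G_nz: "eventually (\<lambda>z. cp (G j) z \<noteq> 0) at_infinity"
proof -
  have "((\<lambda>z. poly (padeB j) (1 / z)) \<longlongrightarrow> poly (padeB j) 0) at_infinity"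
    by (intro tendsto_intros one_divide_tendsto_0_at_infinity)
  then have "eventually (\<lambda>z. poly (padeB j) (1 / z) \<noteq> 0) at_infinity"
    by (rule tendsto_imp_eventually_ne) (simp add: padeB_0)
  then show ?thesis using eventually_nonzero_at_infinity by eventually_elim (auto simp: poly_padeB)
qed

lemma inverse_G_bigo: "(\<lambda>z. 1 / cp (G j) z) \<in> O[at_infinity](\<lambda>z. 1 / z ^ \<nu> j)"
proof (rule bigoI_tendsto[where c = 1])
  have "((\<lambda>z. inverse (poly (padeB j) (1 / z))) \<longlongrightarrow> inverse (poly (padeB j) 0)) at_infinity"
    by (intro tendsto_intros one_divide_tendsto_0_at_infinity) (simp add: padeB_0)
  then have l: "((\<lambda>z. inverse (poly (padeB j) (1 / z))) \<longlongrightarrow> 1) at_infinity" by (simp add: padeB_0)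
  show "((\<lambda>z. 1 / cp (G j) z / (1 / z ^ \<nu> j)) \<longlongrightarrow> 1) at_infinity"
    by (rule Lim_transform_eventually[OF l])
      (use eventually_nonzero_at_infinity in eventually_elim, simp add: poly_padeB)
  show "eventually (\<lambda>z::complex. 1 / z ^ \<nu> j \<noteq> 0) at_infinity"
    using eventually_nonzero_at_infinity by eventually_elim simp
qed

lemma pade_error: "z \<in> off \<Longrightarrow> cp (G j) z \<noteq> 0 \<Longrightarrow> rt 1 z + cp (V j) z / cp (G j) z = rt (G j) z / cp (G j) z"
  by (simp add: rt_G field_simps)

lemma is_pade: "is_pade_approximant \<ss> (\<nu> j) (\<nu> j) (padeR j)"
  unfolding is_pade_approximant_def
proof (rule conjI[OF pade_continuous], rule exI[of _ "padeA j"], rule exI[of _ "padeB j"], intro conjI allI impI)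
  fix z assume z: "z \<noteq> 0 \<and> poly (padeB j) (1 / z) \<noteq> 0"
  then show "padeR j (Fin z) = Fin (poly (padeA j) (1 / z) / poly (padeB j) (1 / z))"
    by (auto simp: padeR_def poly_padeA poly_padeB ratio_def)
next
  let ?S = "\<lambda>z. \<Sum>i<\<nu> j + \<nu> j. complex_of_real (\<ss> i) / z ^ (i + 1)"
  let ?o = "O[at_infinity](\<lambda>z::complex. 1 / z ^ (\<nu> j + \<nu> j + 1))"
  have 1: "(\<lambda>z. rt 1 z + ?S z) \<in> ?o" using rt_1_expansion_bigo[of "\<nu> j + \<nu> j"] by simp
  obtain B where B: "rexp (rt (G j)) (fps_X ^ \<nu> (Suc j) * B)" by (rule rt_G_rexp)
  have "rt (G j) \<in> O[at_infinity](\<lambda>z. 1 / z ^ \<nu> (Suc j))"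
    by (rule rexp_bigo[OF B]) (simp add: fps_X_power_mult_nth)
  then have "rt (G j) \<in> O[at_infinity](\<lambda>z. 1 / z ^ Suc (\<nu> j))"
    by (rule landau_o.big_trans) (rule inverse_power_bigo, use \<nu>_less[of j] in simp)
  then have "(\<lambda>z. rt (G j) z * (1 / cp (G j) z)) \<in> O[at_infinity](\<lambda>z. 1 / z ^ Suc (\<nu> j) * (1 / z ^ \<nu> j))"
    by (rule landau_o.big.mult) (rule inverse_G_bigo)
  then have 2: "(\<lambda>z. rt (G j) z / cp (G j) z) \<in> ?o" by (simp add: power_add mult_ac)
  have "(\<lambda>z. (rt 1 z + ?S z) - rt (G j) z / cp (G j) z) \<in> ?o" by (rule sum_in_bigo(2)[OF 1 2])
  moreover have "eventually (\<lambda>z. (rt 1 z + ?S z) - rt (G j) z / cp (G j) z = ?S z + poly (padeA j) (1 / z) / poly (padeB j) (1 / z)) at_infinity"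
    using eventually_off eventually_G_nz[of j] eventually_nonzero_at_infinity
  proof eventually_elim
    case (elim z)
    have "poly (padeA j) (1 / z) / poly (padeB j) (1 / z) = - (cp (V j) z / cp (G j) z)"
      unfolding poly_padeA[OF elim(3)] poly_padeB[OF elim(3)] using elim by simp
    then show ?case using pade_error[OF elim(1,2)] by (simp add: algebra_simps)
  qed
  ultimately show "(\<lambda>z. ?S z + poly (padeA j) (1 / z) / poly (padeB j) (1 / z)) \<in> ?o"
    by (subst (asm) landau_o.big.in_cong) simp_all
qed (simp_all add: padeA_degree padeB_degree padeB_0)

lemma pade_eq: "pade \<ss> (\<nu> j) (\<nu> j) = padeR j"
  unfolding pade_def by (rule the_equality) (use is_pade pade_unique in blast)+

lemma rt_G_ct: assumes "j > 0" shows "rt (G j) z = ct (G j) z / z"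
proof -
  have "\<nu> (Suc j) - 1 > 0" using \<nu>_less[of j] \<nu>_pos[OF assms] by simp
  then have "sf (G j) = 0" using sf_G_less[of 0 j] by (simp add: monom_0)
  then show ?thesis by (simp add: rt_def)
qed

lemma lint_G_square_le:
  assumes "\<bar>\<delta> j\<bar> \<le> C" shows "lint (G j * G j) \<le> (1 + C\<^sup>2) * lint 1"
proof (cases "j = 0")
  case True
  have "1 * lint 1 \<le> (1 + C\<^sup>2) * lint 1" using lint_1_pos by (intro mult_right_mono) auto
  then show ?thesis using True by (simp add: G_0)
next
  case False
  then have pos: "\<nu> j > 0" by (intro \<nu>_pos) simp
  let ?p = "P (\<nu> j)" and ?q = "P (\<nu> j - 1)"
  have "G j * G j = ?p * ?p - (Polynomial.smult (\<delta> j) (?p * ?q) + Polynomial.smult (\<delta> j) (?p * ?q)) + Polynomial.smult ((\<delta> j)\<^sup>2) (?q * ?q)"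
    using False by (simp add: G_def power2_eq_square algebra_simps)
  then have "lint (G j * G j) = lint (?p * ?p) - (\<delta> j * lint (?p * ?q) + \<delta> j * lint (?p * ?q)) + (\<delta> j)\<^sup>2 * lint (?q * ?q)"
    by (simp only: lint_add lint_diff lint_smult)
  moreover have "lint (?p * ?q) = 0" using pos by (intro P_orth) (simp add: P_degree)
  ultimately have "lint (G j * G j) = h (\<nu> j) + (\<delta> j)\<^sup>2 * h (\<nu> j - 1)" by (simp add: h_def)
  also have "\<dots> \<le> lint 1 + C\<^sup>2 * lint 1"
  proof (intro add_mono mult_mono h_le)
    show "(\<delta> j)\<^sup>2 \<le> C\<^sup>2" using assms by (metis abs_ge_zero power2_abs power_mono)
    show "0 \<le> h (\<nu> j - 1)" using h_pos less_imp_le by blast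
  qed auto
  finally show ?thesis by (simp add: algebra_simps)
qed

text \<open>From the recurrence, with \<open>\<bar>\<beta> n\<bar> \<le> 1\<close> and \<open>\<gamma> n \<le> 1\<close>.\<close>

lemma P_growth:
  assumes z: "cmod z \<ge> 4"
  shows "cp (P n) z \<noteq> 0" "cmod (cp (P (Suc n)) z) \<ge> (cmod z - 2) * cmod (cp (P n) z)"
proof -
  have "cp (P n) z \<noteq> 0 \<and> cmod (cp (P (Suc n)) z) \<ge> (cmod z - 2) * cmod (cp (P n) z)"
  proof (induction n)
    case 0
    have "cmod (z - complex_of_real (\<beta> 0)) \<ge> cmod z - 1"
      using norm_triangle_ineq2[of z "complex_of_real (\<beta> 0)"] \<beta>_le[of 0] by simp
    then show ?case by (simp add: P_0 P_Suc_0 cp_pCons)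
  next
    case (Suc n)
    let ?a = "cmod (cp (P n) z)" and ?b = "cmod (cp (P (Suc n)) z)"
    have ab: "(cmod z - 2) * ?a \<le> ?b" and a: "?a > 0" using Suc by auto
    have le: "?a \<le> ?b"
    proof -
      have "1 * ?a \<le> (cmod z - 2) * ?a" using z by (intro mult_right_mono) auto
      then show ?thesis using ab by simp
    qed
    have eq: "cp (P (Suc (Suc n))) z = (z - complex_of_real (\<beta> (Suc n))) * cp (P (Suc n)) z - complex_of_real (\<gamma> n) * cp (P n) z"
      by (simp only: P_Suc_Suc cp_diff cp_mult cp_smult) (simp add: cp_pCons)
    have "cmod (cp (P (Suc (Suc n))) z) \<ge> cmod (z - complex_of_real (\<beta> (Suc n))) * ?b - \<gamma> n * ?a"
      unfolding eq using norm_triangle_ineq2[of "(z - complex_of_real (\<beta> (Suc n))) * cp (P (Suc n)) z" "complex_of_real (\<gamma> n) * cp (P n) z"]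
        \<gamma>_pos[of n] by (simp add: norm_mult)
    moreover have "cmod (z - complex_of_real (\<beta> (Suc n))) * ?b \<ge> (cmod z - 1) * ?b"
      using norm_triangle_ineq2[of z "complex_of_real (\<beta> (Suc n))"] \<beta>_le[of "Suc n"]
      by (intro mult_right_mono) auto
    moreover have "\<gamma> n * ?a \<le> 1 * ?b" using \<gamma>_le[of n] le \<gamma>_pos[of n] by (intro mult_mono) auto
    ultimately have "(cmod z - 2) * ?b \<le> cmod (cp (P (Suc (Suc n))) z)" by (simp add: algebra_simps)
    moreover have "cp (P (Suc n)) z \<noteq> 0" using a le by auto
    ultimately show ?case by blast
  qed
  then show "cp (P n) z \<noteq> 0" "cmod (cp (P (Suc n)) z) \<ge> (cmod z - 2) * cmod (cp (P n) z)" by auto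
qed

lemma P_growth_power:
  assumes z: "cmod z \<ge> 4" shows "cmod (cp (P n) z) \<ge> 2 ^ n"
proof (induction n)
  case 0
  show ?case by (simp add: P_0)
next
  case (Suc n)
  have "2 * 2 ^ n \<le> (cmod z - 2) * cmod (cp (P n) z)" using Suc z by (intro mult_mono) auto
  then show ?case using P_growth(2)[OF z, of n] by simp
qed

text \<open>Far from the interval the term with \<open>\<delta> j\<close> is at most half of the leading one.\<close>

lemma error_large:
  assumes C: "\<bar>\<delta> j\<bar> \<le> C" and z: "cmod z \<ge> 4 + 2 * C" and j: "j > 0"
  shows "cp (G j) z \<noteq> 0" "cmod (rt (G j) z / cp (G j) z) \<le> 2 * (lint 1 * sqrt (1 + C\<^sup>2)) * (1 / 2) ^ j"
proof -
  have C0: "C \<ge> 0" using C by simp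
  have z4: "cmod z \<ge> 4" using z C0 by simp
  obtain n where n: "\<nu> j = Suc n" using \<nu>_pos[OF j] by (cases "\<nu> j") auto
  have "G j = P (Suc n) - Polynomial.smult (\<delta> j) (P n)" using j n by (simp add: G_def)
  then have G: "cp (G j) z = cp (P (Suc n)) z - complex_of_real (\<delta> j) * cp (P n) z"
    by (simp add: cp_diff cp_smult)
  have "\<bar>\<delta> j\<bar> * cmod (cp (P n) z) \<le> (cmod z - 2) / 2 * cmod (cp (P n) z)"
    using C z by (intro mult_right_mono) auto
  then have "\<bar>\<delta> j\<bar> * cmod (cp (P n) z) \<le> cmod (cp (P (Suc n)) z) / 2"
    using P_growth(2)[OF z4, of n] by simp
  then have "cmod (cp (G j) z) \<ge> cmod (cp (P (Suc n)) z) / 2"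
    unfolding G using norm_triangle_ineq2[of "cp (P (Suc n)) z" "complex_of_real (\<delta> j) * cp (P n) z"]
    by (simp add: norm_mult)
  moreover have "2 ^ j \<le> (2::real) ^ Suc n" using \<nu>_ge[of j] n by (intro power_increasing) auto
  ultimately have low: "cmod (cp (G j) z) \<ge> 2 ^ j / 2" using P_growth_power[OF z4, of "Suc n"] by linarith
  have low0: "(0::real) < 2 ^ j / 2" by simp
  have "0 < cmod (cp (G j) z)" using low low0 by linarith
  then show nz: "cp (G j) z \<noteq> 0" by simp
  have D: "1 \<le> cmod (complex_of_real t - z)" if "t \<in> {-1..1}" for t
  proof -
    have "\<bar>t\<bar> \<le> 1" using that by auto
    then show ?thesis using norm_triangle_ineq2[of z "complex_of_real t"] z4 by (simp add: norm_minus_commute)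
  qed
  have "cmod (ct (G j) z) \<le> sqrt (lint 1 * lint (G j * G j)) / 1" by (rule norm_ct_le) (use D in auto)
  also have "\<dots> \<le> sqrt (lint 1 * ((1 + C\<^sup>2) * lint 1))"
    using lint_G_square_le[OF C] lint_1_pos by (simp add: mult_left_mono)
  also have "\<dots> = lint 1 * sqrt (1 + C\<^sup>2)" using lint_1_pos by (simp add: real_sqrt_mult)
  finally have num: "cmod (ct (G j) z) \<le> lint 1 * sqrt (1 + C\<^sup>2)" .
  have "cmod (rt (G j) z) \<le> cmod (ct (G j) z)"
    using z4 by (simp add: rt_G_ct[OF j] norm_divide divide_le_eq mult_le_cancel_left1)
  then have "cmod (rt (G j) z / cp (G j) z) \<le> lint 1 * sqrt (1 + C\<^sup>2) / (2 ^ j / 2)"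
    unfolding norm_divide using num low low0 order_trans[OF norm_ge_zero num] by (intro frac_le) linarith+
  then show "cmod (rt (G j) z / cp (G j) z) \<le> 2 * (lint 1 * sqrt (1 + C\<^sup>2)) * (1 / 2) ^ j"
    by (simp add: power_divide mult_ac)
qed

text \<open>At nonreal points the error is \<open>(ct (G j))\<^sup>2 / (z * (G j * ct (G j)))\<close>. The denominator is bounded below
  by its imaginary part, the numerator above by the expansion about \<open>a\<close>, both in terms of the norm of
  \<open>G j\<close>, which cancels.\<close>

lemma error_nonreal:
  assumes z: "Im z \<noteq> 0" and j: "j > 0"
    and T: "\<And>t. t \<in> {-1..1} \<Longrightarrow> cmod (complex_of_real t - a) \<le> \<kappa> * cmod (z - a)"
    and \<kappa>: "0 \<le> \<kappa>" "\<kappa> \<le> 1" "z \<noteq> a"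
  shows "cp (G j) z \<noteq> 0"
    "cmod (rt (G j) z / cp (G j) z) \<le> lint 1 * (cmod z + 1)\<^sup>2 / \<bar>Im z\<bar> ^ 4 * \<kappa> ^ (j - 1)"
proof -
  let ?y = "\<bar>Im z\<bar>" and ?g = "lint (G j * G j)"
  define m where "m = \<nu> j - 1"
  have off: "z \<in> off" by (rule off_nonreal[OF z])
  have pos: "\<nu> j > 0" by (rule \<nu>_pos[OF j])
  have y: "?y > 0" using z by simp
  have g: "?g > 0" by (rule lint_square_pos[OF G_nz])
  have orth: "lint (G j * monom 1 i) = 0" if "i < m" for i
    using that \<nu>_less[of j] by (intro lint_G(1)[OF j]) (simp add: m_def)
  have orth': "lint (r * G j) = 0" if "degree r < m" for r
    using lint_eq_0_if_orthogonal[of r "G j"] orth that by (simp add: mult.commute)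
  have "\<bar>Im (cp (G j) z * ct (G j) z)\<bar> = \<bar>Im (ct (G j * G j) z)\<bar>"
    using Im_ct_mult[OF off orth', of m "G j"] pos by (simp add: m_def G_degree)
  then have "?y / (cmod z + 1)\<^sup>2 * ?g \<le> \<bar>Im (cp (G j) z * ct (G j) z)\<bar>"
    using Im_ct_square[OF z, of "G j"] by simp
  also have "\<dots> \<le> cmod (cp (G j) z * ct (G j) z)" by (rule abs_Im_le_cmod)
  finally have low: "?y / (cmod z + 1)\<^sup>2 * ?g \<le> cmod (cp (G j) z) * cmod (ct (G j) z)" by (simp add: norm_mult)
  have zp: "cmod z + 1 > 0" by (simp add: add_nonneg_pos)
  have "0 < ?y / (cmod z + 1)\<^sup>2 * ?g"
    by (intro mult_pos_pos divide_pos_pos y g zero_less_power zp)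
  then have prod: "0 < cmod (cp (G j) z) * cmod (ct (G j) z)" using low by linarith
  then show nz: "cp (G j) z \<noteq> 0" by auto
  have D: "?y \<le> cmod (complex_of_real t - z)" for t
    using abs_Im_le_cmod[of "complex_of_real t - z"] by simp
  have za: "cmod (z - a) > 0" using \<kappa> by simp
  have "cmod ((z - a) ^ m * ct (G j) z) \<le> (\<kappa> * cmod (z - a)) ^ m / ?y * sqrt (lint 1 * ?g)"
  proof -
    have "(\<integral>t. complex_of_real (poly (G j) t) * (complex_of_real t - a) ^ m / (complex_of_real t - z) \<partial>\<sigma>) = (z - a) ^ m * ct (G j) z"
      by (rule ct_shift[OF off, where N = m]) (use orth in auto)
    then show ?thesis using norm_integral_le[OF y D T, of "G j" m] by simp
  qed
  then have "cmod (z - a) ^ m * cmod (ct (G j) z) \<le> cmod (z - a) ^ m * (\<kappa> ^ m / ?y * sqrt (lint 1 * ?g))"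
    by (simp add: norm_mult norm_power power_mult_distrib mult_ac)
  then have "cmod (ct (G j) z) \<le> \<kappa> ^ m / ?y * sqrt (lint 1 * ?g)"
    by (rule mult_left_le_imp_le) (rule zero_less_power[OF za])
  then have "(cmod (ct (G j) z))\<^sup>2 \<le> (\<kappa> ^ m / ?y * sqrt (lint 1 * ?g))\<^sup>2" by (intro power_mono) auto
  also have "\<dots> = (\<kappa> ^ m)\<^sup>2 / ?y\<^sup>2 * (lint 1 * ?g)"
    using lint_1_pos g by (simp add: power_mult_distrib power_divide)
  also have "\<dots> \<le> \<kappa> ^ (j - 1) / ?y\<^sup>2 * (lint 1 * ?g)"
  proof -
    have "(\<kappa> ^ m)\<^sup>2 = \<kappa> ^ (m * 2)" by (simp add: power_mult)
    also have "\<dots> \<le> \<kappa> ^ (j - 1)"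
      using \<kappa> \<nu>_ge[of j] by (intro power_decreasing) (auto simp: m_def)
    finally show ?thesis using lint_1_pos g by (intro mult_right_mono divide_right_mono) auto
  qed
  finally have num: "(cmod (ct (G j) z))\<^sup>2 \<le> \<kappa> ^ (j - 1) / ?y\<^sup>2 * (lint 1 * ?g)" .
  have ctp: "cmod (ct (G j) z) > 0" and Gp: "cmod (cp (G j) z) > 0" using prod by (auto simp: zero_less_mult_iff)
  have zy: "?y \<le> cmod z" by (rule abs_Im_le_cmod)
  have "cmod (rt (G j) z / cp (G j) z) = (cmod (ct (G j) z))\<^sup>2 / (cmod z * (cmod (cp (G j) z) * cmod (ct (G j) z)))"
    using ctp by (simp add: rt_G_ct[OF j] norm_divide norm_mult power2_eq_square)
  also have "\<dots> \<le> (\<kappa> ^ (j - 1) / ?y\<^sup>2 * (lint 1 * ?g)) / (?y * (?y / (cmod z + 1)\<^sup>2 * ?g))"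
  proof (rule frac_le)
    show "0 \<le> \<kappa> ^ (j - 1) / ?y\<^sup>2 * (lint 1 * ?g)" using order_trans[OF zero_le_power2 num] .
    show "0 < ?y * (?y / (cmod z + 1)\<^sup>2 * ?g)" using y \<open>0 < ?y / (cmod z + 1)\<^sup>2 * ?g\<close> by (rule mult_pos_pos)
    show "?y * (?y / (cmod z + 1)\<^sup>2 * ?g) \<le> cmod z * (cmod (cp (G j) z) * cmod (ct (G j) z))"
      using \<open>0 < ?y / (cmod z + 1)\<^sup>2 * ?g\<close> by (intro mult_mono[OF zy low]) auto
  qed (rule num)
  also have "\<dots> = lint 1 * (cmod z + 1)\<^sup>2 / ?y ^ 4 * \<kappa> ^ (j - 1)"
  proof -
    have "(A / Y\<^sup>2 * (L * g)) / (Y * (Y / B * g)) = L * B / Y ^ 4 * A"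
      if "Y > 0" "g > 0" "B > 0" for A B L Y g :: real
      using that by (simp add: field_simps power2_eq_square power4_eq_xxxx)
    from this[OF y g zero_less_power[OF zp]] show ?thesis .
  qed
  finally show "cmod (rt (G j) z / cp (G j) z) \<le> lint 1 * (cmod z + 1)\<^sup>2 / ?y ^ 4 * \<kappa> ^ (j - 1)" .
qed

lemma padeR_dist:
  assumes "z \<in> off" "cp (G j) z \<noteq> 0"
  shows "dist (padeR j (Fin z)) (Fin (rt 1 z)) \<le> 2 * cmod (rt (G j) z / cp (G j) z)"
proof -
  have eq: "rt (G j) z / cp (G j) z = rt 1 z + cp (V j) z / cp (G j) z"
    using pade_error[OF assms] by simp
  have "padeR j (Fin z) = Fin (- cp (V j) z / cp (G j) z)" using assms(2) by (simp add: padeR_def ratio_def)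
  then have "dist (padeR j (Fin z)) (Fin (rt 1 z)) \<le> 2 * cmod (- cp (V j) z / cp (G j) z - rt 1 z)"
    using dist_Fin_le by simp
  also have "cmod (- cp (V j) z / cp (G j) z - rt 1 z) = cmod (rt (G j) z / cp (G j) z)"
    unfolding eq by (subst norm_minus_cancel[symmetric]) simp
  finally show ?thesis .
qed

lemma uniform_limit_pade:
  assumes \<kappa>: "0 \<le> \<kappa>" "\<kappa> < 1"
    and S: "\<And>p. p \<in> S \<Longrightarrow> p = Infty \<or> (\<exists>z. p = Fin z \<and> z \<in> off \<and>
      (\<forall>j>0. cp (G j) z \<noteq> 0 \<and> cmod (rt (G j) z / cp (G j) z) \<le> K * \<kappa> ^ (j - 1)))"
  shows "uniform_limit S padeR (extend_zero (rt 1)) sequentially"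
proof (rule uniform_limitI)
  fix e :: real assume e: "e > 0"
  have "(\<lambda>j. 2 * (K * \<kappa> ^ j)) \<longlonglongrightarrow> 2 * (K * 0)"
    using \<kappa> by (intro tendsto_intros LIMSEQ_realpow_zero)
  then have "(\<lambda>j. 2 * (K * \<kappa> ^ j)) \<longlonglongrightarrow> 0" by simp
  then have "eventually (\<lambda>j. 2 * (K * \<kappa> ^ j) < e) sequentially" using e by (rule order_tendstoD)
  then obtain N where N: "\<And>j. j \<ge> N \<Longrightarrow> 2 * (K * \<kappa> ^ j) < e" unfolding eventually_sequentially by blast
  have "2 * (K * \<kappa> ^ (j - 1)) < e \<and> j > 0" if "j \<ge> Suc N" for j using N[of "j - 1"] that by simp
  then have "eventually (\<lambda>j. 2 * (K * \<kappa> ^ (j - 1)) < e \<and> j > 0) sequentially"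
    unfolding eventually_sequentially by blast
  then show "eventually (\<lambda>j. \<forall>p\<in>S. dist (padeR j p) (extend_zero (rt 1) p) < e) sequentially"
  proof eventually_elim
    case (elim j)
    show ?case
    proof
      fix p assume "p \<in> S"
      from S[OF this] show "dist (padeR j p) (extend_zero (rt 1) p) < e"
      proof
        assume "p = Infty"
        then show ?thesis using e by (simp add: padeR_def ratio_def extend_zero_def)
      next
        assume "\<exists>z. p = Fin z \<and> z \<in> off \<and> (\<forall>j>0. cp (G j) z \<noteq> 0 \<and> cmod (rt (G j) z / cp (G j) z) \<le> K * \<kappa> ^ (j - 1))"
        then obtain z where z: "p = Fin z" "z \<in> off" "cp (G j) z \<noteq> 0" "cmod (rt (G j) z / cp (G j) z) \<le> K * \<kappa> ^ (j - 1)"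
          using elim by blast
        show ?thesis using padeR_dist[OF z(2,3)] z(4) elim unfolding z(1) extend_zero_def by simp
      qed
    qed
  qed
qed

end

lemma neighbourhood_Fin:
  assumes "r > 0"
  obtains U where "open U" "Fin z0 \<in> U" "\<And>p. p \<in> U \<Longrightarrow> \<exists>z. p = Fin z \<and> dist z z0 < r"
proof -
  have "eventually (\<lambda>p. dist (zcoord p) z0 < r) (nhds (Fin z0))" by (rule tendstoD[OF tendsto_zcoord assms])
  then have "eventually (\<lambda>p. p \<noteq> Infty \<and> dist (zcoord p) z0 < r) (nhds (Fin z0))"
    using eventually_not_eq[OF csphere.distinct(1)[of z0]] by (simp add: eventually_conj_iff)
  then obtain U where U: "open U" "Fin z0 \<in> U" "\<And>p. p \<in> U \<Longrightarrow> p \<noteq> Infty \<and> dist (zcoord p) z0 < r"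
    unfolding eventually_nhds by blast
  show ?thesis
  proof (rule that[OF U(1,2)])
    fix p assume "p \<in> U"
    from U(3)[OF this] show "\<exists>z. p = Fin z \<and> dist z z0 < r" by (cases p) (auto simp: zcoord_Fin)
  qed
qed

lemma neighbourhood_Infty:
  assumes M: "M > 0"
  obtains U where "open U" "Infty \<in> U" "\<And>p. p \<in> U \<Longrightarrow> p = Infty \<or> (\<exists>z. p = Fin z \<and> cmod z > M)"
proof -
  have "eventually (\<lambda>p. dist (wcoord p) 0 < 1 / M) (nhds Infty)" by (rule tendstoD[OF tendsto_wcoord]) (use M in simp)
  then have "eventually (\<lambda>p. p \<noteq> Fin 0 \<and> dist (wcoord p) 0 < 1 / M) (nhds Infty)"
    using eventually_not_eq[OF csphere.distinct(2)[of 0]] by (simp add: eventually_conj_iff)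
  then obtain U where U: "open U" "Infty \<in> U" "\<And>p. p \<in> U \<Longrightarrow> p \<noteq> Fin 0 \<and> dist (wcoord p) 0 < 1 / M"
    unfolding eventually_nhds by blast
  show ?thesis
  proof (rule that[OF U(1,2)])
    fix p assume p: "p \<in> U"
    show "p = Infty \<or> (\<exists>z. p = Fin z \<and> cmod z > M)"
    proof (cases p)
      case (Fin z)
      then have "z \<noteq> 0" "cmod (1 / z) < 1 / M" using U(3)[OF p] by (auto simp: wcoord_Fin)
      then show ?thesis using Fin M by (simp add: norm_divide field_simps)
    qed simp
  qed
qed

text \<open>A centre from which a disc contains the interval but stays away from a given nonreal point and its
  neighbourhood. It lies on the far side of the real axis, on the vertical line through the point.\<close>

lemma separating_disc:
  assumes y0: "Im z0 \<noteq> 0"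
  shows "\<exists>a r \<kappa>. 0 < r \<and> r \<le> \<bar>Im z0\<bar> / 2 \<and> 0 \<le> \<kappa> \<and> \<kappa> < 1 \<and>
    (\<forall>z. dist z z0 < r \<longrightarrow> z \<noteq> a \<and> (\<forall>t\<in>{-1..1}. cmod (complex_of_real t - a) \<le> \<kappa> * cmod (z - a)))"
proof -
  define y where "y = \<bar>Im z0\<bar>"
  define A where "A = (1 + \<bar>Re z0\<bar>)\<^sup>2"
  \<comment> \<open>the depth at which the squared radius \<open>A + N\<^sup>2\<close> falls below \<open>(y + N)\<^sup>2 = y\<^sup>2 + 2 * A + N\<^sup>2\<close>\<close>
  define N where "N = A / y"
  define a where "a = Complex (Re z0) (- sgn (Im z0) * N)"
  define T where "T = sqrt (A + N\<^sup>2)"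
  define \<rho> where "\<rho> = (y + N + T) / 2"
  define r where "r = min (y / 2) ((y + N - T) / 2)"
  have y: "y > 0" using y0 by (simp add: y_def)
  have A: "A > 0" by (simp add: A_def add_pos_nonneg)
  have N: "N > 0" using y A by (simp add: N_def)
  have T0: "T \<ge> 0" using A by (simp add: T_def)
  have T: "T < y + N"
  proof -
    have "(y + N)\<^sup>2 = y\<^sup>2 + 2 * A + N\<^sup>2" using y by (simp add: N_def power2_eq_square field_simps)
    then have "A + N\<^sup>2 < (y + N)\<^sup>2" using A zero_le_power2[of y] by linarith
    then show ?thesis unfolding T_def using y N by (intro real_less_lsqrt) auto
  qed
  have \<rho>: "\<rho> > T" "\<rho> > 0" using T T0 by (simp_all add: \<rho>_def)
  have za: "cmod (z0 - a) = y + N"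
  proof -
    have "z0 - a = Complex 0 (sgn (Im z0) * (y + N))"
      by (simp add: complex_eq_iff a_def y_def sgn_real_def algebra_simps)
    then show ?thesis using y0 y N by (simp add: cmod_def power_mult_distrib sgn_real_def)
  qed
  have far: "cmod (z - a) \<ge> \<rho>" if "dist z z0 < r" for z
  proof -
    have "cmod (z0 - a) \<le> cmod (z - a) + cmod (z0 - z)" using norm_triangle_ineq[of "z - a" "z0 - z"] by simp
    moreover have "cmod (z0 - z) < (y + N - T) / 2" using that by (simp add: r_def dist_norm norm_minus_commute)
    ultimately show ?thesis unfolding za \<rho>_def by (simp add: field_simps)
  qed
  have near: "cmod (complex_of_real t - a) \<le> T" if "t \<in> {-1..1}" for t
  proof -
    have "\<bar>t - Re z0\<bar> \<le> 1 + \<bar>Re z0\<bar>" using that by auto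
    then have "(t - Re z0)\<^sup>2 \<le> A" unfolding A_def by (metis abs_ge_zero power2_abs power_mono)
    moreover have "(cmod (complex_of_real t - a))\<^sup>2 = (t - Re z0)\<^sup>2 + N\<^sup>2"
      using y0 by (simp add: cmod_power2 a_def power_mult_distrib sgn_real_def)
    ultimately show ?thesis unfolding T_def by (intro real_le_rsqrt) simp
  qed
  show ?thesis
  proof (rule exI[of _ a], rule exI[of _ r], rule exI[of _ "T / \<rho>"], intro conjI allI impI ballI)
    show "r > 0" using y T by (simp add: r_def)
    show "0 \<le> T / \<rho>" "T / \<rho> < 1" using T0 \<rho> by simp_all
    show "r \<le> \<bar>Im z0\<bar> / 2" by (simp add: r_def y_def)
    show "z \<noteq> a" if "dist z z0 < r" for z using far[OF that] \<rho> by auto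
    show "cmod (complex_of_real t - a) \<le> T / \<rho> * cmod (z - a)" if "dist z z0 < r" "t \<in> {-1..1}" for z t
    proof -
      have "T = T / \<rho> * \<rho>" using \<rho> by simp
      also have "\<dots> \<le> T / \<rho> * cmod (z - a)" using far[OF that(1)] T0 \<rho> by (intro mult_left_mono) auto
      finally show ?thesis using near[OF that(2)] by simp
    qed
  qed
qed

context shifted_moments
begin

text \<open>The removed interval is \<open>[-4 - 2C, 4 + 2C]\<close>, so that \<open>error_large\<close> applies near the remaining real
  points and near infinity.\<close>

lemma pade_converges:
  assumes C: "\<And>j. \<bar>\<delta> j\<bar> \<le> C"
  shows "locally_uniform_limit (UNIV - (\<lambda>x. Fin (complex_of_real x)) ` {-1 - (3 + 2 * C)..1 + (3 + 2 * C)})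
    padeR (extend_zero (rt 1))"
  unfolding locally_uniform_limit_def
proof
  fix x
  assume x: "x \<in> UNIV - (\<lambda>x. Fin (complex_of_real x)) ` {-1 - (3 + 2 * C)..1 + (3 + 2 * C)}"
  define M where "M = 4 + 2 * C"
  define D where "D = UNIV - (\<lambda>x. Fin (complex_of_real x)) ` {-1 - (3 + 2 * C)..1 + (3 + 2 * C)}"
  have C0: "C \<ge> 0" using C[of 0] by simp
  have M: "M > 0" "M \<ge> 4" using C0 by (simp_all add: M_def)
  have large: "z \<in> off \<and> (\<forall>j>0. cp (G j) z \<noteq> 0 \<and>
      cmod (rt (G j) z / cp (G j) z) \<le> 2 * (lint 1 * sqrt (1 + C\<^sup>2)) * (1 / 2) ^ (j - 1))" if z: "cmod z > M" for z
  proof (intro conjI allI impI)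
    show "z \<in> off" using z M by (intro off_large) simp
    fix j :: nat assume j: "j > 0"
    have z': "cmod z \<ge> 4 + 2 * C" using z by (simp add: M_def)
    show "cp (G j) z \<noteq> 0" by (rule error_large(1)[OF C z' j])
    have "(1 / 2 :: real) ^ j \<le> (1 / 2) ^ (j - 1)" by (rule power_decreasing) auto
    then have "2 * (lint 1 * sqrt (1 + C\<^sup>2)) * (1 / 2) ^ j \<le> 2 * (lint 1 * sqrt (1 + C\<^sup>2)) * (1 / 2) ^ (j - 1)"
      using lint_1_pos by (intro mult_left_mono) auto
    then show "cmod (rt (G j) z / cp (G j) z) \<le> 2 * (lint 1 * sqrt (1 + C\<^sup>2)) * (1 / 2) ^ (j - 1)"
      using error_large(2)[OF C z' j] by linarith
  qed
  have "\<exists>U. open U \<and> x \<in> U \<and> uniform_limit (U \<inter> D) padeR (extend_zero (rt 1)) sequentially"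
  proof (cases x)
    case Infty
    obtain U where U: "open U" "Infty \<in> U" "\<And>p. p \<in> U \<Longrightarrow> p = Infty \<or> (\<exists>z. p = Fin z \<and> cmod z > M)"
      using neighbourhood_Infty[OF M(1)] by blast
    have "uniform_limit (U \<inter> D) padeR (extend_zero (rt 1)) sequentially"
    proof (rule uniform_limit_pade[where \<kappa> = "1 / 2" and K = "2 * (lint 1 * sqrt (1 + C\<^sup>2))"])
      fix p assume "p \<in> U \<inter> D"
      then show "p = Infty \<or> (\<exists>z. p = Fin z \<and> z \<in> off \<and> (\<forall>j>0. cp (G j) z \<noteq> 0 \<and>
          cmod (rt (G j) z / cp (G j) z) \<le> 2 * (lint 1 * sqrt (1 + C\<^sup>2)) * (1 / 2) ^ (j - 1)))"
        using U(3)[of p] large by blast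
    qed simp_all
    then show ?thesis using U(1,2) Infty by blast
  next
    case (Fin z0)
    show ?thesis
    proof (cases "Im z0 = 0")
      case True
      then have z0: "z0 = complex_of_real (Re z0)" by (simp add: complex_eq_iff)
      have "Re z0 \<notin> {- M..M}"
      proof
        assume "Re z0 \<in> {- M..M}"
        then have "Fin (complex_of_real (Re z0)) \<in> (\<lambda>x. Fin (complex_of_real x)) ` {-1 - (3 + 2 * C)..1 + (3 + 2 * C)}"
          by (intro imageI) (simp add: M_def)
        then show False using x Fin z0 by simp
      qed
      then have "\<bar>Re z0\<bar> > M" by auto
      then have c: "cmod z0 > M" using abs_Re_le_cmod[of z0] by linarith
      obtain U where U: "open U" "Fin z0 \<in> U" "\<And>p. p \<in> U \<Longrightarrow> \<exists>z. p = Fin z \<and> dist z z0 < cmod z0 - M"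
        using neighbourhood_Fin[of "cmod z0 - M" z0] c by auto
      have near: "\<exists>z. p = Fin z \<and> cmod z > M" if p: "p \<in> U" for p
      proof -
        obtain z where z: "p = Fin z" "dist z z0 < cmod z0 - M" using U(3)[OF p] by blast
        then have "cmod z > M" using norm_triangle_ineq2[of z0 z] by (simp add: dist_norm norm_minus_commute)
        then show ?thesis using z by blast
      qed
      have "uniform_limit (U \<inter> D) padeR (extend_zero (rt 1)) sequentially"
      proof (rule uniform_limit_pade[where \<kappa> = "1 / 2" and K = "2 * (lint 1 * sqrt (1 + C\<^sup>2))"])
        fix p assume "p \<in> U \<inter> D"
        then show "p = Infty \<or> (\<exists>z. p = Fin z \<and> z \<in> off \<and> (\<forall>j>0. cp (G j) z \<noteq> 0 \<and>
            cmod (rt (G j) z / cp (G j) z) \<le> 2 * (lint 1 * sqrt (1 + C\<^sup>2)) * (1 / 2) ^ (j - 1)))"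
          using near[of p] large by blast
      qed simp_all
      then show ?thesis using U(1,2) Fin by blast
    next
      case False
      obtain a r \<kappa> where r: "r > 0" and r2: "r \<le> \<bar>Im z0\<bar> / 2" and \<kappa>: "0 \<le> \<kappa>" "\<kappa> < 1"
        and disc: "\<forall>z. dist z z0 < r \<longrightarrow> z \<noteq> a \<and> (\<forall>t\<in>{-1..1}. cmod (complex_of_real t - a) \<le> \<kappa> * cmod (z - a))"
        using separating_disc[OF False] by (elim exE conjE)
      have za: "z \<noteq> a" if "dist z z0 < r" for z using disc that by simp
      have T: "cmod (complex_of_real t - a) \<le> \<kappa> * cmod (z - a)" if "dist z z0 < r" "t \<in> {-1..1}" for z t
        using disc that by simp
      define K where "K = lint 1 * (cmod z0 + r + 1)\<^sup>2 / (\<bar>Im z0\<bar> / 2) ^ 4"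
      obtain U where U: "open U" "Fin z0 \<in> U" "\<And>p. p \<in> U \<Longrightarrow> \<exists>z. p = Fin z \<and> dist z z0 < r"
        using neighbourhood_Fin[OF r] by blast
      have near: "z \<in> off \<and> (\<forall>j>0. cp (G j) z \<noteq> 0 \<and> cmod (rt (G j) z / cp (G j) z) \<le> K * \<kappa> ^ (j - 1))"
        if z: "dist z z0 < r" for z
      proof -
        have "\<bar>Im z - Im z0\<bar> \<le> dist z z0" using abs_Im_le_cmod[of "z - z0"] by (simp add: dist_norm)
        then have im: "\<bar>Im z\<bar> \<ge> \<bar>Im z0\<bar> / 2" using z r2 by linarith
        then have im0: "Im z \<noteq> 0" using False by auto
        have cz: "cmod z \<le> cmod z0 + r" using z norm_triangle_ineq2[of z z0] by (simp add: dist_norm)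
        have "lint 1 * (cmod z + 1)\<^sup>2 / \<bar>Im z\<bar> ^ 4 \<le> K"
          unfolding K_def using lint_1_pos im cz False
          by (intro frac_le mult_left_mono power_mono) auto
        then have "lint 1 * (cmod z + 1)\<^sup>2 / \<bar>Im z\<bar> ^ 4 * \<kappa> ^ (j - 1) \<le> K * \<kappa> ^ (j - 1)" for j
          using \<kappa> by (intro mult_right_mono) auto
        then show ?thesis
          using error_nonreal[OF im0 _ T[OF z] \<kappa>(1) less_imp_le[OF \<kappa>(2)] za[OF z]] off_nonreal[OF im0]
            order_trans by blast
      qed
      have "uniform_limit (U \<inter> D) padeR (extend_zero (rt 1)) sequentially"
        by (rule uniform_limit_pade[OF \<kappa>, where K = K]) (use U(3) near in blast)
      then show ?thesis using U(1,2) Fin by blast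
    qed
  qed
  then show "\<exists>U. open U \<and> x \<in> U \<and> uniform_limit (U \<inter> (UNIV - (\<lambda>x. Fin (complex_of_real x)) ` {-1 - (3 + 2 * C)..1 + (3 + 2 * C)})) padeR (extend_zero (rt 1)) sequentially"
    unfolding D_def .
qed

text \<open>Values on the real axis outside the interval; \<open>s = -1\<close> is the reflection.\<close>

lemma P_signed_growth:
  assumes x: "x \<ge> 4" and s: "s = 1 \<or> s = (- 1 :: real)"
  shows "0 < s ^ n * poly (P n) (s * x)"
    "s ^ Suc n * poly (P (Suc n)) (s * x) \<le> (x + 2) * (s ^ n * poly (P n) (s * x))"
proof -
  define p where "p n = s ^ n * poly (P n) (s * x)" for n
  have ss: "s * s = 1" using s by auto
  have sb: "\<bar>s * \<beta> n\<bar> \<le> 1" for n using s \<beta>_le[of n] by auto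
  have p0: "p 0 = 1" by (simp add: p_def P_0)
  have p1: "p (Suc 0) = x - s * \<beta> 0"
    using ss by (simp add: p_def P_Suc_0 algebra_simps flip: mult.assoc)
  have p2: "p (Suc (Suc n)) = (x - s * \<beta> (Suc n)) * p (Suc n) - \<gamma> n * p n" for n
  proof -
    have "p (Suc (Suc n)) = (s * s) * x * p (Suc n) - s * \<beta> (Suc n) * p (Suc n) - (s * s) * \<gamma> n * p n"
      by (simp add: p_def P_Suc_Suc algebra_simps)
    then show ?thesis by (simp add: ss algebra_simps)
  qed
  have main: "0 < p n \<and> p n \<le> p (Suc n) \<and> p (Suc n) \<le> (x + 2) * p n" for n
  proof (induction n)
    case 0
    show ?case using sb[of 0] x by (auto simp: p0 p1 abs_le_iff)
  next
    case (Suc n)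
    have pos: "0 < p (Suc n)" using Suc by linarith
    have "\<gamma> n * p n \<le> 1 * p (Suc n)"
      using Suc \<gamma>_le[of n] \<gamma>_pos[of n] by (intro mult_mono) auto
    moreover have "0 \<le> \<gamma> n * p n" using Suc \<gamma>_pos[of n] by simp
    ultimately have g: "\<gamma> n * p n \<le> p (Suc n)" "0 \<le> \<gamma> n * p n" by simp_all
    have b: "(x - 1) * p (Suc n) \<le> (x - s * \<beta> (Suc n)) * p (Suc n)"
      "(x - s * \<beta> (Suc n)) * p (Suc n) \<le> (x + 1) * p (Suc n)"
      using sb[of "Suc n"] pos by (auto intro!: mult_right_mono simp: abs_le_iff)
    have "2 * p (Suc n) \<le> (x - 1) * p (Suc n)" using x pos by (intro mult_right_mono) auto
    then have "p (Suc n) \<le> p (Suc (Suc n))" using b(1) g(1) unfolding p2 by linarith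
    moreover have "p (Suc (Suc n)) \<le> (x + 2) * p (Suc n)"
      using b(2) g(2) pos unfolding p2 by (simp add: algebra_simps)
    ultimately show ?case using pos by blast
  qed
  show "0 < s ^ n * poly (P n) (s * x)"
    "s ^ Suc n * poly (P (Suc n)) (s * x) \<le> (x + 2) * (s ^ n * poly (P n) (s * x))"
    using main[of n] by (auto simp: p_def)
qed

text \<open>If \<open>s \<delta> j\<close> is too large, then \<open>G j\<close> changes sign on the half-line from \<open>s X\<close> to \<open>s \<infinity>\<close>.\<close>

lemma \<delta>_bound_if_no_zeros:
  assumes X: "X \<ge> 4" and j: "j > 0" and s: "s = 1 \<or> s = (- 1 :: real)"
    and nz: "\<And>z. cmod z > X \<Longrightarrow> cp (G j) z \<noteq> 0"
  shows "s * \<delta> j \<le> X + 2"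
proof (rule ccontr)
  assume "\<not> s * \<delta> j \<le> X + 2"
  then have big: "X + 2 < s * \<delta> j" by simp
  obtain m where m: "\<nu> j = Suc m" using \<nu>_pos[OF j] by (cases "\<nu> j") auto
  have ss: "s * s = 1" using s by auto
  have s1: "(s * s) ^ m = 1" by (simp add: ss)
  \<comment> \<open>the factor makes \<open>q\<close> monic, hence positive far out\<close>
  define q where "q = Polynomial.smult (s ^ \<nu> j) (pcompose (G j) [:0, s:])"
  have q: "poly q x = s ^ \<nu> j * poly (G j) (s * x)" for x by (simp add: q_def poly_pcompose mult.commute)
  have "lead_coeff q = s ^ \<nu> j * s ^ \<nu> j"
  proof -
    have "s \<noteq> 0" using s by auto
    then have "lead_coeff (pcompose (G j) [:0, s:]) = s ^ \<nu> j"
      by (subst lead_coeff_comp) (simp_all add: G_degree G_lead)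
    then show ?thesis by (simp add: q_def)
  qed
  also have "\<dots> = 1" by (simp add: ss flip: power_mult_distrib)
  finally have lq: "lead_coeff q = 1" .
  have "poly q X = s ^ Suc m * poly (P (Suc m)) (s * X) - s * \<delta> j * (s ^ m * poly (P m) (s * X))"
    using j m by (simp add: q G_def algebra_simps)
  also have "\<dots> \<le> (X + 2 - s * \<delta> j) * (s ^ m * poly (P m) (s * X))"
    using P_signed_growth(2)[OF X s, of m] by (simp add: algebra_simps)
  also have "\<dots> < 0" using big P_signed_growth(1)[OF X s, of m] by (intro mult_neg_pos) auto
  finally have neg: "poly q X < 0" .
  obtain N where N: "\<And>x. x \<ge> N \<Longrightarrow> lead_coeff q \<le> poly q x" using poly_pinfty_gt_lc[of q] lq by auto
  have pos: "0 < poly q (max N (X + 1))" using N[of "max N (X + 1)"] lq by simp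
  obtain x where x: "X < x" "poly q x = 0"
    using poly_IVT_pos[OF less_le_trans[OF less_add_one max.cobounded2] neg pos] by blast
  have "s \<noteq> 0" using s by auto
  then have "cp (G j) (complex_of_real (s * x)) = 0" using x(2) q[of x] by (simp add: cp_of_real del: of_real_mult)
  moreover have "cmod (complex_of_real (s * x)) > X" using s x(1) X by auto
  ultimately show False using nz by blast
qed

lemma \<delta>_bounded_if_pade_converges:
  assumes lim: "locally_uniform_limit (UNIV - (\<lambda>x. Fin (complex_of_real x)) ` {-1 - \<epsilon>..1 + \<epsilon>})
    padeR (extend_zero (rt 1))"
  shows "\<exists>C. \<forall>j. \<bar>\<delta> j\<bar> \<le> C"
proof -
  let ?D = "UNIV - (\<lambda>x. Fin (complex_of_real x)) ` {-1 - \<epsilon>..1 + \<epsilon>}"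
  have "Infty \<in> ?D" by auto
  then obtain U where U: "open U" "Infty \<in> U" "uniform_limit (U \<inter> ?D) padeR (extend_zero (rt 1)) sequentially"
    using lim unfolding locally_uniform_limit_def by blast
  have "eventually (\<lambda>j. \<forall>p\<in>U \<inter> ?D. dist (padeR j p) (extend_zero (rt 1) p) < 1) sequentially"
    by (rule uniform_limitD[OF U(3)]) simp
  then obtain J where J: "\<And>j p. j \<ge> J \<Longrightarrow> p \<in> U \<inter> ?D \<Longrightarrow> dist (padeR j p) (extend_zero (rt 1) p) < 1"
    unfolding eventually_sequentially by blast
  have "eventually (\<lambda>z. Fin z \<in> U) at_infinity"
    using tendsto_Fin_Infty U(1,2) by (rule topological_tendstoD)
  moreover have "eventually (\<lambda>z. dist (rt 1 z) 0 < 1) at_infinity"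
    using tendstoD[OF rexp_tendsto[OF rt_rexp[of 1]], of 1] by simp
  ultimately have "eventually (\<lambda>z. Fin z \<in> U \<and> cmod (rt 1 z) < 1) at_infinity"
    by eventually_elim simp
  then obtain M where M: "\<And>z. M \<le> cmod z \<Longrightarrow> Fin z \<in> U \<and> cmod (rt 1 z) < 1"
    unfolding eventually_at_infinity by blast
  define X where "X = max 4 (max M (1 + \<epsilon>))"
  have X: "X \<ge> 4" "X \<ge> M" "X \<ge> 1 + \<epsilon>" by (simp_all add: X_def)
  have nz: "cp (G j) z \<noteq> 0" if j: "j \<ge> J" and z: "cmod z > X" for j z
  proof
    assume 0: "cp (G j) z = 0"
    have "Fin z \<in> ?D" using z X(3) by auto
    then have p: "Fin z \<in> U \<inter> ?D" using M[of z] z X(2) by auto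
    have "padeR j (Fin z) = Infty" using 0 by (simp add: padeR_def ratio_def)
    then have "dist Infty (Fin (rt 1 z)) < 1" using J[OF j p] by (simp add: extend_zero_def)
    moreover have "dist Infty (Fin (rt 1 z)) \<ge> 1" using M[of z] z X(2) by (intro dist_Infty_Fin_ge) auto
    ultimately show False by simp
  qed
  have late: "\<bar>\<delta> j\<bar> \<le> X + 2" if "j \<ge> Suc J" for j
    using \<delta>_bound_if_no_zeros[OF X(1), of j 1] \<delta>_bound_if_no_zeros[OF X(1), of j "-1"] nz[of j] that
    by (auto simp: abs_le_iff)
  have "\<bar>\<delta> j\<bar> \<le> (X + 2) + (\<Sum>i\<le>J. \<bar>\<delta> i\<bar>)" for j
  proof (cases "j \<le> J")
    case True
    then have "\<bar>\<delta> j\<bar> \<le> (\<Sum>i\<le>J. \<bar>\<delta> i\<bar>)" by (intro member_le_sum) auto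
    then show ?thesis using X(1) by simp
  next
    case False
    then have "\<bar>\<delta> j\<bar> \<le> X + 2" using late[of j] by simp
    moreover have "0 \<le> (\<Sum>i\<le>J. \<bar>\<delta> i\<bar>)" by (rule sum_nonneg) simp
    ultimately show ?thesis by linarith
  qed
  then show ?thesis by blast
qed

lemma pade_convergence_iff:
  "(\<exists>\<epsilon>\<ge>0. locally_uniform_limit (UNIV - (\<lambda>x. Fin (complex_of_real x)) ` {-1 - \<epsilon>..1 + \<epsilon>})
      (\<lambda>j. pade \<ss> (\<nu> j) (\<nu> j)) (extend_zero (rt 1))) \<longleftrightarrow> (\<exists>C. \<forall>j. \<bar>\<delta> j\<bar> \<le> C)"
proof
  assume "\<exists>\<epsilon>\<ge>0. locally_uniform_limit (UNIV - (\<lambda>x. Fin (complex_of_real x)) ` {-1 - \<epsilon>..1 + \<epsilon>})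
      (\<lambda>j. pade \<ss> (\<nu> j) (\<nu> j)) (extend_zero (rt 1))"
  then show "\<exists>C. \<forall>j. \<bar>\<delta> j\<bar> \<le> C" unfolding pade_eq using \<delta>_bounded_if_pade_converges by blast
next
  assume "\<exists>C. \<forall>j. \<bar>\<delta> j\<bar> \<le> C"
  then obtain C where C: "\<And>j. \<bar>\<delta> j\<bar> \<le> C" by blast
  have "0 \<le> 3 + 2 * C" using C[of 0] by simp
  then show "\<exists>\<epsilon>\<ge>0. locally_uniform_limit (UNIV - (\<lambda>x. Fin (complex_of_real x)) ` {-1 - \<epsilon>..1 + \<epsilon>})
      (\<lambda>j. pade \<ss> (\<nu> j) (\<nu> j)) (extend_zero (rt 1))"
    unfolding pade_eq using pade_converges[OF C] by blast
qed

end

section \<open>Equivalence of boundedness and convergence\<close>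

theorem theorem6p9:
  fixes \<sigma> :: "real measure" and s_m1 :: real
    and F \<FF> :: "complex \<Rightarrow> complex" and \<ss> :: "nat \<Rightarrow> real" and \<nn> :: "nat \<Rightarrow> nat"
  assumes "finite_measure \<sigma>" and "sets \<sigma> = sets borel"
    and "emeasure \<sigma> (- {-1..1}) = 0" and "infinite (measure_support \<sigma>)"
    and "F = cauchy_transform \<sigma>"
    and "\<FF> = (\<lambda>z. 1 / z * F z - complex_of_real s_m1 / z)"
    and "\<FF> \<in> D_plus_minf"
    and "\<ss> = (\<lambda>j. if j = 0 then s_m1 else (\<integral>t. t ^ (j - 1) \<partial>\<sigma>))"
    and "\<nn> = normal_index \<ss>"
  shows "((\<exists>L U. block_LU_factors \<FF> L U \<and> bounded_in_l2 L)
            \<longleftrightarrow> (\<exists>U L. block_UL_factors \<sigma> s_m1 \<nn> U L \<and> bounded_in_l2 L))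
       \<and> ((\<exists>U L. block_UL_factors \<sigma> s_m1 \<nn> U L \<and> bounded_in_l2 L)
            \<longleftrightarrow> (\<exists>\<epsilon>\<ge>0. locally_uniform_limit
                   (UNIV - (\<lambda>x. Fin (complex_of_real x)) ` {-1 - \<epsilon>..1 + \<epsilon>})
                   (\<lambda>j. pade \<ss> (\<nn> j) (\<nn> j)) (extend_zero \<FF>)))"
proof -
  interpret S: shifted_moments \<sigma> s_m1
    by (rule shifted_moments.intro, rule interval_measure.intro) (fact assms)+
  have ss: "\<ss> = S.\<ss>" unfolding assms(8) S.\<ss>_def[abs_def] ..
  have nn: "\<nn> = S.\<nu>" unfolding assms(9) ss S.\<nu>_def ..
  have FF: "\<FF> = S.rt 1"
    unfolding assms(5,6) by (simp add: fun_eq_iff S.rt_def S.cauchy_transform_eq_ct S.sf_1 diff_divide_distrib)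
  have ev: "eventually (\<lambda>z. \<FF> z = S.rt 1 z) at_infinity" by (simp add: FF)
  have LU: "(\<exists>L U. block_LU_factors \<FF> L U \<and> bounded_in_l2 L) \<longleftrightarrow> (\<exists>C. \<forall>j. \<bar>S.\<delta> j\<bar> \<le> C)"
    by (rule S.block_LU_bounded_iff) (rule S.gj_identification[OF ev])+
  have UL: "(\<exists>U L. block_UL_factors \<sigma> s_m1 \<nn> U L \<and> bounded_in_l2 L) \<longleftrightarrow> (\<exists>C. \<forall>j. \<bar>S.\<delta> j\<bar> \<le> C)"
    unfolding nn by (rule S.block_UL_bounded_iff)
  show ?thesis unfolding LU UL unfolding ss nn FF S.pade_convergence_iff by simp
qed

end
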